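(* Let $D$ be a weakly locally finite division ring, let $n\ge1$, and let $G$ be an infinite almost subnormal subgroup of $\mathrm{GL}_n(D)$. If $G$ is finitely generated, then $G$ is central, i.e. contained in the center of $\mathrm{GL}_n(D)$.
   Context: A division ring $D$ is weakly locally finite if every finite subset of $D$ generates a division subring that is finite-dimensional over its own center. A subgroup $H$ of a group $K$ is almost subnormal in $K$ if there is a chain of subgroups $H=H_r\le H_{r-1}\le\cdots\le H_1=K$ such that for each $1<i\le r$, either $H_i$ is normal in $H_{i-1}$ or $H_i$ has finite index in $H_{i-1}$. *)

theory Defs
  imports "Jordan_Normal_Form.Matrix" "HOL-Algebra.Generated_Groups" "HOL-Algebra.Coset"
begin

definition div_subring :: "'a::division_ring set \<Rightarrow> bool" where
  "div_subring K \<longleftrightarrow> 0 \<in> K \<and> 1 \<in> K \<and>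
     (\<forall>x\<in>K. \<forall>y\<in>K. x + y \<in> K \<and> x * y \<in> K) \<and>
     (\<forall>x\<in>K. - x \<in> K \<and> inverse x \<in> K)"

definition div_subring_gen :: "'a::division_ring set \<Rightarrow> 'a set" where
  "div_subring_gen S = \<Inter>{K. div_subring K \<and> S \<subseteq> K}"

definition ctr :: "'a::division_ring set \<Rightarrow> 'a set" where
  "ctr K = {z \<in> K. \<forall>x\<in>K. z * x = x * z}"

definition fin_dim_over_center :: "'a::division_ring set \<Rightarrow> bool" where
  "fin_dim_over_center K \<longleftrightarrow>
     (\<exists>B. finite B \<and> B \<subseteq> K \<and>
        (\<forall>x\<in>K. \<exists>c. (\<forall>b\<in>B. c b \<in> ctr K) \<and> x = (\<Sum>b\<in>B. c b * b)))"

definition weakly_locally_finite :: "'a::division_ring itself \<Rightarrow> bool" where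
  "weakly_locally_finite TYPE('a) \<longleftrightarrow>
     (\<forall>S::'a set. finite S \<longrightarrow> fin_dim_over_center (div_subring_gen S))"

definition GL :: "nat \<Rightarrow> 'a::division_ring mat monoid" where
  "GL n = units_of (ring_mat TYPE('a) n ())"

definition group_center :: "('a, 'b) monoid_scheme \<Rightarrow> 'a set" where
  "group_center K = {z \<in> carrier K. \<forall>x\<in>carrier K. z \<otimes>\<^bsub>K\<^esub> x = x \<otimes>\<^bsub>K\<^esub> z}"

definition almost_subnormal :: "'a set \<Rightarrow> ('a, 'b) monoid_scheme \<Rightarrow> bool" where
  "almost_subnormal H K \<longleftrightarrow>
     (\<exists>r::nat. \<exists>Hs::nat \<Rightarrow> 'a set. r \<ge> 1 \<and> Hs 1 = carrier K \<and> Hs r = H \<and>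
        (\<forall>i\<in>{1..r}. subgroup (Hs i) K) \<and>
        (\<forall>i. 1 < i \<and> i \<le> r \<longrightarrow> Hs i \<subseteq> Hs (i - 1) \<and>
            (Hs i \<lhd> K\<lparr>carrier := Hs (i - 1)\<rparr> \<or>
             finite (rcosets\<^bsub>K\<lparr>carrier := Hs (i - 1)\<rparr>\<^esub> (Hs i)))))"

end

theory Submission
  imports Defs
begin

text \<open>Suppose that some \<open>g \<in> G\<close> is not central. Weak local finiteness places the finitely many relevant
  matrix entries in a division ring \<open>D\<close> that is either finite, in which case \<open>G\<close> is finite, or of finite
  dimension over a central subfield \<open>Frac A\<close>, where \<open>A\<close> is the ring of integers or a polynomial ring
  \<open>K[s]\<close>. As \<open>G\<close> is finitely generated, its entries lie in an order over some \<open>A[1/v]\<close>. Every nonconstant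
  polynomial over \<open>Frac A\<close> takes a value that is not invertible in \<open>A[1/v]\<close>, so a rational function of
  \<open>t \<in> A\<close> with values in this order has no pole.

  On the other hand, iterated commutators with \<open>g\<close>, combined with powers of fixed exponents, carry every
  \<open>x \<in> GL\<^sub>n(D)\<close> down the almost subnormal chain into \<open>G\<close>. Apply this to a family \<open>x(t)\<close> such that \<open>x(t)\<close>
  and its inverse have rank one polar parts at the same place, in general position with respect to \<open>g\<close>:
  the leading coefficients multiply to a nonzero rank one operator, and the word keeps its pole. For
  \<open>n \<ge> 2\<close> take \<open>x(t) = 1 + t\<^sup>-\<^sup>1 u \<phi>\<close> with \<open>\<phi> u = 0\<close>. For \<open>n = 1\<close> take \<open>x(t) = (a - t) h (a - t)\<^sup>-\<^sup>1\<close>,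
  where \<open>a\<close> does not commute with \<open>g\<close>; the place is the minimal polynomial of \<open>a\<close> over the center of \<open>D\<close>,
  and replacing \<open>t\<close> by right multiplication by \<open>a\<close> turns leading coefficients into operators on \<open>D\<close>.\<close>

section \<open>Linear algebra over a division subring\<close>

text \<open>The obstacle is cancellation: a commutator of two families with a pole may have no pole.
  Here the leading coefficients have the form \<open>v \<mapsto> \<delta> * y v\<close>, where
  \<open>y\<close> takes values in the centralizer of \<open>a\<close> and is linear over it from
  the right. Composing such operators only multiplies scalars of that centralizer, which is a
  division ring, so finitely many inequalities arranged at the start survive words of every length.

  The place is governed by two minimal polynomials of \<open>a\<close>. Nonunit values are available
  over \<open>Frac A\<close> only, whereas \<open>y \<noteq> 0\<close> rests on minimality over the
  center of \<open>D\<close>. The polynomial over the center divides the other one, so a bound on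
  denominators for one yields the absence of a pole for the other.

  The center of a division ring generated by finitely many entries need not be finitely generated.
  Only the structure constants of a finite spanning set matter, and these generate a subfield small
  enough to be analyzed one generator at a time.\<close>

definition is_subring :: "'a::division_ring set \<Rightarrow> bool" where
  "is_subring A \<longleftrightarrow> 0 \<in> A \<and> 1 \<in> A \<and>
     (\<forall>x\<in>A. \<forall>y\<in>A. x + y \<in> A \<and> x * y \<in> A) \<and> (\<forall>x\<in>A. - x \<in> A)"

lemma is_subringD:
  assumes "is_subring K"
  shows "0 \<in> K" "1 \<in> K" "x \<in> K \<Longrightarrow> y \<in> K \<Longrightarrow> x + y \<in> K"
    "x \<in> K \<Longrightarrow> y \<in> K \<Longrightarrow> x * y \<in> K" "x \<in> K \<Longrightarrow> - x \<in> K"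
    "x \<in> K \<Longrightarrow> y \<in> K \<Longrightarrow> x - y \<in> K" "x \<in> K \<Longrightarrow> x ^ k \<in> K"
proof -
  show *: "0 \<in> K" "1 \<in> K" "x \<in> K \<Longrightarrow> y \<in> K \<Longrightarrow> x + y \<in> K"
    "x \<in> K \<Longrightarrow> y \<in> K \<Longrightarrow> x * y \<in> K" "x \<in> K \<Longrightarrow> - x \<in> K" for x y
    using assms unfolding is_subring_def by auto
  show "x \<in> K \<Longrightarrow> y \<in> K \<Longrightarrow> x - y \<in> K"
    using *(3)[of x "- y"] *(5)[of y] by simp
  show "x \<in> K \<Longrightarrow> x ^ k \<in> K"
    by (induction k) (auto intro: *)
qed

lemma div_subring_imp_subring: "div_subring K \<Longrightarrow> is_subring K"
  unfolding div_subring_def is_subring_def by auto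

lemma div_subring_inverse: "div_subring K \<Longrightarrow> x \<in> K \<Longrightarrow> inverse x \<in> K"
  unfolding div_subring_def by blast

lemmas div_subringD = is_subringD(1-5)[OF div_subring_imp_subring] div_subring_inverse
  is_subringD(6-7)[OF div_subring_imp_subring]

lemma is_subring_sum: "is_subring K \<Longrightarrow> (\<And>i. i \<in> I \<Longrightarrow> f i \<in> K) \<Longrightarrow> sum f I \<in> K"
  by (induction I rule: infinite_finite_induct) (auto intro: is_subringD)

lemmas div_subring_sum = is_subring_sum[OF div_subring_imp_subring]

lemma div_subring_Inter:
  assumes "\<And>K. K \<in> X \<Longrightarrow> div_subring K" shows "div_subring (\<Inter>X)"
  using assms unfolding div_subring_def by blast

lemma div_subring_gen:
  "div_subring (div_subring_gen S)" "S \<subseteq> div_subring_gen S"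
  unfolding div_subring_gen_def by (rule div_subring_Inter, auto)

lemma inverse_commute:
  fixes x y :: "'a::division_ring"
  assumes "x * y = y * x" shows "inverse x * y = y * inverse x"
proof (cases "x = 0")
  case False
  have "inverse x * y = inverse x * (y * x) * inverse x"
    using False by (simp add: mult.assoc)
  also have "\<dots> = inverse x * (x * y) * inverse x"
    by (simp add: assms)
  also have "\<dots> = y * inverse x"
    using False by (simp add: mult.assoc[symmetric])
  finally show ?thesis .
qed simp

lemma power_commute:
  fixes x y :: "'a::monoid_mult"
  assumes "x * y = y * x" shows "x ^ k * y = y * x ^ k"
  by (rule power_commuting_commutes) (rule assms)

lemma div_subring_centralizer:
  assumes "div_subring D" shows "div_subring {z \<in> D. z * a = a * z}"
  unfolding div_subring_def
  by (auto intro!: div_subringD[OF assms] simp: algebra_simps inverse_commute)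
    (metis mult.assoc)

lemma div_subring_ctr:
  assumes "div_subring D" shows "div_subring (ctr D)"
proof -
  have "ctr D = \<Inter>(insert D ((\<lambda>a. {z \<in> D. z * a = a * z}) ` D))"
    unfolding ctr_def by auto
  also have "div_subring \<dots>"
    by (rule div_subring_Inter) (auto intro: div_subring_centralizer assms)
  finally show ?thesis .
qed

text \<open>Gaussian elimination on the equations. The unknowns multiply from the left, so the pivot
  \<open>s p j\<close> is cancelled on the right, and the eliminated unknown \<open>e\<close> is
  recovered from equation \<open>j\<close>.\<close>

lemma homogeneous_system:
  assumes S: "div_subring S" and "finite J" and "finite I" and "card J < card I"
    and "\<And>i j. i \<in> I \<Longrightarrow> j \<in> J \<Longrightarrow> s i j \<in> S"
  shows "\<exists>c. (\<forall>i\<in>I. c i \<in> S) \<and> (\<exists>i\<in>I. c i \<noteq> 0) \<and> (\<forall>j\<in>J. (\<Sum>i\<in>I. c i * s i j) = 0)"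
  using assms(2-)
proof (induction J arbitrary: I s rule: finite_induct)
  case empty
  then obtain i where "i \<in> I" by fastforce
  then show ?case
    by (intro exI[of _ "\<lambda>_. 1"]) (auto intro: div_subringD[OF S])
next
  case (insert j J)
  show ?case
  proof (cases "\<forall>i\<in>I. s i j = 0")
    case True
    have "card J < card I" using insert by simp
    from insert.IH[OF insert.prems(1) this, of s] insert.prems
    obtain c where "\<forall>i\<in>I. c i \<in> S" "\<exists>i\<in>I. c i \<noteq> 0" "\<forall>j\<in>J. (\<Sum>i\<in>I. c i * s i j) = 0"
      by auto
    then show ?thesis using True by (intro exI[of _ c]) auto
  next
    case False
    then obtain p where p: "p \<in> I" "s p j \<noteq> 0" by auto
    define s' where "s' i k = s i k - s i j * inverse (s p j) * s p k" for i k
    let ?I = "I - {p}"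
    have "card J < card ?I" using insert p by simp
    moreover have "s' i k \<in> S" if "i \<in> ?I" "k \<in> J" for i k
      unfolding s'_def using that insert.prems p by (auto intro!: div_subringD[OF S])
    ultimately obtain c where c: "\<forall>i\<in>?I. c i \<in> S" "\<exists>i\<in>?I. c i \<noteq> 0"
      "\<forall>k\<in>J. (\<Sum>i\<in>?I. c i * s' i k) = 0"
      using insert.IH[of ?I s'] insert.prems by auto
    define e where "e = - (\<Sum>i\<in>?I. c i * s i j) * inverse (s p j)"
    define c' where "c' i = (if i = p then e else c i)" for i
    have eS: "e \<in> S" unfolding e_def using c(1) insert.prems p
      by (auto intro!: div_subringD[OF S] div_subring_sum[OF S])
    have split: "(\<Sum>i\<in>I. c' i * s i k) = e * s p k + (\<Sum>i\<in>?I. c i * s i k)" for k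
    proof -
      have "(\<Sum>i\<in>I. c' i * s i k) = c' p * s p k + (\<Sum>i\<in>?I. c' i * s i k)"
        by (rule sum.remove) (use insert.prems p in auto)
      also have "(\<Sum>i\<in>?I. c' i * s i k) = (\<Sum>i\<in>?I. c i * s i k)"
        by (rule sum.cong) (auto simp: c'_def)
      finally show ?thesis by (simp add: c'_def)
    qed
    have "(\<Sum>i\<in>I. c' i * s i k) = 0" if "k \<in> insert j J" for k
    proof (cases "k = j")
      case True
      then show ?thesis unfolding split e_def using p by (simp add: mult.assoc)
    next
      case False
      then have "0 = (\<Sum>i\<in>?I. c i * s' i k)" using c(3) that by auto
      also have "\<dots> = (\<Sum>i\<in>?I. c i * s i k) - (\<Sum>i\<in>?I. c i * s i j) * inverse (s p j) * s p k"
        unfolding s'_def by (simp add: algebra_simps sum_subtractf sum_distrib_left sum_distrib_right)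
      finally show ?thesis unfolding split e_def by simp
    qed
    then show ?thesis
      using c(1,2) eS by (intro exI[of _ c']) (auto simp: c'_def)
  qed
qed

text \<open>Given inductively so that neither finiteness of \<open>B\<close> nor a coefficient
  function has to be carried along; \<open>spn_explicit\<close> recovers coefficients when
  \<open>B\<close> is finite.\<close>

inductive_set spn :: "'a::division_ring set \<Rightarrow> 'a set \<Rightarrow> 'a set" for K B where
  zero: "0 \<in> spn K B"
| step: "x \<in> spn K B \<Longrightarrow> k \<in> K \<Longrightarrow> b \<in> B \<Longrightarrow> k * b + x \<in> spn K B"

lemma spn_base: "k \<in> K \<Longrightarrow> b \<in> B \<Longrightarrow> k * b \<in> spn K B"
  using spn.step[OF spn.zero] by force

lemma spn_add: "x \<in> spn K B \<Longrightarrow> y \<in> spn K B \<Longrightarrow> x + y \<in> spn K B"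
  by (induction rule: spn.induct) (auto simp: add.assoc intro: spn.intros)

lemma spn_sum: "(\<And>i. i \<in> I \<Longrightarrow> f i \<in> spn K B) \<Longrightarrow> sum f I \<in> spn K B"
  by (induction I rule: infinite_finite_induct) (auto intro: spn_add spn.zero)

lemma spn_scale:
  assumes "is_subring K" "x \<in> spn K B" "k \<in> K" shows "k * x \<in> spn K B"
  using assms(2)
  by induction (auto simp: distrib_left mult.assoc[symmetric] intro: spn.intros is_subringD[OF assms(1)] assms(3))

lemma spn_subset:
  assumes "is_subring D" "K \<subseteq> D" "B \<subseteq> D" shows "spn K B \<subseteq> D"
proof
  fix x assume "x \<in> spn K B"
  then show "x \<in> D"
    by induction (use assms in \<open>auto intro!: is_subringD[OF assms(1)]\<close>)
qed

lemma spn_explicit: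
  assumes K: "is_subring K" and B: "finite B"
  shows "x \<in> spn K B \<longleftrightarrow> (\<exists>c. (\<forall>b. c b \<in> K) \<and> x = (\<Sum>b\<in>B. c b * b))"
proof
  assume "x \<in> spn K B"
  then show "\<exists>c. (\<forall>b. c b \<in> K) \<and> x = (\<Sum>b\<in>B. c b * b)"
  proof induction
    case zero
    show ?case by (intro exI[of _ "\<lambda>_. 0"]) (auto intro: is_subringD[OF K])
  next
    case (step x k b)
    then obtain c where c: "\<forall>b. c b \<in> K" "x = (\<Sum>b\<in>B. c b * b)" by blast
    have "(\<Sum>d\<in>B. (c d + (if d = b then k else 0)) * d) = k * b + x"
      using B step.hyps c(2) by (simp add: distrib_right sum.distrib if_distrib[of "\<lambda>x. x * _"] sum.delta cong: if_cong)
    then show ?case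
      using c(1) step.hyps
      by (intro exI[of _ "\<lambda>d. c d + (if d = b then k else 0)"]) (auto intro: is_subringD[OF K])
  qed
qed (auto intro: spn_sum spn_base)

lemma spn_self: "is_subring K \<Longrightarrow> B \<subseteq> spn K B"
  using spn_base[of 1 K _ B] is_subringD(2)[of K] by auto

lemma spn_finite:
  assumes "finite K" "finite B" "is_subring K" shows "finite (spn K B)"
proof -
  have "spn K B \<subseteq> (\<lambda>c. \<Sum>b\<in>B. c b * b) ` (PiE B (\<lambda>_. K))"
  proof
    fix x assume "x \<in> spn K B"
    then obtain c where c: "\<forall>b. c b \<in> K" "x = (\<Sum>b\<in>B. c b * b)"
      using spn_explicit[OF assms(3,2)] by blast
    have "x = (\<Sum>b\<in>B. restrict c B b * b)" unfolding c(2) by (rule sum.cong) auto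
    moreover have "restrict c B \<in> PiE B (\<lambda>_. K)" using c(1) by auto
    ultimately show "x \<in> (\<lambda>c. \<Sum>b\<in>B. c b * b) ` (PiE B (\<lambda>_. K))" by blast
  qed
  then show ?thesis by (rule finite_subset) (simp add: assms finite_PiE)
qed

text \<open>The tower law: scalars stand on the left, so expanding a coefficient from
  \<open>L\<close> over \<open>B\<close> leaves the products \<open>b * c\<close> on the
  right.\<close>

lemma spn_trans:
  assumes K: "is_subring K" and "L \<subseteq> spn K B"
  shows "spn L C \<subseteq> spn K ((\<lambda>(b, c). b * c) ` (B \<times> C))"
proof
  have *: "l * c \<in> spn K ((\<lambda>(b, c). b * c) ` (B \<times> C))" if "l \<in> spn K B" "c \<in> C" for l c
    using that
  proof (induction)
    case (step x k b)
    have "(k * b + x) * c = k * (b * c) + x * c" by (simp add: distrib_right mult.assoc)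
    moreover have "b * c \<in> (\<lambda>(b, c). b * c) ` (B \<times> C)" using step by force
    ultimately show ?case using step by (auto intro: spn.intros)
  qed (auto intro: spn.intros)
  fix x assume "x \<in> spn L C"
  then show "x \<in> spn K ((\<lambda>(b, c). b * c) ` (B \<times> C))"
    by induction (use assms * in \<open>auto intro: spn_add spn.zero\<close>)
qed

lemma dependent_family:
  assumes S: "div_subring S" and B: "finite B" and x: "\<And>i. x i \<in> spn S B"
  shows "\<exists>c. (\<forall>i. c i \<in> S) \<and> (\<exists>i \<le> card B. c i \<noteq> 0) \<and> (\<Sum>i\<le>card B. c i * x i) = 0"
proof -
  have "\<forall>i. \<exists>s. (\<forall>b. s b \<in> S) \<and> x i = (\<Sum>b\<in>B. s b * b)"
    using x spn_explicit[OF div_subring_imp_subring[OF S] B] by blast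
  then obtain s where s: "\<And>i b. s i b \<in> S" "\<And>i. x i = (\<Sum>b\<in>B. s i b * b)" by metis
  obtain c where c: "\<forall>i\<le>card B. c i \<in> S" "\<exists>i\<le>card B. c i \<noteq> 0"
    "\<forall>b\<in>B. (\<Sum>i\<le>card B. c i * s i b) = 0"
    using homogeneous_system[OF S B, of "{..card B}" s] s(1) by auto
  define d where "d i = (if i \<le> card B then c i else 0)" for i
  have "(\<Sum>i\<le>card B. d i * x i) = (\<Sum>i\<le>card B. \<Sum>b\<in>B. c i * s i b * b)"
    by (simp add: d_def s(2) sum_distrib_left mult.assoc)
  also have "\<dots> = (\<Sum>b\<in>B. (\<Sum>i\<le>card B. c i * s i b) * b)"
    by (subst sum.swap) (simp add: sum_distrib_right)
  also have "\<dots> = 0" using c(3) by simp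
  finally show ?thesis
    using c(1,2) by (intro exI[of _ d]) (auto simp: d_def div_subringD[OF S])
qed

text \<open>The coefficient sequence of a monic polynomial omits the leading coefficient.\<close>

definition minpoly :: "'a::division_ring set \<Rightarrow> 'a \<Rightarrow> nat \<Rightarrow> (nat \<Rightarrow> 'a) \<Rightarrow> bool" where
  "minpoly S b N f \<longleftrightarrow> N \<ge> 1 \<and> (\<forall>i. f i \<in> S) \<and> b ^ N + (\<Sum>i<N. f i * b ^ i) = 0 \<and>
     (\<forall>c. (\<forall>i. c i \<in> S) \<and> (\<Sum>i<N. c i * b ^ i) = 0 \<longrightarrow> (\<forall>i<N. c i = 0))"

definition algebraic_over :: "'a::division_ring set \<Rightarrow> 'a \<Rightarrow> bool" where
  "algebraic_over S b \<longleftrightarrow>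
     (\<exists>n c. (\<forall>i. c i \<in> S) \<and> (\<exists>i<n. c i \<noteq> 0) \<and> (\<Sum>i<n. c i * b ^ i) = 0)"

lemma algebraic_over_mono: "S \<subseteq> T \<Longrightarrow> algebraic_over S b \<Longrightarrow> algebraic_over T b"
  unfolding algebraic_over_def by blast

lemma algebraic_in_span:
  assumes "div_subring S" "finite B" "\<And>i. b ^ i \<in> spn S B"
  shows "algebraic_over S b"
  using dependent_family[OF assms(1,2), of "\<lambda>i. b ^ i"] assms(3)
  unfolding algebraic_over_def
  by (intro exI[of _ "Suc (card B)"]) (simp only: lessThan_Suc_atMost less_Suc_eq_le)

text \<open>A shortest dependence among the powers of \<open>b\<close> must involve its top power.
  Dividing by that coefficient makes it monic, and the choice of the length is the independence
  clause.\<close>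

lemma minpoly_exists:
  assumes S: "div_subring S" and "algebraic_over S b"
  shows "\<exists>N f. minpoly S b N f"
proof -
  let ?P = "\<lambda>n. \<exists>c. (\<forall>i. c i \<in> S) \<and> (\<exists>i<n. c i \<noteq> 0) \<and> (\<Sum>i<n. c i * b ^ i) = 0"
  define n where "n = (LEAST n. ?P n)"
  have Pn: "?P n" unfolding n_def
    by (rule LeastI_ex) (use assms(2) in \<open>simp add: algebraic_over_def\<close>)
  have least: "\<not> ?P m" if "m < n" for m
    using not_less_Least[of m ?P] that unfolding n_def by blast
  from Pn obtain c where c: "\<And>i. c i \<in> S" "\<exists>i<n. c i \<noteq> 0" "(\<Sum>i<n. c i * b ^ i) = 0" by blast
  then obtain N where N: "n = Suc N" by (cases n) auto
  have cN: "c N \<noteq> 0"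
  proof
    assume *: "c N = 0"
    then have "?P N" using c less_Suc_eq by (intro exI[of _ c]) (auto simp: N)
    then show False using least[of N] N by blast
  qed
  have "N \<ge> 1" using c cN by (cases N) (auto simp: N)
  moreover have "b ^ N + (\<Sum>i<N. inverse (c N) * c i * b ^ i) = 0"
  proof -
    have "inverse (c N) * (\<Sum>i<n. c i * b ^ i) = 0" using c(3) by simp
    then show ?thesis using cN
      by (simp add: N distrib_left sum_distrib_left mult.assoc[symmetric] add.commute)
  qed
  moreover have "(\<forall>i<N. d i = 0)" if "\<forall>i. d i \<in> S" "(\<Sum>i<N. d i * b ^ i) = 0" for d
    using least[of N] that N by blast
  ultimately show ?thesis
    unfolding minpoly_def
    by (intro exI[of _ N] exI[of _ "\<lambda>i. inverse (c N) * c i"]) (auto intro: div_subringD[OF S] c)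
qed

text \<open>Write the minimal relation as \<open>r * b + f 0 = 0\<close>. If \<open>f 0\<close>
  vanished, so would \<open>r\<close>, which is a shorter relation; hence \<open>b\<close> has the
  inverse \<open>- inverse (f 0) * r\<close>, a polynomial in \<open>b\<close>.\<close>

lemma inverse_polynomial:
  assumes S: "div_subring S" and "algebraic_over S b" and b: "b \<noteq> 0"
  shows "\<exists>n c. (\<forall>i. c i \<in> S) \<and> inverse b = (\<Sum>i<n. c i * b ^ i)"
proof -
  obtain N f where m: "minpoly S b N f" using minpoly_exists[OF assms(1,2)] by blast
  then obtain M where N: "N = Suc M" unfolding minpoly_def by (cases N) auto
  define r where "r = b ^ M + (\<Sum>i<M. f (Suc i) * b ^ i)"
  have rb: "r * b + f 0 = 0"
  proof -
    have "b ^ N + (\<Sum>i<N. f i * b ^ i) = r * b + f 0"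
      unfolding N r_def sum.lessThan_Suc_shift
      by (simp add: distrib_right sum_distrib_right mult.assoc power_commutes)
    then show ?thesis using m unfolding minpoly_def by simp
  qed
  have "f 0 \<noteq> 0"
  proof
    assume "f 0 = 0"
    then have "r = 0" using rb b by simp
    define c where "c i = (if i = M then 1 else f (Suc i))" for i
    have "(\<Sum>i<N. c i * b ^ i) = r" unfolding N r_def by (simp add: c_def add.commute)
    moreover have "\<forall>i. c i \<in> S" using m unfolding c_def minpoly_def
      by (auto intro: div_subringD[OF S])
    ultimately have "c M = 0" using \<open>r = 0\<close> m N unfolding minpoly_def by blast
    then show False by (simp add: c_def)
  qed
  have "- inverse (f 0) * r * b = 1" using rb \<open>f 0 \<noteq> 0\<close>
    by (metis add_eq_0_iff2 left_inverse minus_mult_minus mult.assoc mult_minus_left)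
  then have "inverse b = - inverse (f 0) * r" using b
    by (metis mult.assoc mult.right_neutral right_inverse mult_1)
  also have "\<dots> = (\<Sum>i<N. (- inverse (f 0) * (if i = M then 1 else f (Suc i))) * b ^ i)"
    unfolding N r_def by (simp add: distrib_left sum_distrib_left mult.assoc sum_negf add.commute)
  finally show ?thesis using m unfolding minpoly_def
    by (intro exI[of _ N] exI[of _ "\<lambda>i. - inverse (f 0) * (if i = M then 1 else f (Suc i))"])
      (auto intro!: div_subringD[OF S])
qed

text \<open>A spanning subset of least cardinality is a basis, so coordinates are unique, and
  uniqueness makes any choice \<open>co\<close> additive and linear. Outside the span the values of
  \<open>co\<close> are arbitrary elements of \<open>S\<close>.\<close>

lemma coordinates_exist:
  assumes S: "div_subring S" and "finite B"
  shows "\<exists>C co. finite C \<and> C \<subseteq> B \<and> (\<forall>x b. co x b \<in> S) \<and>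
     (\<forall>x\<in>spn S B. x = (\<Sum>b\<in>C. co x b * b)) \<and>
     (\<forall>x\<in>spn S B. \<forall>y\<in>spn S B. \<forall>b\<in>C. co (x + y) b = co x b + co y b) \<and>
     (\<forall>x\<in>spn S B. \<forall>k\<in>S. \<forall>b\<in>C. co (k * x) b = k * co x b)"
proof -
  note SR = div_subring_imp_subring[OF S]
  let ?P = "\<lambda>C. C \<subseteq> B \<and> spn S B \<subseteq> spn S C"
  obtain C where C: "?P C" and least: "\<And>C'. ?P C' \<Longrightarrow> card C \<le> card C'"
    using ex_has_least_nat[of ?P B card] by blast
  have fin: "finite C" using C assms(2) finite_subset by blast
  have indep: "\<forall>b\<in>C. c b = 0" if c: "\<forall>b. c b \<in> S" "(\<Sum>b\<in>C. c b * b) = 0" for c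
  proof (rule ccontr)
    assume "\<not> ?thesis"
    then obtain p where p: "p \<in> C" "c p \<noteq> 0" by blast
    let ?C = "C - {p}"
    have "c p * p + (\<Sum>b\<in>?C. c b * b) = 0" using c(2) sum.remove[OF fin p(1), of "\<lambda>b. c b * b"] by simp
    then have "c p * p = - (\<Sum>b\<in>?C. c b * b)" by (simp add: eq_neg_iff_add_eq_0)
    then have "p = inverse (c p) * - (\<Sum>b\<in>?C. c b * b)"
      using p by (metis left_inverse mult.assoc mult_1)
    also have "\<dots> = (\<Sum>b\<in>?C. (- inverse (c p) * c b) * b)"
      by (simp add: sum_distrib_left sum_negf mult.assoc)
    also have "\<dots> \<in> spn S ?C" using c by (intro spn_sum spn_base) (auto intro!: div_subringD[OF S])
    finally have "p \<in> spn S ?C" .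
    then have "C \<subseteq> spn S ?C" using spn_self[OF SR, of ?C] by blast
    have "spn S C \<subseteq> spn S ?C"
    proof
      fix x assume "x \<in> spn S C"
      then show "x \<in> spn S ?C"
        by induction (use \<open>C \<subseteq> spn S ?C\<close> in \<open>auto intro!: spn_add spn.zero spn_scale[OF SR]\<close>)
    qed
    then have "card C \<le> card ?C" using least[of ?C] C by blast
    then show False using p fin by (metis card_Diff1_less linorder_not_less)
  qed
  have uniq: "c b = d b" if "\<forall>b. c b \<in> S" "\<forall>b. d b \<in> S"
    "(\<Sum>b\<in>C. c b * b) = (\<Sum>b\<in>C. d b * b)" "b \<in> C" for c d b
    using indep[of "\<lambda>b. c b - d b"] that
    by (auto simp: left_diff_distrib sum_subtractf intro: div_subringD[OF S])
  have "\<forall>x. \<exists>c. (\<forall>b. c b \<in> S) \<and> (x \<in> spn S B \<longrightarrow> x = (\<Sum>b\<in>C. c b * b))"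
  proof
    fix x
    show "\<exists>c. (\<forall>b. c b \<in> S) \<and> (x \<in> spn S B \<longrightarrow> x = (\<Sum>b\<in>C. c b * b))"
    proof (cases "x \<in> spn S B")
      case True
      then have "x \<in> spn S C" using C by blast
      then show ?thesis using spn_explicit[OF SR fin] by blast
    qed (auto intro!: exI[of _ "\<lambda>_. 0"] div_subringD[OF S])
  qed
  then obtain co where co: "\<And>x b. co x b \<in> S" "\<And>x. x \<in> spn S B \<Longrightarrow> x = (\<Sum>b\<in>C. co x b * b)"
    by metis
  have "co (x + y) b = co x b + co y b" if "x \<in> spn S B" "y \<in> spn S B" "b \<in> C" for x y b
  proof (rule uniq[of "co (x + y)" "\<lambda>b. co x b + co y b"])
    have "(\<Sum>b\<in>C. co (x + y) b * b) = x + y"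
      using co(2)[OF spn_add[OF that(1,2)]] by simp
    also have "\<dots> = (\<Sum>b\<in>C. (co x b + co y b) * b)"
      using co(2)[OF that(1)] co(2)[OF that(2)] by (simp add: distrib_right sum.distrib)
    finally show "(\<Sum>b\<in>C. co (x + y) b * b) = (\<Sum>b\<in>C. (co x b + co y b) * b)" .
  qed (use that in \<open>auto intro: co div_subringD[OF S]\<close>)
  moreover have "co (k * x) b = k * co x b" if "x \<in> spn S B" "k \<in> S" "b \<in> C" for x k b
  proof (rule uniq[of "co (k * x)" "\<lambda>b. k * co x b"])
    have "(\<Sum>b\<in>C. co (k * x) b * b) = k * x"
      using co(2)[OF spn_scale[OF SR that(1,2)]] by simp
    also have "\<dots> = k * (\<Sum>b\<in>C. co x b * b)"
      using co(2)[OF that(1)] by simp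
    finally show "(\<Sum>b\<in>C. co (k * x) b * b) = (\<Sum>b\<in>C. k * co x b * b)"
      by (simp add: sum_distrib_left mult.assoc)
  qed (use that in \<open>auto intro: co div_subringD[OF S]\<close>)
  ultimately show ?thesis using fin co C
    by (intro exI[of _ C] exI[of _ co]) auto
qed

section \<open>Polynomials in a central variable\<close>

text \<open>A polynomial \<open>\<Sum>i. c i X^i\<close> in a central variable is represented by the function
  \<open>\<lambda>m \<tau>. \<Sum>i. c i * m * \<tau>^i\<close>. At a central \<open>\<tau>\<close> and \<open>m = 1\<close> this is evaluation; for fixed \<open>\<tau>\<close> it is the
  operator of the element \<open>\<Sum>i. c i \<otimes> \<tau>^i\<close> acting from both sides. Multiplication is composition.\<close>

inductive_set polys :: "'a::division_ring set \<Rightarrow> ('a \<Rightarrow> 'a \<Rightarrow> 'a) set" for D where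
  const: "c \<in> D \<Longrightarrow> (\<lambda>m \<tau>. c * m) \<in> polys D"
| var: "(\<lambda>m \<tau>. m * \<tau>) \<in> polys D"
| add: "P \<in> polys D \<Longrightarrow> Q \<in> polys D \<Longrightarrow> (\<lambda>m \<tau>. P m \<tau> + Q m \<tau>) \<in> polys D"
| mult: "P \<in> polys D \<Longrightarrow> Q \<in> polys D \<Longrightarrow> (\<lambda>m \<tau>. P (Q m \<tau>) \<tau>) \<in> polys D"

lemma polys_mono: "S \<subseteq> D \<Longrightarrow> P \<in> polys S \<Longrightarrow> P \<in> polys D"
  by (rotate_tac, induction rule: polys.induct) (auto intro: polys.intros)

lemma polys_zero: "is_subring D \<Longrightarrow> (\<lambda>m \<tau>. 0) \<in> polys D"
  using polys.const[of 0 D] is_subringD(1) by fastforce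

lemma polys_id: "is_subring D \<Longrightarrow> (\<lambda>m \<tau>. m) \<in> polys D"
  using polys.const[of 1 D] is_subringD(2) by fastforce

lemma polys_sum:
  assumes "is_subring D" "\<And>i. i \<in> I \<Longrightarrow> P i \<in> polys D"
  shows "(\<lambda>m \<tau>. \<Sum>i\<in>I. P i m \<tau>) \<in> polys D"
  using assms(2)
  by (induction I rule: infinite_finite_induct)
    (auto intro: polys.add polys_zero[OF assms(1)])

lemma polys_monom:
  assumes "is_subring D" "c \<in> D" shows "(\<lambda>m \<tau>. c * m * \<tau> ^ i) \<in> polys D"
proof (induction i)
  case 0
  then show ?case using polys.const[OF assms(2)] by simp
next
  case (Suc i)
  have "(\<lambda>m \<tau>. (c * m * \<tau> ^ i) * \<tau>) \<in> polys D"
    using polys.mult[OF polys.var Suc] by simp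
  then show ?case by (simp add: mult.assoc power_commutes)
qed

lemma polys_explicit:
  assumes "is_subring D" "\<And>i. i < n \<Longrightarrow> c i \<in> D"
  shows "(\<lambda>m \<tau>. \<Sum>i<n. c i * m * \<tau> ^ i) \<in> polys D"
  by (rule polys_sum) (auto intro: assms polys_monom)

text \<open>The coefficients vanish from \<open>n\<close> on so that two sums of different lengths
  can be padded to a common one.\<close>

definition has_coeffs :: "'a::division_ring set \<Rightarrow> ('a \<Rightarrow> 'a \<Rightarrow> 'a) \<Rightarrow> bool" where
  "has_coeffs D P \<longleftrightarrow> (\<exists>n c. (\<forall>i. c i \<in> D) \<and> (\<forall>i\<ge>n. c i = 0) \<and> P = (\<lambda>m \<tau>. \<Sum>i<n. c i * m * \<tau> ^ i))"

lemma has_coeffs_monom: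
  assumes "is_subring D" "c \<in> D" shows "has_coeffs D (\<lambda>m \<tau>. c * m * \<tau> ^ k)"
  unfolding has_coeffs_def
  by (intro exI[of _ "Suc k"] exI[of _ "\<lambda>i. if i = k then c else 0"])
    (auto simp: assms fun_eq_iff if_distrib[of "\<lambda>x. x * _"] intro: is_subringD[OF assms(1)] cong: if_cong)

lemma has_coeffs_add:
  assumes "is_subring D" "has_coeffs D P" "has_coeffs D Q"
  shows "has_coeffs D (\<lambda>m \<tau>. P m \<tau> + Q m \<tau>)"
proof -
  obtain n c where c: "\<And>i. c i \<in> D" "\<And>i. i \<ge> n \<Longrightarrow> c i = 0" "P = (\<lambda>m \<tau>. \<Sum>i<n. c i * m * \<tau> ^ i)"
    using assms(2) unfolding has_coeffs_def by blast
  obtain k d where d: "\<And>i. d i \<in> D" "\<And>i. i \<ge> k \<Longrightarrow> d i = 0" "Q = (\<lambda>m \<tau>. \<Sum>i<k. d i * m * \<tau> ^ i)"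
    using assms(3) unfolding has_coeffs_def by blast
  let ?N = "max n k"
  have 1: "(\<Sum>i<n. c i * m * \<tau> ^ i) = (\<Sum>i<?N. c i * m * \<tau> ^ i)" for m \<tau>
    by (rule sum.mono_neutral_left) (auto simp: c(2))
  have 2: "(\<Sum>i<k. d i * m * \<tau> ^ i) = (\<Sum>i<?N. d i * m * \<tau> ^ i)" for m \<tau>
    by (rule sum.mono_neutral_left) (auto simp: d(2))
  show ?thesis unfolding has_coeffs_def c(3) d(3) 1 2
    by (intro exI[of _ ?N] exI[of _ "\<lambda>i. c i + d i"])
      (auto simp: fun_eq_iff sum.distrib distrib_right c d intro: is_subringD[OF assms(1)])
qed

lemma has_coeffs_sum:
  assumes "is_subring D" "finite I" "\<And>i. i \<in> I \<Longrightarrow> has_coeffs D (P i)"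
  shows "has_coeffs D (\<lambda>m \<tau>. \<Sum>i\<in>I. P i m \<tau>)"
  using assms(2,3)
proof (induction I rule: finite_induct)
  case empty
  then show ?case using has_coeffs_monom[OF assms(1) is_subringD(1)[OF assms(1)], of 0] by simp
next
  case (insert x F)
  then show ?case by (auto intro: has_coeffs_add assms(1))
qed

lemma polys_has_coeffs:
  assumes D: "is_subring D" and "P \<in> polys D" shows "has_coeffs D P"
  using assms(2)
proof induction
  case (const c)
  then show ?case using has_coeffs_monom[OF D, of c 0] by simp
next
  case var
  then show ?case using has_coeffs_monom[OF D is_subringD(2)[OF D], of 1] by simp
next
  case (add P Q)
  then show ?case by (auto intro: has_coeffs_add D)
next
  case (mult P Q)
  obtain n c where c: "\<And>i. c i \<in> D" "P = (\<lambda>m \<tau>. \<Sum>i<n. c i * m * \<tau> ^ i)"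
    using mult unfolding has_coeffs_def by blast
  obtain k d where d: "\<And>i. d i \<in> D" "Q = (\<lambda>m \<tau>. \<Sum>i<k. d i * m * \<tau> ^ i)"
    using mult unfolding has_coeffs_def by blast
  have "P (Q m \<tau>) \<tau> = (\<Sum>i<n. \<Sum>j<k. (c i * d j) * m * \<tau> ^ (j + i))" for m \<tau>
    unfolding c(2) d(2)
    by (simp add: sum_distrib_left sum_distrib_right mult.assoc power_add)
  then have "(\<lambda>m \<tau>. P (Q m \<tau>) \<tau>) = (\<lambda>m \<tau>. \<Sum>i<n. \<Sum>j<k. (c i * d j) * m * \<tau> ^ (j + i))"
    by simp
  then show ?case
    by (auto intro!: has_coeffs_sum has_coeffs_monom D is_subringD(4)[OF D] c d)
qed

lemma polys_closed:
  assumes "is_subring D" "P \<in> polys D" "m \<in> D" "\<tau> \<in> D" shows "P m \<tau> \<in> D"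
  using assms(2,3) by (induction arbitrary: m) (auto intro: is_subringD[OF assms(1)] assms(4))

lemma polys_additive: "P \<in> polys D \<Longrightarrow> P (m + m') \<tau> = P m \<tau> + P m' \<tau>"
  by (induction arbitrary: m m' rule: polys.induct) (auto simp: distrib_left distrib_right)

lemma polys_zero_arg: "P \<in> polys D \<Longrightarrow> P 0 \<tau> = 0"
  by (induction rule: polys.induct) auto

lemma polys_sum_arg: "P \<in> polys D \<Longrightarrow> P (\<Sum>i\<in>I. f i) \<tau> = (\<Sum>i\<in>I. P (f i) \<tau>)"
  by (induction I rule: infinite_finite_induct) (auto simp: polys_additive polys_zero_arg)

lemma polys_right_linear:
  assumes "P \<in> polys D" "c * \<tau> = \<tau> * c" shows "P (m * c) \<tau> = P m \<tau> * c"
  using assms(1)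
  by (induction arbitrary: m) (auto simp: mult.assoc assms(2) distrib_right)

lemma polys_central_arg:
  assumes "is_subring D" "P \<in> polys D" "\<tau> \<in> ctr D" "m \<in> D" shows "P m \<tau> = P 1 \<tau> * m"
proof -
  have "m * \<tau> = \<tau> * m" using assms unfolding ctr_def by auto
  then show ?thesis using polys_right_linear[OF assms(2), of m \<tau> 1] by simp
qed

text \<open>At a central point, composition is multiplication of values. At other points only the
  composition behaves well, which is why \<open>polys\<close> is built on it.\<close>

lemma polys_mult_central:
  assumes "is_subring D" "P \<in> polys D" "Q \<in> polys D" "\<tau> \<in> ctr D"
  shows "P (Q 1 \<tau>) \<tau> = P 1 \<tau> * Q 1 \<tau>"
proof -
  have "\<tau> \<in> D" using assms unfolding ctr_def by auto
  then show ?thesis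
    using polys_central_arg[OF assms(1,2,4)] polys_closed[OF assms(1,3)] is_subringD[OF assms(1)] by blast
qed

text \<open>Central coefficients slide past \<open>m\<close>, so the operator is determined by its
  value at 1 even at a noncentral \<open>\<tau>\<close>. In particular a root of a central
  polynomial makes the whole operator vanish.\<close>

lemma polys_ctr_left_linear:
  assumes "is_subring D" "S \<subseteq> ctr D" "P \<in> polys S" "m \<in> D" "m' \<in> D" "\<tau> \<in> D"
  shows "P (m * m') \<tau> = m * P m' \<tau>"
  using assms(3,5)
proof (induction arbitrary: m')
  case (const c)
  then have "c * m = m * c" using assms unfolding ctr_def by auto
  then show ?case by (metis mult.assoc)
next
  case (mult P Q)
  have "polys S \<subseteq> polys D"
    using polys_mono[of S D] assms(2) unfolding ctr_def by auto
  then have "Q m' \<tau> \<in> D" using polys_closed[OF assms(1) _ mult.prems assms(6)] mult by blast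
  then show ?case using mult by simp
qed (auto simp: distrib_left mult.assoc)

text \<open>Divide by \<open>t - s\<close> for a root \<open>s\<close>: the quotient has the
  coefficients \<open>d j\<close>, vanishes at the other roots, and has leading coefficient
  \<open>c n\<close>. The division works because the roots commute with each other and with the
  coefficients.\<close>

lemma finitely_many_central_roots:
  fixes c :: "nat \<Rightarrow> 'a::division_ring"
  assumes "infinite T"
    and TT: "\<And>t s. t \<in> T \<Longrightarrow> s \<in> T \<Longrightarrow> t * s = s * t"
    and cT: "\<And>t i. t \<in> T \<Longrightarrow> t * c i = c i * t"
    and root: "\<And>t. t \<in> T \<Longrightarrow> (\<Sum>i<n. c i * t ^ i) = 0"
  shows "\<forall>i<n. c i = 0"
  using assms(1) TT cT root
proof (induction n arbitrary: c T)
  case (Suc n)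
  obtain s where s: "s \<in> T" using Suc.prems(1) by (metis finite.emptyI ex_in_conv)
  define d where "d j = (\<Sum>i\<in>{j<..n}. c i * s ^ (i - 1 - j))" for j
  have inf: "infinite (T - {s})" using Suc.prems(1) by simp
  have "(\<Sum>j<n. d j * t ^ j) = 0" if t: "t \<in> T - {s}" for t
  proof -
    have pw: "t ^ i - s ^ i = (\<Sum>j<i. s ^ (i - 1 - j) * t ^ j) * (t - s)" for i
    proof (induction i)
      case (Suc i)
      have "(\<Sum>j<Suc i. s ^ (Suc i - 1 - j) * t ^ j) = t ^ i + s * (\<Sum>j<i. s ^ (i - 1 - j) * t ^ j)"
      proof -
        have "s ^ (i - j) * t ^ j = s * (s ^ (i - 1 - j) * t ^ j)" if "j < i" for j
        proof -
          have "i - j = Suc (i - 1 - j)" using that by simp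
          then show ?thesis by (simp add: mult.assoc)
        qed
        then show ?thesis by (simp add: sum_distrib_left add.commute)
      qed
      then have "(\<Sum>j<Suc i. s ^ (Suc i - 1 - j) * t ^ j) * (t - s) = t ^ i * (t - s) + s * (t ^ i - s ^ i)"
        using Suc by (simp add: distrib_right mult.assoc)
      also have "\<dots> = t ^ Suc i - s ^ Suc i"
        using power_commute[of t s i] \<open>\<And>t s. t \<in> T \<Longrightarrow> s \<in> T \<Longrightarrow> t * s = s * t\<close>[of s t] s t
        by (simp add: right_diff_distrib power_commutes[symmetric] power_Suc2 del: power_Suc)
      finally show ?case by simp
    qed simp
    have "0 = (\<Sum>i<Suc n. c i * t ^ i) - (\<Sum>i<Suc n. c i * s ^ i)"
      using Suc.prems(4) s t by simp
    also have "\<dots> = (\<Sum>i<Suc n. c i * (\<Sum>j<i. s ^ (i - 1 - j) * t ^ j)) * (t - s)"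
      by (simp only: sum_subtractf[symmetric] right_diff_distrib[symmetric] pw sum_distrib_right mult.assoc)
    also have "(\<Sum>i<Suc n. c i * (\<Sum>j<i. s ^ (i - 1 - j) * t ^ j)) = (\<Sum>i<Suc n. \<Sum>j<i. c i * s ^ (i - 1 - j) * t ^ j)"
      by (simp only: sum_distrib_left mult.assoc)
    also have "\<dots> = (\<Sum>j<n. \<Sum>i\<in>{j<..n}. c i * s ^ (i - 1 - j) * t ^ j)"
      unfolding lessThan_Suc_atMost sum.nested_swap' atLeastSucAtMost_greaterThanAtMost ..
    also have "\<dots> = (\<Sum>j<n. d j * t ^ j)"
      by (simp add: d_def sum_distrib_right)
    finally show ?thesis using t by auto
  qed
  moreover have "t * d j = d j * t" if t: "t \<in> T" for t j
  proof -
    have "s ^ k * t = t * s ^ k" for k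
      using power_commute[of s t k] Suc.prems(2)[of s t] s t by auto
    then have "c i * s ^ k * t = t * (c i * s ^ k)" for i k
      using Suc.prems(3)[OF t, of i] by (metis mult.assoc)
    then show ?thesis unfolding d_def by (simp add: sum_distrib_left sum_distrib_right)
  qed
  ultimately have "\<forall>j<n. d j = 0"
    using Suc.IH[OF inf, of d] Suc.prems(2) by blast
  then have cn: "c n = 0" 
  proof (cases n)
    case 0
    then show ?thesis using Suc.prems(4)[OF s] by simp
  next
    case (Suc k)
    then have "{k<..n} = {n}" by auto
    then have "d k = c n" unfolding d_def using Suc by simp
    then show ?thesis using \<open>\<forall>j<n. d j = 0\<close> Suc by simp
  qed
  \<comment> \<open>With the top coefficient gone, the induction hypothesis applies a second time,
    now to \<open>c\<close> itself on all of \<open>T\<close>.\<close>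
  then have "(\<Sum>i<n. c i * t ^ i) = 0" if "t \<in> T" for t
    using Suc.prems(4)[OF that] by simp
  then show ?case using Suc.IH[OF Suc.prems(1), of c] Suc.prems(2,3) cn less_Suc_eq by blast
qed simp

text \<open>All coefficients vanish, so the conclusion extends from \<open>m = 1\<close> and central
  points to every \<open>m\<close> and every \<open>\<tau>\<close>, central or not. This is how
  identities checked at central \<open>t\<close> come to be evaluated at \<open>a\<close>.\<close>

lemma polys_eq_zero:
  assumes D: "is_subring D" and P: "P \<in> polys D" and "infinite T" and T: "T \<subseteq> ctr D"
    and root: "\<And>t. t \<in> T \<Longrightarrow> P 1 t = 0"
  shows "P m \<tau> = 0"
proof -
  obtain n c where c: "\<And>i. c i \<in> D" "P = (\<lambda>m \<tau>. \<Sum>i<n. c i * m * \<tau> ^ i)"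
    using polys_has_coeffs[OF D P] unfolding has_coeffs_def by blast
  have "\<forall>i<n. c i = 0"
    by (rule finitely_many_central_roots[OF assms(3)]) (use T root c in \<open>auto simp: ctr_def subset_iff\<close>)
  then show ?thesis unfolding c(2) by simp
qed

lemma polys_eqI:
  assumes D: "is_subring D" and P: "P \<in> polys D" and Q: "Q \<in> polys D" and "infinite T" and T: "T \<subseteq> ctr D"
    and "\<And>t. t \<in> T \<Longrightarrow> P 1 t = Q 1 t"
  shows "P m \<tau> = Q m \<tau>"
proof -
  have "(\<lambda>m \<tau>. - 1 * Q m \<tau>) \<in> polys D"
    by (rule polys.mult[OF polys.const Q]) (auto intro: is_subringD[OF D])
  from polys.add[OF P this] have "(\<lambda>m \<tau>. P m \<tau> - Q m \<tau>) \<in> polys D" by simp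
  from polys_eq_zero[OF D this assms(4,5), of m \<tau>] show ?thesis using assms(6) by simp
qed

lemma polys_power:
  assumes "is_subring D" "P \<in> polys D"
  shows "(\<lambda>m \<tau>. ((\<lambda>m. P m \<tau>) ^^ k) m) \<in> polys D"
  by (induction k) (auto intro: polys_id assms polys.mult)

lemma polys_power_central:
  assumes "is_subring D" "P \<in> polys D" "\<tau> \<in> ctr D"
  shows "((\<lambda>m. P m \<tau>) ^^ k) 1 = P 1 \<tau> ^ k"
proof (induction k)
  case (Suc k)
  then show ?case
    using polys_mult_central[OF assms(1,2) polys_power[OF assms(1,2), of k] assms(3)] by simp
qed simp

section \<open>Division with remainder by monic polynomials\<close>

definition monic :: "nat \<Rightarrow> (nat \<Rightarrow> 'a) \<Rightarrow> 'a::division_ring \<Rightarrow> 'a \<Rightarrow> 'a" where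
  "monic N f m \<tau> = m * \<tau> ^ N + (\<Sum>i<N. f i * m * \<tau> ^ i)"

lemma monic_polys:
  assumes "is_subring S" "\<And>i. f i \<in> S" shows "monic N f \<in> polys S"
proof -
  have "(\<lambda>m \<tau>. 1 * m * \<tau> ^ N + (\<Sum>i<N. f i * m * \<tau> ^ i)) \<in> polys S"
    by (rule polys.add[OF polys_monom polys_explicit]) (auto intro: assms is_subringD[OF assms(1)])
  then show ?thesis by (simp add: monic_def[abs_def])
qed

text \<open>Horner induction. With \<open>P = c 0 + P' X\<close> and \<open>P' = Q G + r\<close>,
  the only term of \<open>r X\<close> of too high a degree is \<open>r M X^N\<close>, which is
  traded for \<open>r M G\<close> minus lower terms.\<close>

lemma polys_division:
  assumes S: "is_subring S" and f: "\<And>i. f i \<in> S" and N: "N \<ge> 1" and "P \<in> polys S"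
  shows "\<exists>Q r. Q \<in> polys S \<and> (\<forall>i. r i \<in> S) \<and>
    P = (\<lambda>m \<tau>. Q (monic N f m \<tau>) \<tau> + (\<Sum>i<N. r i * m * \<tau> ^ i))"
proof -
  obtain n c where c: "\<And>i. c i \<in> S" "P = (\<lambda>m \<tau>. \<Sum>i<n. c i * m * \<tau> ^ i)"
    using polys_has_coeffs[OF S assms(4)] unfolding has_coeffs_def by blast
  have "\<exists>Q r. Q \<in> polys S \<and> (\<forall>i. r i \<in> S) \<and>
    (\<lambda>m \<tau>. \<Sum>i<n. c i * m * \<tau> ^ i) = (\<lambda>m \<tau>. Q (monic N f m \<tau>) \<tau> + (\<Sum>i<N. r i * m * \<tau> ^ i))"
    using c(1)
  proof (induction n arbitrary: c)
    case 0
    then show ?case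
      by (intro exI[of _ "\<lambda>m \<tau>. 0"] exI[of _ "\<lambda>_. 0"]) (auto intro: polys_zero S is_subringD[OF S])
  next
    case (Suc n)
    obtain Q r where Q: "Q \<in> polys S" "\<And>i. r i \<in> S" and
      eq: "\<And>m \<tau>. (\<Sum>i<n. c (Suc i) * m * \<tau> ^ i) = Q (monic N f m \<tau>) \<tau> + (\<Sum>i<N. r i * m * \<tau> ^ i)"
      using Suc.IH[of "\<lambda>i. c (Suc i)"] Suc.prems by (auto simp: fun_eq_iff)
    obtain M where M: "N = Suc M" using N by (cases N) auto
    define Q' where "Q' m \<tau> = Q m \<tau> * \<tau> + r M * m" for m \<tau>
    define r' where "r' i = (if i = 0 then c 0 else r (i - 1)) - r M * f i" for i
    have "Q' \<in> polys S" unfolding Q'_def[abs_def]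
      by (rule polys.add[OF polys.mult[OF polys.var Q(1)] polys.const[OF Q(2)]])
    moreover have "r' i \<in> S" for i unfolding r'_def
      using Q(2) f Suc.prems by (auto intro!: is_subringD[OF S])
    moreover have "(\<Sum>i<Suc n. c i * m * \<tau> ^ i) = Q' (monic N f m \<tau>) \<tau> + (\<Sum>i<N. r' i * m * \<tau> ^ i)" for m \<tau>
    proof -
      have "(\<Sum>i<Suc n. c i * m * \<tau> ^ i) = c 0 * m + (\<Sum>i<n. c (Suc i) * m * \<tau> ^ i) * \<tau>"
        unfolding sum.lessThan_Suc_shift by (simp add: sum_distrib_right mult.assoc power_commutes)
      also have "\<dots> = c 0 * m + Q (monic N f m \<tau>) \<tau> * \<tau> + (\<Sum>i<N. r i * m * \<tau> ^ i) * \<tau>"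
        unfolding eq by (simp add: distrib_right add.assoc)
      also have "(\<Sum>i<N. r i * m * \<tau> ^ i) * \<tau> = r M * m * \<tau> ^ N + (\<Sum>i<M. r i * m * \<tau> ^ Suc i)"
        by (simp add: M sum_distrib_right distrib_right mult.assoc power_commutes add.commute)
      also have "r M * m * \<tau> ^ N = r M * monic N f m \<tau> - (\<Sum>i<N. r M * f i * m * \<tau> ^ i)"
        by (simp add: monic_def distrib_left sum_distrib_left mult.assoc)
      also have "c 0 * m + Q (monic N f m \<tau>) \<tau> * \<tau> + (r M * monic N f m \<tau> - (\<Sum>i<N. r M * f i * m * \<tau> ^ i)
          + (\<Sum>i<M. r i * m * \<tau> ^ Suc i))
        = Q' (monic N f m \<tau>) \<tau> + (c 0 * m + (\<Sum>i<M. r i * m * \<tau> ^ Suc i) - (\<Sum>i<N. r M * f i * m * \<tau> ^ i))"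
        unfolding Q'_def by (simp add: algebra_simps)
      also have "c 0 * m + (\<Sum>i<M. r i * m * \<tau> ^ Suc i) = (\<Sum>i<N. (if i = 0 then c 0 else r (i - 1)) * m * \<tau> ^ i)"
        unfolding M sum.lessThan_Suc_shift by simp
      finally show ?thesis
        by (simp add: r'_def left_diff_distrib sum_subtractf)
    qed
    ultimately show ?case by (intro exI[of _ Q'] exI[of _ r']) (auto simp: fun_eq_iff)
  qed
  then show ?thesis unfolding c(2) .
qed

text \<open>The remainder, evaluated at \<open>a\<close>, is a relation among the powers of
  \<open>a\<close> below \<open>N\<close>, hence zero by minimality.\<close>

lemma polys_root_division:
  assumes S: "is_subring S" and m: "minpoly S a N f" and P: "P \<in> polys S" and "P 1 a = 0"
  shows "\<exists>Q\<in>polys S. \<forall>m \<tau>. P m \<tau> = Q (monic N f m \<tau>) \<tau>"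
proof -
  have f: "\<And>i. f i \<in> S" "N \<ge> 1" and root: "monic N f 1 a = 0"
    using m unfolding minpoly_def monic_def by auto
  obtain Q r where Q: "Q \<in> polys S" "\<And>i. r i \<in> S" and
    eq: "P = (\<lambda>m \<tau>. Q (monic N f m \<tau>) \<tau> + (\<Sum>i<N. r i * m * \<tau> ^ i))"
    using polys_division[where f = f and N = N, OF S f(1) f(2) P] by blast
  have "(\<Sum>i<N. r i * a ^ i) = 0"
    using assms(4) root polys_zero_arg[OF Q(1)] unfolding eq by simp
  then have "\<forall>i<N. r i = 0" using m Q(2) unfolding minpoly_def by blast
  then show ?thesis using Q(1) unfolding eq by (intro bexI[of _ Q]) auto
qed

section \<open>Rings over which polynomials take nonunit values\<close>

definition fracs :: "'a::division_ring set \<Rightarrow> 'a set" where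
  "fracs A = {z. \<exists>y\<in>A. y \<noteq> 0 \<and> z * y \<in> A}"

definition localiz :: "'a::division_ring set \<Rightarrow> 'a \<Rightarrow> 'a set" where
  "localiz A v = {z. \<exists>k. z * v ^ k \<in> A}"

text \<open>A division ring never satisfies this, since its nonzero elements are invertible in it.
  The integers and the polynomial rings \<open>L[s]\<close> do, and in the form of
  \<open>nonunit_values_monic\<close> the property survives the passage to
  \<open>A[1/v]\<close>.\<close>

definition nonunit_values :: "'a::division_ring set \<Rightarrow> bool" where
  "nonunit_values A \<longleftrightarrow> (\<forall>N \<psi>. (\<forall>i. \<psi> i \<in> A) \<and> N \<ge> 1 \<and> \<psi> N \<noteq> 0 \<longrightarrow>
     (\<exists>z\<in>A. (\<Sum>i\<le>N. \<psi> i * z ^ i) \<noteq> 0 \<and> inverse (\<Sum>i\<le>N. \<psi> i * z ^ i) \<notin> A))"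

lemma power_mult_commuting:
  fixes x y :: "'a::monoid_mult"
  assumes "x * y = y * x" shows "(x * y) ^ n = x ^ n * y ^ n"
proof (induction n)
  case (Suc n)
  have "y * x ^ n = x ^ n * y" using power_commute[OF assms, of n] by simp
  then show ?case using Suc by (metis mult.assoc power_Suc)
qed simp

lemma nonunit_valuesD:
  assumes "nonunit_values A" "\<And>i. \<psi> i \<in> A" "N \<ge> 1" "\<psi> N \<noteq> 0"
  shows "\<exists>z\<in>A. (\<Sum>i\<le>N. \<psi> i * z ^ i) \<noteq> 0 \<and> inverse (\<Sum>i\<le>N. \<psi> i * z ^ i) \<notin> A"
  using assms unfolding nonunit_values_def by blast

locale comm_div_subring =
  fixes Z :: "'a::division_ring set"
  assumes Z: "div_subring Z" and comm: "x \<in> Z \<Longrightarrow> y \<in> Z \<Longrightarrow> x * y = y * x"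
begin

lemmas Z_closed = div_subringD[OF Z]

lemma left_comm: "x \<in> Z \<Longrightarrow> y \<in> Z \<Longrightarrow> x * (y * w) = y * (x * w)"
  using comm[of x y] by (metis mult.assoc)

lemma subset_frac: "is_subring A \<Longrightarrow> A \<subseteq> fracs A"
  unfolding fracs_def by (auto intro!: bexI[of _ 1] dest: is_subringD(2))

lemma frac_subset:
  assumes "A \<subseteq> Z" shows "fracs A \<subseteq> Z"
proof
  fix z assume "z \<in> fracs A"
  then obtain y where y: "y \<in> A" "y \<noteq> 0" "z * y \<in> A" unfolding fracs_def by blast
  then have "z = z * y * inverse y" by (simp add: mult.assoc)
  then show "z \<in> Z" using y assms Z_closed by (metis subsetD)
qed

lemma div_subring_frac:
  assumes A: "is_subring A" and AZ: "A \<subseteq> Z" shows "div_subring (fracs A)"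
proof -
  note fZ = frac_subset[OF AZ]
  have "x + y \<in> fracs A \<and> x * y \<in> fracs A" if xy: "x \<in> fracs A" "y \<in> fracs A" for x y
  proof -
    obtain a b where a: "a \<in> A" "a \<noteq> 0" "x * a \<in> A" and b: "b \<in> A" "b \<noteq> 0" "y * b \<in> A"
      using xy unfolding fracs_def by blast
    have mem: "x \<in> Z" "y \<in> Z" "a \<in> Z" "b \<in> Z" using xy fZ a b AZ by auto
    have "(x + y) * (a * b) = (x * a) * b + (y * b) * a"
      using comm[OF mem(3,4)] by (metis distrib_right mult.assoc)
    moreover have "(x * y) * (a * b) = (x * a) * (y * b)"
      by (simp only: mult.assoc left_comm[OF mem(2,3)])
    moreover have "a * b \<in> A" "a * b \<noteq> 0" using a b by (auto intro: is_subringD[OF A])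
    ultimately show ?thesis using a b is_subringD(3,4)[OF A] unfolding fracs_def
      by (metis (mono_tags, lifting) mem_Collect_eq)
  qed
  moreover have "- x \<in> fracs A \<and> inverse x \<in> fracs A" if x: "x \<in> fracs A" for x
  proof -
    obtain a where a: "a \<in> A" "a \<noteq> 0" "x * a \<in> A" using x unfolding fracs_def by blast
    have "- x * a \<in> A" using a is_subringD(5)[OF A] by simp
    moreover have "inverse x \<in> fracs A"
    proof (cases "x = 0")
      case False
      then have "inverse x * (x * a) = a" "x * a \<noteq> 0" using a by (auto simp: mult.assoc[symmetric])
      then show ?thesis using a unfolding fracs_def by (metis (mono_tags, lifting) mem_Collect_eq)
    qed (use x in simp)
    ultimately show ?thesis using a unfolding fracs_def by blast
  qed
  ultimately show ?thesis
    unfolding div_subring_def using subset_frac[OF A] is_subringD(1,2)[OF A] by blast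
qed

lemma common_denominator:
  assumes A: "is_subring A" and AZ: "A \<subseteq> Z" and "finite X" "X \<subseteq> fracs A"
  shows "\<exists>y\<in>A. y \<noteq> 0 \<and> (\<forall>x\<in>X. x * y \<in> A)"
  using assms(3,4)
proof (induction X rule: finite_induct)
  case empty
  then show ?case using is_subringD(2)[OF A] by (intro bexI[of _ 1]) auto
next
  case (insert x X)
  then obtain y where y: "y \<in> A" "y \<noteq> 0" "\<forall>x\<in>X. x * y \<in> A" by auto
  obtain b where b: "b \<in> A" "b \<noteq> 0" "x * b \<in> A" using insert unfolding fracs_def by auto
  have "x * (y * b) = (x * b) * y" using comm[of y b] y b AZ by (auto simp: mult.assoc)
  moreover have "w * (y * b) = w * y * b" for w by (simp add: mult.assoc)
  ultimately show ?case using y b is_subringD(4)[OF A]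
    by (intro bexI[of _ "y * b"]) auto
qed

lemma loc_mono:
  assumes A: "is_subring A" and AZ: "A \<subseteq> Z" and v: "v \<in> A" "w \<in> A"
  shows "localiz A v \<subseteq> localiz A (v * w)"
proof
  fix z assume "z \<in> localiz A v"
  then obtain k where k: "z * v ^ k \<in> A" unfolding localiz_def by blast
  have "v * w = w * v" using comm v AZ by auto
  then have "z * (v * w) ^ k = (z * v ^ k) * w ^ k"
    using power_mult_commuting[of v w k] by (simp add: mult.assoc)
  then have "z * (v * w) ^ k \<in> A" using k v is_subringD[OF A] by auto
  then show "z \<in> localiz A (v * w)" unfolding localiz_def by blast
qed

lemma loc_subset_frac:
  assumes "is_subring A" "v \<in> A" "v \<noteq> 0" shows "localiz A v \<subseteq> fracs A"
  unfolding localiz_def fracs_def using is_subringD(7)[OF assms(1,2)] assms(3)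
  by (auto intro!: bexI[of _ "v ^ _"])

lemma subset_loc: "A \<subseteq> localiz A v"
  unfolding localiz_def by (auto intro!: exI[of _ 0])

lemma is_subring_loc:
  assumes A: "is_subring A" and AZ: "A \<subseteq> Z" and v: "v \<in> A" "v \<noteq> 0"
  shows "is_subring (localiz A v)"
proof -
  have sub: "localiz A v \<subseteq> Z" using loc_subset_frac[OF A v] frac_subset[OF AZ] by blast
  have "x + y \<in> localiz A v \<and> x * y \<in> localiz A v" if xy: "x \<in> localiz A v" "y \<in> localiz A v" for x y
  proof -
    obtain k l where kl: "x * v ^ k \<in> A" "y * v ^ l \<in> A" using xy unfolding localiz_def by blast
    have vk: "v ^ i \<in> A" for i by (rule is_subringD(7)[OF A v(1)])
    have mem: "x \<in> Z" "y \<in> Z" "v ^ k \<in> Z" "v ^ l \<in> Z" using xy sub vk AZ by auto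
    have "(x + y) * v ^ (k + l) = (x * v ^ k) * v ^ l + (y * v ^ l) * v ^ k"
      using power_add[of v k l] power_add[of v l k] by (metis add.commute distrib_right mult.assoc)
    moreover have "(x * y) * v ^ (k + l) = (x * v ^ k) * (y * v ^ l)"
      by (simp only: power_add mult.assoc left_comm[OF mem(2,3)])
    ultimately show ?thesis using kl vk is_subringD(3,4)[OF A] unfolding localiz_def
      by (metis (mono_tags, lifting) mem_Collect_eq)
  qed
  moreover have "- x \<in> localiz A v" if "x \<in> localiz A v" for x
    using that is_subringD(5)[OF A] unfolding localiz_def by auto
  ultimately show ?thesis
    unfolding is_subring_def using subset_loc[of A v] is_subringD(1,2)[OF A] by blast
qed

text \<open>As in Euclid's proof: up to a factor, \<open>f\<close> takes values \<open>1 + \<rho> V\<close> with \<open>V\<close> divisible by all inverted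
  elements, and such a value is invertible after localization only if it is so in \<open>A\<close>.\<close>

lemma nonunit_values_monic:
  assumes A: "is_subring A" and AZ: "A \<subseteq> Z" and nv: "nonunit_values A"
    and f: "\<And>i. f i \<in> fracs A" and N: "N \<ge> 1" and v: "v \<in> A" "v \<noteq> 0"
  shows "\<exists>t\<in>A. monic N f 1 t \<noteq> 0 \<and> inverse (monic N f 1 t) \<notin> localiz A v"
proof -
  note Ac = is_subringD[OF A]
  note FR = div_subring_frac[OF A AZ]
  note Fc = div_subringD[OF FR]
  note FZ = frac_subset[OF AZ]
  define g where "g i = (if i = N then 1 else f i)" for i
  have gF: "g i \<in> fracs A" for i unfolding g_def using f Fc by auto
  have F: "monic N f 1 t = (\<Sum>i\<le>N. g i * t ^ i)" for t
    unfolding monic_def by (simp add: g_def lessThan_Suc_atMost[symmetric] add.commute)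
  \<comment> \<open>From \<open>inverse \<psi> = 1 - \<rho> * V * inverse \<psi>\<close>, the power
    of \<open>V\<close> that clears the denominator of \<open>inverse \<psi>\<close> can be lowered
    by one at a time.\<close>
  have unit: "inverse \<psi> \<in> A" if "\<psi> = 1 + \<rho> * V" "\<rho> \<in> A" "V \<in> A" "\<psi> \<noteq> 0" "inverse \<psi> * V ^ j \<in> A" for \<psi> \<rho> V j
    using that(5)
  proof (induction j)
    case (Suc j)
    have "\<psi> \<in> A" using that Ac by auto
    then have mem: "\<psi> \<in> Z" "inverse \<psi> \<in> Z" "\<rho> \<in> Z" "V \<in> Z" "V ^ j \<in> Z"
      using AZ that Z_closed by auto
    have "inverse \<psi> + \<rho> * (V * inverse \<psi>) = 1"
      using that by (metis distrib_right mult.assoc mult_1 right_inverse)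
    then have "(inverse \<psi> + \<rho> * (V * inverse \<psi>)) * V ^ j = V ^ j" by simp
    moreover have "V * (inverse \<psi> * V ^ j) = inverse \<psi> * V ^ Suc j"
      using left_comm[OF mem(4,2)] by simp
    ultimately have "inverse \<psi> * V ^ j = V ^ j - \<rho> * (inverse \<psi> * V ^ Suc j)"
      by (simp only: distrib_right mult.assoc eq_diff_eq)
    then show ?case using Suc that Ac by auto
  qed simp
  have "\<exists>i. g i \<noteq> 0" by (intro exI[of _ N]) (simp add: g_def)
  \<comment> \<open>Splitting off \<open>t ^ k\<close> leaves a cofactor with nonzero constant term,
    which can be normalized to 1. If the polynomial is \<open>X^N\<close> itself, the cofactor is
    trivial and a nonunit of the form \<open>1 + z * v\<close> does the work.\<close>
  define k where "k = (LEAST i. g i \<noteq> 0)"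
  have gk: "g k \<noteq> 0" unfolding k_def by (rule LeastI_ex) fact
  have gl: "g i = 0" if "i < k" for i using not_less_Least that unfolding k_def by blast
  have "k \<le> N" unfolding k_def by (rule Least_le) (simp add: g_def)
  show ?thesis
  proof (cases "k = N")
    case True
    have Ft: "monic N f 1 t = t ^ N" for t
    proof -
      have "(\<Sum>i<N. g i * t ^ i) = 0" using gl True by simp
      then show ?thesis unfolding F by (simp add: lessThan_Suc_atMost[symmetric] g_def)
    qed
    define \<psi> where "\<psi> i = (if i = 0 then 1 else v)" for i :: nat
    obtain z where z: "z \<in> A" "(\<Sum>i\<le>1. \<psi> i * z ^ i) \<noteq> 0" "inverse (\<Sum>i\<le>1. \<psi> i * z ^ i) \<notin> A"
      using nonunit_valuesD[OF nv, of \<psi> 1] v Ac unfolding \<psi>_def by fastforce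
    define t where "t = 1 + z * v"
    have "(\<Sum>i\<le>1. \<psi> i * z ^ i) = t"
      using comm[of v z] v z AZ by (auto simp: \<psi>_def t_def)
    then have t: "t \<in> A" "t \<noteq> 0" "inverse t \<notin> A" using z v Ac unfolding t_def by auto
    have "inverse (t ^ N) \<notin> localiz A v"
    proof
      assume "inverse (t ^ N) \<in> localiz A v"
      then obtain j where j: "inverse (t ^ N) * v ^ j \<in> A" unfolding localiz_def by blast
      obtain M where M: "N = Suc M" using N by (cases N) auto
      have "t * (t ^ M * inverse (t ^ N)) = t ^ N * inverse (t ^ N)"
        unfolding M by (simp add: mult.assoc)
      then have "inverse t = t ^ M * inverse (t ^ N)"
        using t(2) by (intro inverse_unique) simp
      then have "inverse t * v ^ j \<in> A" using j t Ac(4)[OF Ac(7)[OF t(1)] j, of M] by (simp add: mult.assoc)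
      then show False using unit[OF t_def z(1) v(1) t(2)] t(3) by blast
    qed
    then show ?thesis using t Ft by (intro bexI[of _ t]) auto
  next
    case False
    define M where "M = N - k"
    have M: "N = M + k" "M \<ge> 1" using False \<open>k \<le> N\<close> unfolding M_def by auto
    define h where "h i = g (i + k)" for i
    have hF: "h i \<in> fracs A" for i unfolding h_def by (rule gF)
    have h0: "h 0 \<noteq> 0" unfolding h_def using gk by simp
    have hM: "h M = 1" unfolding h_def g_def using M by simp
    have Fh: "monic N f 1 t = (\<Sum>i\<le>M. h i * t ^ i) * t ^ k" for t
    proof -
      have "(\<Sum>i\<le>N. g i * t ^ i) = (\<Sum>i\<in>{k..N}. g i * t ^ i)"
        by (rule sum.mono_neutral_right) (auto intro!: gl simp: not_le)
      also have "\<dots> = (\<Sum>i\<le>M. h i * t ^ (i + k))"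
        unfolding h_def by (rule sum.reindex_bij_witness[of _ "\<lambda>i. i + k" "\<lambda>i. i - k"]) (auto simp: M)
      finally show ?thesis unfolding F by (simp add: sum_distrib_right power_add mult.assoc)
    qed
    define \<kappa> where "\<kappa> i = inverse (h 0) * h i" for i
    have \<kappa>F: "\<kappa> i \<in> fracs A" for i unfolding \<kappa>_def using hF Fc by auto
    obtain \<beta> where \<beta>: "\<beta> \<in> A" "\<beta> \<noteq> 0" "\<forall>x\<in>\<kappa> ` {..M}. x * \<beta> \<in> A"
      using common_denominator[OF A AZ, of "\<kappa> ` {..M}"] \<kappa>F by auto
    obtain y where y: "y \<in> A" "y \<noteq> 0" "h 0 * y \<in> A" using hF[of 0] unfolding fracs_def by blast
    \<comment> \<open>The factor \<open>v\<close> absorbs denominators of the localization and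
      \<open>y\<close> that of \<open>h 0\<close>. The substitution
      \<open>t = \<beta> * V * z\<close> then puts a factor \<open>V\<close> into every nonconstant
      term.\<close>
    define V where "V = v * y"
    have V: "V \<in> A" "V \<noteq> 0" unfolding V_def using v y Ac by auto
    \<comment> \<open>One \<open>\<beta>\<close> clears the denominator of \<open>\<kappa> i\<close>
      and one \<open>V\<close> is held back, so that
      \<open>\<rho> i * V = \<kappa> i * \<beta> ^ i * V ^ i\<close> for
      \<open>1 \<le> i \<le> M\<close>.\<close>
    define \<rho> where "\<rho> i = (if i = 0 \<or> i > M then 0 else \<kappa> i * \<beta> * \<beta> ^ (i - 1) * V ^ (i - 1))" for i
    have \<rho>A: "\<rho> i \<in> A" for i unfolding \<rho>_def using \<beta> V Ac by auto
    define \<psi> where "\<psi> i = (if i = 0 then 1 else \<rho> i * V)" for i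
    have \<psi>A: "\<psi> i \<in> A" for i unfolding \<psi>_def using \<rho>A V Ac by auto
    have "\<psi> M \<noteq> 0" using M(2) \<beta> V h0 unfolding \<psi>_def \<rho>_def \<kappa>_def hM by auto
    then obtain z where z: "z \<in> A" "(\<Sum>i\<le>M. \<psi> i * z ^ i) \<noteq> 0" "inverse (\<Sum>i\<le>M. \<psi> i * z ^ i) \<notin> A"
      using nonunit_valuesD[where \<psi> = \<psi>, OF nv \<psi>A M(2)] by blast
    define p where "p = (\<Sum>i\<le>M. \<psi> i * z ^ i)"
    have pA: "p \<in> A" unfolding p_def using \<psi>A z Ac by (auto intro!: is_subring_sum A)
    define t where "t = \<beta> * V * z"
    have tA: "t \<in> A" unfolding t_def using \<beta> V z Ac by auto
    have memZ: "\<beta> \<in> Z" "V \<in> Z" "z \<in> Z" "\<And>i. \<kappa> i \<in> Z" "\<And>i. \<rho> i \<in> Z" "\<And>i. h i \<in> Z"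
      "\<And>i. V ^ i \<in> Z" "\<And>i. \<beta> ^ i \<in> Z" "\<And>i. z ^ i \<in> Z"
      using \<beta> V z \<kappa>F hF \<rho>A FZ AZ Z_closed by auto
    have pw: "t ^ i = \<beta> ^ i * V ^ i * z ^ i" for i
      unfolding t_def
      by (simp only: power_mult_commuting[OF comm[OF Z_closed(4)[OF memZ(1,2)] memZ(3)]]
          power_mult_commuting[OF comm[OF memZ(1,2)]])
    have \<kappa>t: "\<kappa> i * t ^ i = \<psi> i * z ^ i" if "i \<le> M" for i
    proof (cases i)
      case 0
      then show ?thesis using h0 by (simp add: \<psi>_def \<kappa>_def)
    next
      case (Suc l)
      have "\<rho> i * V = \<kappa> i * (\<beta> ^ i * V ^ i)"
        using that Suc by (simp add: \<rho>_def mult.assoc power_commutes)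
      moreover have "\<psi> i = \<rho> i * V" using Suc by (simp add: \<psi>_def)
      ultimately show ?thesis by (simp only: pw mult.assoc)
    qed
    have Fp: "monic N f 1 t = h 0 * p * t ^ k"
    proof -
      have "h i * t ^ i = h 0 * (\<kappa> i * t ^ i)" for i
        unfolding \<kappa>_def using h0 by (simp add: mult.assoc[symmetric])
      then have "(\<Sum>i\<le>M. h i * t ^ i) = h 0 * p"
        unfolding p_def using \<kappa>t by (simp add: sum_distrib_left)
      then show ?thesis unfolding Fh by simp
    qed
    define \<rho>' where "\<rho>' = (\<Sum>i\<le>M. \<rho> i * z ^ i)"
    have "p = 1 + \<rho>' * V"
    proof -
      have "p = (\<Sum>i\<le>M. (if i = 0 then 1 else 0) + \<rho> i * z ^ i * V)"
        unfolding p_def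
      proof (rule sum.cong)
        fix i assume "i \<in> {..M}"
        have "\<rho> i * V * z ^ i = \<rho> i * z ^ i * V"
          using comm[of V "z ^ i"] memZ by (simp add: mult.assoc)
        then show "\<psi> i * z ^ i = (if i = 0 then 1 else 0) + \<rho> i * z ^ i * V"
          by (cases "i = 0") (simp_all add: \<psi>_def \<rho>_def)
      qed simp
      then show ?thesis unfolding \<rho>'_def by (simp add: sum.distrib sum_distrib_right)
    qed
    moreover have "\<rho>' \<in> A" unfolding \<rho>'_def using \<rho>A z Ac by (auto intro!: is_subring_sum A)
    ultimately have unit': "inverse p * V ^ j \<in> A \<Longrightarrow> inverse p \<in> A" for j
      using unit[of p \<rho>' V j] V z(2) unfolding p_def by blast
    have pn: "inverse p \<notin> A" "p \<noteq> 0" using z unfolding p_def by auto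
    have "t \<noteq> 0"
    proof
      assume "t = 0"
      then have "z = 0" unfolding t_def using \<beta> V by auto
      then have "p = (\<Sum>i\<le>M. if i = 0 then 1 else 0)"
        unfolding p_def by (intro sum.cong) (auto simp: \<psi>_def power_0_left)
      then have "p = 1" by simp
      then show False using pn Ac by auto
    qed
    then have Fn: "monic N f 1 t \<noteq> 0" unfolding Fp using h0 pn by simp
    have "inverse (monic N f 1 t) \<notin> localiz A v"
    proof
      assume "inverse (monic N f 1 t) \<in> localiz A v"
      then obtain j where j: "inverse (monic N f 1 t) * v ^ j \<in> A" unfolding localiz_def by blast
      define I where "I = inverse (monic N f 1 t)"
      have tk: "t ^ k \<in> A" using tA Ac by auto
      have "monic N f 1 t \<in> Z" unfolding Fp
        using pA tk AZ memZ by (intro Z_closed(4)) auto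
      then have IZ: "I \<in> Z" unfolding I_def by (rule Z_closed)
      have yv: "y ^ i \<in> Z" "v ^ i \<in> Z" "y \<in> Z" "v \<in> Z" "t ^ k \<in> Z" "p \<in> Z" for i
        using y v tk pA AZ Z_closed by auto
      have "p * (h 0 * t ^ k * I) = h 0 * (p * (t ^ k * I))"
        using left_comm[OF yv(6) memZ(6), of 0 "t ^ k * I"] by (simp add: mult.assoc)
      also have "\<dots> = monic N f 1 t * I" unfolding Fp by (simp add: mult.assoc)
      finally have "inverse p = h 0 * t ^ k * I" using Fn pn
        unfolding I_def by (metis inverse_unique right_inverse)
      \<comment> \<open>The first \<open>j\<close> factors supply \<open>v ^ j\<close>; the extra
        factor guarantees a \<open>y\<close> to clear \<open>h 0\<close>, even for
        \<open>j = 0\<close>.\<close>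
      moreover have "V ^ Suc j = v ^ j * (y * (v * y ^ j))"
      proof -
        have "V ^ Suc j = v ^ Suc j * y ^ Suc j"
          unfolding V_def by (rule power_mult_commuting[OF comm[OF yv(4,3)]])
        also have "\<dots> = v ^ j * (v * (y * y ^ j))"
          by (simp only: power_Suc2[of v j] power_Suc[of y j] mult.assoc)
        also have "v * (y * y ^ j) = y * (v * y ^ j)" by (rule left_comm[OF yv(4,3)])
        finally show ?thesis .
      qed
      ultimately have "inverse p * V ^ Suc j = h 0 * (t ^ k * ((I * v ^ j) * (y * (v * y ^ j))))"
        by (simp add: mult.assoc)
      also have "(I * v ^ j) * (y * (v * y ^ j)) = y * ((I * v ^ j) * (v * y ^ j))"
        by (rule left_comm) (use IZ yv in \<open>auto intro: Z_closed\<close>)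
      also have "t ^ k * (y * ((I * v ^ j) * (v * y ^ j))) = y * (t ^ k * ((I * v ^ j) * (v * y ^ j)))"
        by (rule left_comm[OF yv(5,3)])
      also have "h 0 * (y * (t ^ k * ((I * v ^ j) * (v * y ^ j)))) = (h 0 * y) * (t ^ k * ((I * v ^ j) * (v * y ^ j)))"
        by (simp add: mult.assoc)
      also have "\<dots> \<in> A" using y v tk j Ac unfolding I_def by auto
      finally show False using unit' pn by blast
    qed
    then show ?thesis using Fn tA by blast
  qed
qed

end

section \<open>Nonunit values over the integers and over polynomial rings\<close>

lemma inj_of_int_if_infinite:
  assumes "infinite (range (of_int :: int \<Rightarrow> 'a::ring_1))"
  shows "inj (of_int :: int \<Rightarrow> 'a)"
proof (rule injI, rule ccontr)
  fix a b :: int assume ab: "(of_int a :: 'a) = of_int b" "a \<noteq> b"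
  define n where "n = \<bar>a - b\<bar>"
  have n: "n > 0" "(of_int n :: 'a) = 0" unfolding n_def using ab by (auto simp: abs_if)
  have "range (of_int :: int \<Rightarrow> 'a) \<subseteq> of_int ` {0..<n}"
  proof
    fix x :: 'a assume "x \<in> range of_int"
    then obtain k where k: "x = of_int k" by blast
    have "(of_int k :: 'a) = of_int (n * (k div n) + k mod n)" by simp
    also have "\<dots> = of_int (k mod n)" using n by (simp only: of_int_add of_int_mult) simp
    finally show "x \<in> of_int ` {0..<n}" using k n by auto
  qed
  then show False using assms finite_subset by blast
qed

lemma is_subring_of_int: "is_subring (range (of_int :: int \<Rightarrow> 'a::division_ring))"
  unfolding is_subring_def
proof (intro conjI ballI)
  show "(0::'a) \<in> range of_int" using rangeI[of of_int 0] by simp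
  show "(1::'a) \<in> range of_int" using rangeI[of of_int 1] by simp
qed (auto simp flip: of_int_add of_int_mult of_int_minus)

text \<open>The only units are 1 and -1. If every value were 0 or a unit, some value would be taken
  infinitely often by pigeonhole, and the polynomial minus that value would have infinitely many
  roots in spite of its leading coefficient.\<close>

lemma nonunit_values_of_int:
  assumes inf: "infinite (range (of_int :: int \<Rightarrow> 'a::division_ring))"
  shows "nonunit_values (range (of_int :: int \<Rightarrow> 'a))"
  unfolding nonunit_values_def
proof (intro allI impI, elim conjE)
  let ?A = "range (of_int :: int \<Rightarrow> 'a)"
  fix N :: nat and \<psi> :: "nat \<Rightarrow> 'a"
  assume \<psi>: "\<forall>i. \<psi> i \<in> ?A" and N: "N \<ge> 1" and lead: "\<psi> N \<noteq> 0"
  let ?p = "\<lambda>z. \<Sum>i\<le>N. \<psi> i * z ^ i"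
  show "\<exists>z\<in>?A. ?p z \<noteq> 0 \<and> inverse (?p z) \<notin> ?A"
  proof (rule ccontr)
    assume neg: "\<not> ?thesis"
    have "?p z \<in> {0, 1, -1}" if z: "z \<in> ?A" for z
    proof (rule ccontr)
      assume nt: "?p z \<notin> {0, 1, -1}"
      have "?p z \<in> ?A" by (intro is_subring_sum[OF is_subring_of_int] is_subringD(4,7)[OF is_subring_of_int]) (use \<psi> z in auto)
      then obtain a where a: "?p z = of_int a" by auto
      obtain b where b: "inverse (?p z) = of_int b" using neg z nt by auto
      have "(of_int (a * b) :: 'a) = ?p z * inverse (?p z)" unfolding of_int_mult a[symmetric] b[symmetric] ..
      also have "\<dots> = of_int 1" using nt by simp
      finally have "a * b = 1" using inj_of_int_if_infinite[OF inf] by (simp only: inj_eq)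
      then have "a = 1 \<or> a = -1" by (auto simp: zmult_eq_1_iff)
      then show False using nt unfolding a by auto
    qed
    then have "?p ` ?A \<subseteq> {0, 1, -1}" by (rule image_subsetI)
    then have "finite (?p ` ?A)" by (rule finite_subset) simp
    then obtain y where "y \<in> ?A" "infinite {z \<in> ?A. ?p z = ?p y}"
      using pigeonhole_infinite[OF inf] by blast
    then obtain w T where T: "infinite T" "T \<subseteq> ?A" "w \<in> ?A" "\<And>z. z \<in> T \<Longrightarrow> ?p z = w"
    proof -
      assume *: "y \<in> ?A" "infinite {z \<in> ?A. ?p z = ?p y}"
        "\<And>T w. \<lbrakk>infinite T; T \<subseteq> ?A; w \<in> ?A; \<And>z. z \<in> T \<Longrightarrow> ?p z = w\<rbrakk> \<Longrightarrow> thesis"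
      have "?p y \<in> ?A" by (intro is_subring_sum[OF is_subring_of_int] is_subringD(4,7)[OF is_subring_of_int]) (use \<psi> * in auto)
      then show thesis by (intro *(3)[of "{z \<in> ?A. ?p z = ?p y}" "?p y"]) (use * in auto)
    qed
    define c where "c i = \<psi> i - (if i = 0 then w else 0)" for i
    have commA: "x * y = y * x" if "x \<in> ?A" for x y :: 'a
      using that mult_of_int_commute by auto
    have "\<forall>i<Suc N. c i = 0"
    proof (rule finitely_many_central_roots[OF T(1)])
      fix t assume t: "t \<in> T"
      have "(\<Sum>i<Suc N. c i * t ^ i) = (\<Sum>i\<le>N. \<psi> i * t ^ i - (if i = 0 then w else 0))"
        unfolding lessThan_Suc_atMost by (rule sum.cong) (auto simp: c_def)
      then show "(\<Sum>i<Suc N. c i * t ^ i) = 0" using T(4)[OF t] by (simp add: sum_subtractf)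
    qed (use T(2) commA in blast)+
    then have "c N = 0" by simp
    then show False using N lead unfolding c_def by simp
  qed
qed

lemma div_subring_finite:
  fixes A :: "'a::division_ring set"
  assumes A: "is_subring A" and "finite A" shows "div_subring A"
proof -
  have "inverse x \<in> A" if x: "x \<in> A" "x \<noteq> 0" for x
  proof -
    have "inj_on ((*) x) A" using x by (simp add: inj_on_def)
    moreover have "(*) x ` A \<subseteq> A" using x is_subringD(4)[OF A] by auto
    ultimately have "(*) x ` A = A" using assms(2) endo_inj_surj by blast
    then obtain y where "y \<in> A" "x * y = 1" using is_subringD(2)[OF A] by (metis imageE)
    then show ?thesis using inverse_unique by metis
  qed
  then show ?thesis using A unfolding div_subring_def is_subring_def
    by (metis inverse_zero)
qed

definition adjoin :: "'a::division_ring set \<Rightarrow> 'a \<Rightarrow> 'a set" where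
  "adjoin L s = (\<lambda>P. P 1 s) ` polys L"

lemma adjoinI: "P \<in> polys L \<Longrightarrow> P 1 s \<in> adjoin L s"
  unfolding adjoin_def by blast

lemma subset_adjoin: "is_subring L \<Longrightarrow> L \<subseteq> adjoin L s" and adjoin_self: "s \<in> adjoin L s"
proof -
  show "L \<subseteq> adjoin L s"
  proof
    fix x assume "x \<in> L"
    then show "x \<in> adjoin L s"
      unfolding adjoin_def by (intro image_eqI[of _ _ "\<lambda>m \<tau>. x * m"] polys.const) auto
  qed
  show "s \<in> adjoin L s"
    unfolding adjoin_def by (intro image_eqI[of _ _ "\<lambda>m \<tau>. m * \<tau>"] polys.var) auto
qed

lemma adjoin_explicit:
  assumes L: "is_subring L"
  shows "x \<in> adjoin L s \<longleftrightarrow> (\<exists>n c. (\<forall>i. c i \<in> L) \<and> x = (\<Sum>i<n. c i * s ^ i))"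
proof
  assume "x \<in> adjoin L s"
  then obtain P where "P \<in> polys L" "x = P 1 s" unfolding adjoin_def by blast
  then show "\<exists>n c. (\<forall>i. c i \<in> L) \<and> x = (\<Sum>i<n. c i * s ^ i)"
    using polys_has_coeffs[OF L] unfolding has_coeffs_def by fastforce
next
  assume "\<exists>n c. (\<forall>i. c i \<in> L) \<and> x = (\<Sum>i<n. c i * s ^ i)"
  then obtain n c where c: "\<And>i. c i \<in> L" "x = (\<Sum>i<n. c i * s ^ i)" by blast
  then show "x \<in> adjoin L s" unfolding adjoin_def
    by (intro image_eqI[OF _ polys_explicit[OF L, of n c]]) auto
qed

context comm_div_subring
begin

lemma is_subring_adjoin:
  assumes L: "is_subring L" "L \<subseteq> Z" and s: "s \<in> Z"
  shows "is_subring (adjoin L s)" "adjoin L s \<subseteq> Z"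
proof -
  show sub: "adjoin L s \<subseteq> Z"
  proof
    fix x assume "x \<in> adjoin L s"
    then obtain n c where "\<And>i. c i \<in> L" "x = (\<Sum>i<n. c i * s ^ i)"
      using adjoin_explicit[OF L(1)] by blast
    then show "x \<in> Z" using L(2) s by (auto intro!: div_subring_sum[OF Z] Z_closed)
  qed
  have ctrZ: "ctr Z = Z" unfolding ctr_def using comm by auto
  have *: "P (Q 1 s) s = P 1 s * Q 1 s" if "P \<in> polys L" "Q \<in> polys L" for P Q
    by (rule polys_mult_central[OF div_subring_imp_subring[OF Z]])
      (use that L s ctrZ in \<open>auto intro: polys_mono[of L Z]\<close>)
  have "x + y \<in> adjoin L s \<and> x * y \<in> adjoin L s" if xy: "x \<in> adjoin L s" "y \<in> adjoin L s" for x y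
  proof -
    obtain P Q where P: "P \<in> polys L" "x = P 1 s" and Q: "Q \<in> polys L" "y = Q 1 s"
      using xy unfolding adjoin_def by blast
    have "x + y = (\<lambda>m \<tau>. P m \<tau> + Q m \<tau>) 1 s" "x * y = (\<lambda>m \<tau>. P (Q m \<tau>) \<tau>) 1 s"
      using P Q * by auto
    then show ?thesis
      using adjoinI[OF polys.add[OF P(1) Q(1)], of s] adjoinI[OF polys.mult[OF P(1) Q(1)], of s] by simp
  qed
  moreover have "- x \<in> adjoin L s" if x: "x \<in> adjoin L s" for x
  proof -
    have "- 1 \<in> adjoin L s" using subset_adjoin[OF L(1)] is_subringD(2,5)[OF L(1)] by blast
    then show ?thesis using calculation[OF _ x, of "- 1"] by simp
  qed
  ultimately show "is_subring (adjoin L s)"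
    unfolding is_subring_def using subset_adjoin[OF L(1)] is_subringD(1,2)[OF L(1)] by blast
qed

lemma div_subring_algebraic:
  assumes K: "div_subring K" "K \<subseteq> D" and D: "is_subring D"
    and alg: "\<And>x. x \<in> D \<Longrightarrow> algebraic_over K x"
  shows "div_subring D"
proof -
  have "inverse x \<in> D" if x: "x \<in> D" for x
  proof (cases "x = 0")
    case False
    obtain n c where "\<forall>i. c i \<in> K" "inverse x = (\<Sum>i<n. c i * x ^ i)"
      using inverse_polynomial[OF K(1) alg[OF x] False] by blast
    then show ?thesis using K(2) x by (auto intro!: is_subring_sum[OF D] is_subringD[OF D])
  qed (use x in simp)
  then show ?thesis using D unfolding is_subring_def div_subring_def by blast
qed

text \<open>Division by the minimal polynomial of \<open>s\<close> leaves a finite span over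
  \<open>L\<close>. Every element whose powers stay in a finite span is algebraic, so its inverse is
  a polynomial in it.\<close>

lemma adjoin_algebraic:
  assumes L: "div_subring L" "L \<subseteq> Z" and s: "s \<in> Z" and alg: "algebraic_over L s"
  shows "div_subring (adjoin L s)" "\<exists>B. finite B \<and> B \<subseteq> adjoin L s \<and> adjoin L s \<subseteq> spn L B"
proof -
  note LR = div_subring_imp_subring[OF L(1)]
  note AR = is_subring_adjoin[OF LR L(2) s]
  obtain N f where m: "minpoly L s N f" using minpoly_exists[OF L(1) alg] by blast
  define B where "B = (\<lambda>i. s ^ i) ` {..<N}"
  have fin: "finite B" unfolding B_def by simp
  have sub: "adjoin L s \<subseteq> spn L B"
  proof
    fix x assume "x \<in> adjoin L s"
    then obtain P where P: "P \<in> polys L" "x = P 1 s" unfolding adjoin_def by blast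
    have f: "\<And>i. f i \<in> L" "N \<ge> 1" "monic N f 1 s = 0"
      using m unfolding minpoly_def monic_def by auto
    obtain Q r where Q: "Q \<in> polys L" "\<forall>i. r i \<in> L"
      "P = (\<lambda>m \<tau>. Q (monic N f m \<tau>) \<tau> + (\<Sum>i<N. r i * m * \<tau> ^ i))"
      using polys_division[where f = f and N = N, OF LR f(1,2) P(1)] by blast
    have "x = (\<Sum>i<N. r i * s ^ i)" unfolding P(2) Q(3) using f(3) polys_zero_arg[OF Q(1)] by simp
    also have "\<dots> \<in> spn L B" using Q(2) unfolding B_def by (intro spn_sum spn_base) auto
    finally show "x \<in> spn L B" .
  qed
  have "s ^ i \<in> adjoin L s" for i using is_subringD(7)[OF AR(1) adjoin_self] .
  then show "\<exists>B. finite B \<and> B \<subseteq> adjoin L s \<and> adjoin L s \<subseteq> spn L B"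
    using fin sub unfolding B_def by (intro exI[of _ B]) (auto simp: B_def)
  show "div_subring (adjoin L s)"
  proof (rule div_subring_algebraic[OF L(1) subset_adjoin[OF LR] AR(1)])
    fix x assume x: "x \<in> adjoin L s"
    have "x ^ i \<in> spn L B" for i using is_subringD(7)[OF AR(1) x, of i] sub by blast
    then show "algebraic_over L x" by (rule algebraic_in_span[OF L(1) fin])
  qed
qed

end

locale transcendental_adjoin = comm_div_subring +
  fixes L s
  assumes L: "div_subring L" "L \<subseteq> Z" and s: "s \<in> Z" and transc: "\<not> algebraic_over L s"
begin

lemmas LR = div_subring_imp_subring[OF L(1)]
lemmas AR = is_subring_adjoin[OF LR L(2) s]

text \<open>Degree is kept as a pair of relations, \<open>deg_less\<close> and
  \<open>has_deg\<close>, that can be read off any expansion in powers of \<open>s\<close>.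
  Transcendence enters only to show that the two exclude each other.\<close>

definition deg_less :: "'a \<Rightarrow> nat \<Rightarrow> bool" where
  "deg_less x n \<longleftrightarrow> (\<exists>c. (\<forall>i. c i \<in> L) \<and> x = (\<Sum>i<n. c i * s ^ i))"

definition has_deg :: "'a \<Rightarrow> nat \<Rightarrow> bool" where
  "has_deg x n \<longleftrightarrow> (\<exists>y c. deg_less y n \<and> c \<in> L \<and> c \<noteq> 0 \<and> x = y + c * s ^ n)"

lemma deg_less_Z: "deg_less x n \<Longrightarrow> x \<in> Z"
  unfolding deg_less_def using L(2) s by (auto intro!: div_subring_sum[OF Z] Z_closed)

lemma deg_less_zero: "deg_less 0 n"
  unfolding deg_less_def by (intro exI[of _ "\<lambda>_. 0"]) (auto intro: is_subringD[OF LR])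

lemma deg_less_add:
  assumes "deg_less x n" "deg_less y n" shows "deg_less (x + y) n"
proof -
  obtain c d where "\<And>i. c i \<in> L" "x = (\<Sum>i<n. c i * s ^ i)" "\<And>i. d i \<in> L" "y = (\<Sum>i<n. d i * s ^ i)"
    using assms unfolding deg_less_def by blast
  then show ?thesis unfolding deg_less_def
    by (intro exI[of _ "\<lambda>i. c i + d i"]) (auto simp: sum.distrib distrib_right intro: is_subringD[OF LR])
qed

lemma deg_less_sum: "(\<And>i. i \<in> I \<Longrightarrow> deg_less (f i) n) \<Longrightarrow> deg_less (sum f I) n"
  by (induction I rule: infinite_finite_induct) (auto intro: deg_less_add deg_less_zero)

lemma deg_less_monom: "c \<in> L \<Longrightarrow> k < n \<Longrightarrow> deg_less (c * s ^ k) n"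
  unfolding deg_less_def
  by (intro exI[of _ "\<lambda>i. if i = k then c else 0"])
    (auto simp: if_distrib[of "\<lambda>x. x * _"] intro: is_subringD[OF LR] cong: if_cong)

lemma deg_less_mono:
  assumes "deg_less x n" "n \<le> m" shows "deg_less x m"
proof -
  obtain c where "\<And>i. c i \<in> L" "x = (\<Sum>i<n. c i * s ^ i)" using assms unfolding deg_less_def by blast
  then show ?thesis using assms(2) by (auto intro!: deg_less_sum deg_less_monom)
qed

lemma L_comm: "c \<in> L \<Longrightarrow> s ^ i * c = c * s ^ i"
  using comm L s Z_closed by (meson subsetD)

lemma deg_less_mult_monom:
  assumes "deg_less x n" "c \<in> L" shows "deg_less (x * (c * s ^ k)) (n + k)"
proof -
  obtain d where d: "\<And>i. d i \<in> L" "x = (\<Sum>i<n. d i * s ^ i)" using assms unfolding deg_less_def by blast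
  have "d i * s ^ i * (c * s ^ k) = (d i * c) * s ^ (i + k)" for i
    using L_comm[OF assms(2), of i] by (metis mult.assoc power_add)
  then have "x * (c * s ^ k) = (\<Sum>i<n. (d i * c) * s ^ (i + k))"
    unfolding d(2) sum_distrib_right by simp
  also have "deg_less \<dots> (n + k)"
    using assms d by (intro deg_less_sum deg_less_monom) (auto intro: is_subringD[OF LR])
  finally show ?thesis .
qed

lemma deg_less_mult:
  assumes "deg_less x n" "deg_less y k" shows "deg_less (x * y) (n + k)"
proof -
  obtain d where d: "\<And>i. d i \<in> L" "y = (\<Sum>i<k. d i * s ^ i)" using assms unfolding deg_less_def by blast
  have "x * y = (\<Sum>i<k. x * (d i * s ^ i))" unfolding d by (simp add: sum_distrib_left)
  also have "deg_less \<dots> (n + k)"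
  proof (rule deg_less_sum)
    fix i assume "i \<in> {..<k}"
    then show "deg_less (x * (d i * s ^ i)) (n + k)"
      using deg_less_mono[OF deg_less_mult_monom[OF assms(1) d(1)[of i], of i], of "n + k"] by simp
  qed
  finally show ?thesis .
qed

lemma has_deg_not_deg_less:
  assumes "has_deg x n" shows "\<not> deg_less x n"
proof
  assume "deg_less x n"
  obtain y c where yc: "deg_less y n" "c \<in> L" "c \<noteq> 0" "x = y + c * s ^ n"
    using assms unfolding has_deg_def by blast
  obtain d e where d: "\<And>i. d i \<in> L" "x = (\<Sum>i<n. d i * s ^ i)" and e: "\<And>i. e i \<in> L" "y = (\<Sum>i<n. e i * s ^ i)"
    using \<open>deg_less x n\<close> yc(1) unfolding deg_less_def by blast
  define h where "h i = (if i = n then c else e i - d i)" for i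
  have "(\<Sum>i<Suc n. h i * s ^ i) = (\<Sum>i<n. e i * s ^ i) - (\<Sum>i<n. d i * s ^ i) + c * s ^ n"
    by (simp add: h_def left_diff_distrib sum_subtractf)
  also have "\<dots> = 0" using yc(4) d(2) e(2) by (metis diff_add_eq diff_self)
  finally have "(\<Sum>i<Suc n. h i * s ^ i) = 0" .
  moreover have "\<forall>i. h i \<in> L" unfolding h_def using yc d e by (auto intro: is_subringD[OF LR])
  moreover have "\<exists>i<Suc n. h i \<noteq> 0" by (intro exI[of _ n]) (simp add: h_def yc)
  ultimately show False using transc unfolding algebraic_over_def by blast
qed

lemma has_deg_exists:
  assumes "x \<in> adjoin L s" "x \<noteq> 0" shows "\<exists>n. has_deg x n"
proof -
  obtain n c where c: "\<And>i. c i \<in> L" "x = (\<Sum>i<n. c i * s ^ i)"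
    using assms(1) adjoin_explicit[OF LR] by blast
  then show ?thesis using assms(2)
  proof (induction n arbitrary: x)
    case (Suc n)
    show ?case
    proof (cases "c n = 0")
      case False
      then show ?thesis using Suc.prems unfolding has_deg_def deg_less_def
        by (intro exI[of _ n] exI[of _ "\<Sum>i<n. c i * s ^ i"] exI[of _ "c n"]) auto
    qed (use Suc in simp)
  qed simp
qed

lemma has_deg_mult:
  assumes "has_deg x n" "has_deg y k" shows "has_deg (x * y) (n + k)"
proof -
  obtain x' c where x: "deg_less x' n" "c \<in> L" "c \<noteq> 0" "x = x' + c * s ^ n"
    using assms unfolding has_deg_def by blast
  obtain y' d where y: "deg_less y' k" "d \<in> L" "d \<noteq> 0" "y = y' + d * s ^ k"
    using assms unfolding has_deg_def by blast
  have mem: "y' \<in> Z" "c * s ^ n \<in> Z" using deg_less_Z[OF y(1)] x(2) L(2) s Z_closed by auto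
  have "(c * s ^ n) * (d * s ^ k) = c * d * s ^ (n + k)"
    using L_comm[OF y(2), of n] by (metis mult.assoc power_add)
  moreover have "(c * s ^ n) * y' = y' * (c * s ^ n)" by (rule comm[OF mem(2,1)])
  ultimately have "x * y = (x' * y' + x' * (d * s ^ k) + y' * (c * s ^ n)) + c * d * s ^ (n + k)"
    unfolding x y by (simp only: distrib_left distrib_right add_ac)
  moreover have "deg_less (y' * (c * s ^ n)) (n + k)"
    using deg_less_mult_monom[OF y(1) x(2), of n] by (simp add: add.commute)
  then have "deg_less (x' * y' + x' * (d * s ^ k) + y' * (c * s ^ n)) (n + k)"
    by (intro deg_less_add deg_less_mult[OF x(1) y(1)] deg_less_mult_monom[OF x(1) y(2)])
  ultimately show ?thesis unfolding has_deg_def using x y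
    by (intro exI[of _ "x' * y' + x' * (d * s ^ k) + y' * (c * s ^ n)"] exI[of _ "c * d"])
      (auto intro: is_subringD[OF LR])
qed

lemma nonunit_values_adjoin: "nonunit_values (adjoin L s)"
  unfolding nonunit_values_def
proof (intro allI impI, elim conjE)
  let ?A = "adjoin L s"
  fix N :: nat and \<psi> :: "nat \<Rightarrow> 'a"
  assume \<psi>: "\<forall>i. \<psi> i \<in> ?A" and N: "N \<ge> 1" and lead: "\<psi> N \<noteq> 0"
  have "\<exists>n. deg_less (\<psi> i) n" for i
    using \<psi> adjoin_explicit[OF LR] unfolding deg_less_def by blast
  then obtain dg where dg: "\<And>i. deg_less (\<psi> i) (dg i)" by metis
  \<comment> \<open>\<open>J\<close> is positive and exceeds the degrees of all coefficients up to
    \<open>N\<close>, so at \<open>z = s ^ J\<close> the terms \<open>\<psi> i * z ^ i\<close> with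
    \<open>i < N\<close> have degree below \<open>J * N\<close> and cannot reach the leading
    one.\<close>
  define J where "J = Suc (\<Sum>i\<le>N. dg i)"
  have J: "deg_less (\<psi> i) J" if "i \<le> N" for i
  proof (rule deg_less_mono[OF dg])
    have "dg i \<le> (\<Sum>i\<le>N. dg i)" by (rule member_le_sum) (use that in auto)
    then show "dg i \<le> J" unfolding J_def by simp
  qed
  define z where "z = s ^ J"
  have zA: "z \<in> ?A" unfolding z_def by (rule is_subringD(7)[OF AR(1) adjoin_self])
  obtain M where M: "N = Suc M" using N by (cases N) auto
  define p where "p = (\<Sum>i\<le>N. \<psi> i * z ^ i)"
  obtain d where d: "has_deg (\<psi> N) d" using has_deg_exists lead \<psi> by blast
  have mon: "has_deg (s ^ k) k" for k
    unfolding has_deg_def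
    by (intro exI[of _ 0] exI[of _ 1]) (auto intro: deg_less_zero is_subringD[OF LR])
  have low: "deg_less (\<Sum>i\<le>M. \<psi> i * z ^ i) (J * N)"
  proof (rule deg_less_sum)
    fix i assume i: "i \<in> {..M}"
    have "deg_less (\<psi> i * (1 * s ^ (J * i))) (J + J * i)"
      by (rule deg_less_mult_monom) (use i M J is_subringD[OF LR] in auto)
    moreover have "J + J * i \<le> J * N" using i M by (metis Suc_le_mono atMost_iff mult_Suc_right mult_le_mono2)
    ultimately show "deg_less (\<psi> i * z ^ i) (J * N)"
      unfolding z_def using deg_less_mono by (simp add: power_mult)
  qed
  have "has_deg (\<psi> N * s ^ (J * N)) (d + J * N)" by (rule has_deg_mult[OF d mon])
  then obtain y c where yc: "deg_less y (d + J * N)" "c \<in> L" "c \<noteq> 0" "\<psi> N * s ^ (J * N) = y + c * s ^ (d + J * N)"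
    unfolding has_deg_def by blast
  have "p = ((\<Sum>i\<le>M. \<psi> i * z ^ i) + y) + c * s ^ (d + J * N)"
    unfolding p_def M using yc(4) by (simp add: z_def M power_mult[symmetric] add.assoc)
  moreover have "deg_less ((\<Sum>i\<le>M. \<psi> i * z ^ i) + y) (d + J * N)"
    by (rule deg_less_add[OF deg_less_mono[OF low] yc(1)]) simp
  ultimately have deg: "has_deg p (d + J * N)" unfolding has_deg_def using yc by blast
  have p0: "p \<noteq> 0" using has_deg_not_deg_less[OF deg] deg_less_zero by auto
  \<comment> \<open>Degrees add, so an inverse in \<open>L[s]\<close> would give 1 the positive
    degree \<open>d + J * N + e\<close>.\<close>
  have "inverse p \<notin> ?A"
  proof
    assume "inverse p \<in> ?A"
    then obtain e where "has_deg (inverse p) e" using has_deg_exists p0 by fastforce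
    from has_deg_mult[OF deg this] have "has_deg 1 (d + J * N + e)" using p0 by simp
    moreover have "deg_less 1 (d + J * N + e)"
      using deg_less_monom[of 1 0 "d + J * N + e"] is_subringD(2)[OF LR] M by (auto simp: J_def)
    ultimately show False using has_deg_not_deg_less by blast
  qed
  then show "\<exists>z\<in>?A. (\<Sum>i\<le>N. \<psi> i * z ^ i) \<noteq> 0 \<and> inverse (\<Sum>i\<le>N. \<psi> i * z ^ i) \<notin> ?A"
    using zA p0 unfolding p_def by blast
qed

end

section \<open>Central subfields of arithmetic type\<close>

lemma of_int_in_subring:
  assumes "is_subring A" shows "of_int k \<in> A"
proof -
  have n: "of_nat n \<in> A" for n by (induction n) (auto intro: is_subringD[OF assms])
  show ?thesis
    using n[of "nat k"] n[of "nat (- k)"] is_subringD(5)[OF assms, of "of_nat (nat (- k))"]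
    by (cases "k \<ge> 0") (auto simp: of_nat_nat)
qed

context comm_div_subring
begin

text \<open>The intended instances are finite fields and finite extensions of the rationals or of a
  rational function field. Asking for a spanning set rather than a basis reduces a finite extension
  to \<open>spn_trans\<close>.\<close>

definition arithmetic_subfield :: "'a set \<Rightarrow> bool" where
  "arithmetic_subfield L \<longleftrightarrow> div_subring L \<and> L \<subseteq> Z \<and> (finite L \<or>
     (\<exists>A B. is_subring A \<and> A \<subseteq> L \<and> nonunit_values A \<and> finite B \<and> B \<subseteq> L \<and> L \<subseteq> spn (fracs A) B))"

lemma arithmetic_subfield_fracs:
  assumes "is_subring A" "A \<subseteq> Z" "nonunit_values A" shows "arithmetic_subfield (fracs A)"
proof -
  have "x \<in> spn (fracs A) {1}" if "x \<in> fracs A" for x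
    using spn_base[OF that, of 1 "{1}"] by simp
  then have "fracs A \<subseteq> spn (fracs A) {1}" by blast
  moreover have "{1} \<subseteq> fracs A" using subset_frac[OF assms(1)] is_subringD(2)[OF assms(1)] by blast
  ultimately show ?thesis unfolding arithmetic_subfield_def
    using assms div_subring_frac[OF assms(1,2)] frac_subset[OF assms(2)] subset_frac[OF assms(1)]
    by (intro conjI disjI2 exI[of _ A] exI[of _ "{1}"]) auto
qed

text \<open>Adjoin the generators one by one: an algebraic one enlarges the span, a transcendental one
  replaces the base ring by a polynomial ring over everything obtained so far.\<close>

lemma arithmetic_subfield_exists:
  assumes "finite \<Gamma>" "\<Gamma> \<subseteq> Z" shows "\<exists>L. arithmetic_subfield L \<and> \<Gamma> \<subseteq> L"
  using assms
proof (induction \<Gamma> rule: finite_induct)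
  case empty
  \<comment> \<open>Without generators the prime ring decides: if it is finite it is already a
    field, otherwise it is a copy of the integers and serves as \<open>A\<close>.\<close>
  let ?I = "range (of_int :: int \<Rightarrow> 'a)"
  have IZ: "?I \<subseteq> Z" using of_int_in_subring[OF div_subring_imp_subring[OF Z]] by blast
  show ?case
  proof (cases "finite ?I")
    case True
    then have "arithmetic_subfield ?I" unfolding arithmetic_subfield_def
      using div_subring_finite[OF is_subring_of_int] IZ by blast
    then show ?thesis by blast
  next
    case False
    then show ?thesis
      using arithmetic_subfield_fracs[OF is_subring_of_int IZ nonunit_values_of_int] by blast
  qed
next
  case (insert s \<Gamma>)
  then obtain L where L: "arithmetic_subfield L" "\<Gamma> \<subseteq> L" by blast
  then have LS: "div_subring L" "L \<subseteq> Z" unfolding arithmetic_subfield_def by auto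
  note LR = div_subring_imp_subring[OF LS(1)]
  have s: "s \<in> Z" using insert by simp
  show ?case
  proof (cases "algebraic_over L s")
    case True
    note adj = adjoin_algebraic[OF LS s True]
    obtain C where C: "finite C" "adjoin L s \<subseteq> spn L C" "C \<subseteq> adjoin L s" using adj(2) by blast
    have "finite (adjoin L s) \<or> (\<exists>A B. is_subring A \<and> A \<subseteq> adjoin L s \<and> nonunit_values A \<and>
      finite B \<and> B \<subseteq> adjoin L s \<and> adjoin L s \<subseteq> spn (fracs A) B)"
    proof (cases "finite L")
      case True
      then show ?thesis using spn_finite[OF True C(1) LR] C(2) finite_subset by blast
    next
      case False
      then obtain A B where A: "is_subring A" "A \<subseteq> L" "nonunit_values A" "finite B" "L \<subseteq> spn (fracs A) B"
        and BL: "B \<subseteq> L"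
        using L(1) unfolding arithmetic_subfield_def by blast
      have "is_subring (fracs A)"
        using div_subring_frac[OF A(1)] A(2) LS(2) div_subring_imp_subring by blast
      then have "adjoin L s \<subseteq> spn (fracs A) ((\<lambda>(b, c). b * c) ` (B \<times> C))"
        using C(2) spn_trans[OF _ A(5)] by blast
      moreover have "A \<subseteq> adjoin L s" using A(2) subset_adjoin[OF LR] by blast
      moreover have "(\<lambda>(b, c). b * c) ` (B \<times> C) \<subseteq> adjoin L s"
        using BL C(3) subset_adjoin[OF LR] is_subringD(4)[OF is_subring_adjoin(1)[OF LR LS(2) s]]
        by (auto simp: subset_iff)
      ultimately show ?thesis using A(1,3,4) C(1) by (metis finite_cartesian_product finite_imageI)
    qed
    then have "arithmetic_subfield (adjoin L s)"
      unfolding arithmetic_subfield_def using adj(1) is_subring_adjoin(2)[OF LR LS(2) s] by blast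
    then show ?thesis using L(2) subset_adjoin[OF LR, of s] adjoin_self[of s L] by blast
  next
    case False
    interpret transcendental_adjoin Z L s by unfold_locales (use LS s False in auto)
    have "arithmetic_subfield (fracs (adjoin L s))"
      by (rule arithmetic_subfield_fracs[OF AR nonunit_values_adjoin])
    then show ?thesis
      using \<open>\<Gamma> \<subseteq> L\<close> subset_adjoin[OF LR, of s] adjoin_self[of s L] subset_frac[OF AR(1)] by blast
  qed
qed

end

lemma comm_div_subring_ctr: "div_subring D \<Longrightarrow> comm_div_subring (ctr D)"
  by (intro comm_div_subring.intro div_subring_ctr) (unfold ctr_def, blast+)

text \<open>The center of the generated division ring may be far too large, but a spanning set
  involves only finitely many structure constants. These lie in a subfield \<open>L\<close> of
  arithmetic type, and the \<open>L\<close>-span of the spanning set is a ring. Being finite or of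
  finite dimension over a field, it is a division ring.\<close>

lemma arithmetic_order_exists:
  assumes wlf: "weakly_locally_finite TYPE('a::division_ring)" and E: "finite (E :: 'a set)"
  shows "\<exists>D. div_subring D \<and> E \<subseteq> D \<and> (finite D \<or>
    (\<exists>A C. is_subring A \<and> nonunit_values A \<and> A \<subseteq> ctr D \<and> finite C \<and> C \<subseteq> D \<and> D \<subseteq> spn (fracs A) C))"
proof -
  define K where "K = div_subring_gen E"
  have K: "div_subring K" "E \<subseteq> K" unfolding K_def by (rule div_subring_gen)+
  interpret comm_div_subring "ctr K" by (rule comm_div_subring_ctr[OF K(1)])
  have central: "z * x = x * z" if "z \<in> ctr K" "x \<in> K" for z x
    using that unfolding ctr_def by blast
  have "fin_dim_over_center K" using wlf E unfolding weakly_locally_finite_def K_def by simp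
  then obtain B0 where B0: "finite B0" "B0 \<subseteq> K"
    "\<And>x. x \<in> K \<Longrightarrow> \<exists>c. (\<forall>b\<in>B0. c b \<in> ctr K) \<and> x = (\<Sum>b\<in>B0. c b * b)"
    unfolding fin_dim_over_center_def by auto
  \<comment> \<open>With \<open>E\<close> and 1 among the spanning elements, the span over a smaller
    field still contains them. The set may become dependent; any choice of coordinates yields
    structure constants.\<close>
  define B where "B = B0 \<union> E \<union> {1}"
  have B: "finite B" "B \<subseteq> K" unfolding B_def using B0 E K(2) div_subringD(2)[OF K(1)] by auto
  have "\<exists>c. (\<forall>b. c b \<in> ctr K) \<and> (x \<in> K \<longrightarrow> x = (\<Sum>b\<in>B. c b * b))" for x
  proof (cases "x \<in> K")
    case True
    then obtain c where c: "\<forall>b\<in>B0. c b \<in> ctr K" "x = (\<Sum>b\<in>B0. c b * b)" using B0(3) by blast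
    have "x = (\<Sum>b\<in>B. (if b \<in> B0 then c b else 0) * b)"
      unfolding c(2) by (rule sum.mono_neutral_cong_left) (auto simp: B(1), auto simp: B_def)
    then show ?thesis using c(1) Z_closed(1)
      by (intro exI[of _ "\<lambda>b. if b \<in> B0 then c b else 0"]) auto
  qed (use Z_closed(1) in auto)
  then obtain co where co: "\<And>x b. co x b \<in> ctr K" "\<And>x. x \<in> K \<Longrightarrow> x = (\<Sum>b\<in>B. co x b * b)"
    by metis
  define \<Gamma> where "\<Gamma> = (\<lambda>(b, b', d). co (b * b') d) ` (B \<times> B \<times> B)"
  have "finite \<Gamma>" "\<Gamma> \<subseteq> ctr K" unfolding \<Gamma>_def using B co by auto
  then obtain L where L: "arithmetic_subfield L" "\<Gamma> \<subseteq> L" using arithmetic_subfield_exists by blast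
  then have LS: "div_subring L" "L \<subseteq> ctr K" unfolding arithmetic_subfield_def by auto
  note LR = div_subring_imp_subring[OF LS(1)]
  define D where "D = spn L B"
  have DK: "D \<subseteq> K" unfolding D_def
    by (rule spn_subset[OF div_subring_imp_subring[OF K(1)]]) (use LS B in \<open>auto simp: ctr_def\<close>)
  have BD: "B \<subseteq> D" unfolding D_def by (rule spn_self[OF LR])
  have bb: "b * b' \<in> D" if "b \<in> B" "b' \<in> B" for b b'
  proof -
    have "b * b' = (\<Sum>d\<in>B. co (b * b') d * d)"
      using that B(2) by (intro co) (auto intro: div_subringD[OF K(1)])
    also have "\<dots> \<in> D" unfolding D_def
    proof (rule spn_sum, rule spn_base)
      fix d assume "d \<in> B"
      then have "co (b * b') d \<in> \<Gamma>" unfolding \<Gamma>_def using that by force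
      then show "co (b * b') d \<in> L" using L(2) by blast
    qed
    finally show ?thesis .
  qed
  have by_: "b * y \<in> D" if "b \<in> B" "y \<in> D" for b y
    using that(2) unfolding D_def
  proof induction
    case (step y k b')
    have "k * b = b * k" by (rule central) (use step LS B that in auto)
    then have "b * (k * b' + y) = k * (b * b') + b * y" by (metis distrib_left mult.assoc)
    then show ?case using step bb[OF that(1)] unfolding D_def by (auto intro: spn_add spn_scale[OF LR])
  qed (simp add: spn.zero)
  have xy: "x * y \<in> D" if "x \<in> D" "y \<in> D" for x y
    using that(1) unfolding D_def
  proof induction
    case (step x k b)
    have "(k * b + x) * y = k * (b * y) + x * y" by (simp add: distrib_right mult.assoc)
    then show ?case using step by_[OF _ that(2)] unfolding D_def by (auto intro: spn_add spn_scale[OF LR])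
  qed (simp add: spn.zero)
  have D: "is_subring D" unfolding is_subring_def
  proof (intro conjI ballI)
    show "1 \<in> D" using BD unfolding B_def by blast
    show "- x \<in> D" if "x \<in> D" for x
      using spn_scale[OF LR, of x B "- 1"] that is_subringD[OF LR] unfolding D_def by auto
  qed (use xy in \<open>auto simp: D_def intro: spn_add spn.zero\<close>)
  have ED: "E \<subseteq> D" using BD unfolding B_def by blast
  have LD: "L \<subseteq> D"
  proof
    fix l assume "l \<in> L"
    then show "l \<in> D" using spn_base[of l L 1 B] unfolding D_def B_def by simp
  qed
  show ?thesis
  proof (cases "finite L")
    case True
    then have "finite D" unfolding D_def by (rule spn_finite[OF _ B(1) LR])
    then show ?thesis using div_subring_finite[OF D] ED by blast
  next
    case False
    then obtain A C where A: "is_subring A" "A \<subseteq> L" "nonunit_values A" "finite C" "L \<subseteq> spn (fracs A) C"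
      and CL: "C \<subseteq> L"
      using L(1) unfolding arithmetic_subfield_def by blast
    have F: "div_subring (fracs A)" using div_subring_frac[OF A(1)] A(2) LS(2) by blast
    interpret L: comm_div_subring L by unfold_locales (use LS comm in auto)
    have FD: "fracs A \<subseteq> D" using L.frac_subset[OF A(2)] LD by blast
    define C' where "C' = (\<lambda>(b, c). b * c) ` (C \<times> B)"
    have fin: "finite C'" unfolding C'_def using A(4) B(1) by simp
    have DC: "D \<subseteq> spn (fracs A) C'" unfolding D_def C'_def
      by (rule spn_trans[OF div_subring_imp_subring[OF F] A(5)])
    have "C' \<subseteq> D" unfolding C'_def
      using CL LD BD is_subringD(4)[OF D] by (auto simp: subset_iff)
    moreover have "div_subring D"
    proof (rule div_subring_algebraic[OF F FD D])
      fix x assume "x \<in> D"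
      then have "x ^ i \<in> spn (fracs A) C'" for i using DC is_subringD(7)[OF D, of x i] by blast
      then show "algebraic_over (fracs A) x" by (rule algebraic_in_span[OF F fin])
    qed
    moreover have "A \<subseteq> ctr D"
    proof
      fix a assume "a \<in> A"
      then have "a \<in> ctr K" "a \<in> D" using A(2) LS LD by auto
      then show "a \<in> ctr D" using DK central unfolding ctr_def by blast
    qed
    ultimately show ?thesis using A(1,3) ED fin DC by blast
  qed
qed

section \<open>Orders and rational functions with bounded denominators\<close>

text \<open>\<open>D\<close> is finite-dimensional over its central subfield \<open>fracs A\<close>.
  The order itself, which depends on the matrix entries, is constructed in
  \<open>bounded_order_exists\<close>.\<close>

locale arithmetic_order =
  fixes D A C :: "'a::division_ring set"
  assumes D: "div_subring D" and A: "is_subring A" and nv: "nonunit_values A"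
    and AD: "A \<subseteq> ctr D" and C: "finite C" "C \<subseteq> D" and DC: "D \<subseteq> spn (fracs A) C"
begin

sublocale comm_div_subring "ctr D"
  by (rule comm_div_subring_ctr[OF D])

lemmas DR = div_subring_imp_subring[OF D]
lemmas Dc = div_subringD[OF D]
lemmas F = div_subring_frac[OF A AD]
lemmas FR = div_subring_imp_subring[OF F]
lemmas F_ctr = frac_subset[OF AD]
lemmas A_F = subset_frac[OF A]

lemma ctr_D: "ctr D \<subseteq> D"
  unfolding ctr_def by blast

lemma F_D: "fracs A \<subseteq> D"
  using F_ctr ctr_D by blast

lemma A_D: "A \<subseteq> D"
  using AD ctr_D by blast

lemma central: "z \<in> ctr D \<Longrightarrow> x \<in> D \<Longrightarrow> z * x = x * z"
  unfolding ctr_def by blast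

lemma infinite_A: "infinite A"
proof
  assume fin: "finite A"
  define \<psi> :: "nat \<Rightarrow> 'a" where "\<psi> i = (if i = 0 then 0 else 1)" for i
  have "\<psi> i \<in> A" for i unfolding \<psi>_def using is_subringD(1,2)[OF A] by simp
  then obtain z where z: "z \<in> A" "inverse (\<Sum>i\<le>1. \<psi> i * z ^ i) \<notin> A"
    using nonunit_valuesD[OF nv, of \<psi> 1] unfolding \<psi>_def by fastforce
  then have "inverse z \<notin> A" by (simp add: \<psi>_def)
  then show False using div_subringD(6)[OF div_subring_finite[OF A fin] z(1)] by blast
qed

lemma algebraic: assumes "x \<in> D" shows "algebraic_over (fracs A) x"
proof (rule algebraic_in_span[OF F C(1)])
  show "x ^ i \<in> spn (fracs A) C" for i using DC Dc(8)[OF assms, of i] by blast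
qed

lemma polys_D: "P \<in> polys (fracs A) \<Longrightarrow> P \<in> polys D"
  by (rule polys_mono[OF F_D])

lemma polys_value_F: "P \<in> polys (fracs A) \<Longrightarrow> t \<in> A \<Longrightarrow> P 1 t \<in> fracs A"
  using polys_closed[OF FR _ is_subringD(2)[OF FR], of P t] A_F by blast

text \<open>A polynomial has finitely many coefficients, so one denominator serves for all its
  values on \<open>A\<close>.\<close>

lemma polys_localiz:
  assumes "P \<in> polys (fracs A)"
  shows "\<exists>w\<in>A. w \<noteq> 0 \<and> (\<forall>t\<in>A. P 1 t \<in> localiz A w)"
  using assms
proof induction
  case (const c)
  then obtain y where y: "y \<in> A" "y \<noteq> 0" "c * y \<in> A" unfolding fracs_def by blast
  then have "c * y ^ 1 \<in> A" by simp
  then have "c \<in> localiz A y" unfolding localiz_def by blast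
  then show ?case using y by (intro bexI[of _ y]) auto
next
  case var
  then show ?case using subset_loc[of A 1] is_subringD(2)[OF A] by (intro bexI[of _ 1]) auto
next
  case (add P Q)
  then obtain w w' where w: "w \<in> A" "w \<noteq> 0" "\<And>t. t \<in> A \<Longrightarrow> P 1 t \<in> localiz A w"
    and w': "w' \<in> A" "w' \<noteq> 0" "\<And>t. t \<in> A \<Longrightarrow> Q 1 t \<in> localiz A w'" by blast
  have c: "w * w' = w' * w" using comm AD w w' by blast
  have ww: "w * w' \<in> A" "w * w' \<noteq> 0" using w w' is_subringD(4)[OF A] by auto
  have "P 1 t + Q 1 t \<in> localiz A (w * w')" if "t \<in> A" for t
    using is_subringD(3)[OF is_subring_loc[OF A AD ww]] loc_mono[OF A AD w(1) w'(1)]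
      loc_mono[OF A AD w'(1) w(1)] w(3)[OF that] w'(3)[OF that] c by (metis subsetD)
  then show ?case using ww by blast
next
  case (mult P Q)
  then obtain w w' where w: "w \<in> A" "w \<noteq> 0" "\<And>t. t \<in> A \<Longrightarrow> P 1 t \<in> localiz A w"
    and w': "w' \<in> A" "w' \<noteq> 0" "\<And>t. t \<in> A \<Longrightarrow> Q 1 t \<in> localiz A w'" by blast
  have c: "w * w' = w' * w" using comm AD w w' by blast
  have ww: "w * w' \<in> A" "w * w' \<noteq> 0" using w w' is_subringD(4)[OF A] by auto
  have "P (Q 1 t) t \<in> localiz A (w * w')" if "t \<in> A" for t
  proof -
    have "P (Q 1 t) t = P 1 t * Q 1 t"
      by (rule polys_mult_central[OF DR]) (use mult.hyps polys_D that AD in auto)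
    then show ?thesis
      using is_subringD(4)[OF is_subring_loc[OF A AD ww]] loc_mono[OF A AD w(1) w'(1)]
      loc_mono[OF A AD w'(1) w(1)] w(3)[OF that] w'(3)[OF that] c by (metis subsetD)
  qed
  then show ?case using ww by blast
qed

text \<open>One factor \<open>G\<close> is cancelled at a time while \<open>P\<close> vanishes at
  \<open>a\<close>. If at some stage it does not, \<open>P\<close> and \<open>G\<close> are coprime,
  and the bounded denominators would make every nonzero \<open>G 1 t\<close> a unit of one ring
  \<open>A[1/V]\<close>, which \<open>nonunit_values_monic\<close> forbids.\<close>

lemma polynomial_of_localized_scalar:
  assumes a: "a \<in> D" and m: "minpoly (fracs A) a N f" and v: "v \<in> A" "v \<noteq> 0"
    and P: "P \<in> polys (fracs A)"
    and loc: "\<And>t. t \<in> A \<Longrightarrow> monic N f 1 t \<noteq> 0 \<Longrightarrow> \<exists>x\<in>localiz A v. monic N f 1 t ^ k * x = P 1 t"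
  shows "\<exists>E\<in>polys (fracs A). \<forall>t\<in>A. monic N f 1 t \<noteq> 0 \<longrightarrow> P 1 t = monic N f 1 t ^ k * E 1 t"
  using P loc
proof (induction k arbitrary: P)
  case 0
  then show ?case by (intro bexI[of _ P]) auto
next
  case (Suc k)
  have f: "\<And>i. f i \<in> fracs A" "N \<ge> 1" using m unfolding minpoly_def by auto
  define G where "G = monic N f"
  have G: "G \<in> polys (fracs A)" unfolding G_def by (rule monic_polys[OF FR f(1)])
  have GF: "G 1 t \<in> fracs A" if "t \<in> A" for t by (rule polys_value_F[OF G that])
  have commF: "x * y = y * x" if "x \<in> fracs A" "y \<in> fracs A" for x y
    using comm F_ctr that by blast
  have mc: "Q (R 1 t) t = Q 1 t * R 1 t" if "Q \<in> polys (fracs A)" "R \<in> polys (fracs A)" "t \<in> A" for Q R t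
    by (rule polys_mult_central[OF DR]) (use that polys_D AD in auto)
  show ?case
  proof (cases "P 1 a = 0")
    case True
    obtain Q where Q: "Q \<in> polys (fracs A)" "\<And>m \<tau>. P m \<tau> = Q (G m \<tau>) \<tau>"
      using polys_root_division[OF FR m Suc.prems(1) True] unfolding G_def by blast
    have PQ: "P 1 t = G 1 t * Q 1 t" if "t \<in> A" for t
      using mc[OF Q(1) G that] Q(2)[of 1 t] commF[OF GF polys_value_F[OF Q(1)]] that by simp
    have "\<exists>x\<in>localiz A v. G 1 t ^ k * x = Q 1 t" if t: "t \<in> A" "G 1 t \<noteq> 0" for t
    proof -
      obtain x where x: "x \<in> localiz A v" "G 1 t ^ Suc k * x = P 1 t"
        using Suc.prems(2)[of t] t unfolding G_def by blast
      then have "G 1 t * (G 1 t ^ k * x) = G 1 t * Q 1 t" using PQ[OF t(1)] by (simp add: mult.assoc)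
      then show ?thesis using t(2) x(1) by auto
    qed
    from Suc.IH[OF Q(1) this[unfolded G_def]] obtain E where E: "E \<in> polys (fracs A)"
      "\<And>t. t \<in> A \<Longrightarrow> G 1 t \<noteq> 0 \<Longrightarrow> Q 1 t = G 1 t ^ k * E 1 t" unfolding G_def by blast
    then have "P 1 t = G 1 t ^ Suc k * E 1 t" if "t \<in> A" "G 1 t \<noteq> 0" for t
      using PQ[OF that(1)] E(2)[OF that] by (simp add: mult.assoc)
    then show ?thesis using E(1) unfolding G_def by blast
  next
    case False
    \<comment> \<open>Bezout: \<open>\<alpha> P - 1 = \<beta> G\<close>, so \<open>G\<close> would be invertible on \<open>A\<close> after inverting one element.\<close>
    define \<pi> where "\<pi> = P 1 a"
    have \<pi>: "\<pi> \<in> D" unfolding \<pi>_def by (rule polys_closed[OF DR polys_D[OF Suc.prems(1)] Dc(2) a])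
    obtain n s where s: "\<forall>i. s i \<in> fracs A" "inverse \<pi> = (\<Sum>i<n. s i * \<pi> ^ i)"
      using inverse_polynomial[OF F algebraic[OF \<pi>]] False unfolding \<pi>_def by blast
    \<comment> \<open>\<open>inverse \<pi>\<close> is a polynomial in \<open>\<pi>\<close>. Applying
      the same polynomial to \<open>P\<close> in place of \<open>\<pi> = P 1 a\<close> produces an
      \<open>\<alpha>\<close> with \<open>\<alpha> P = 1\<close> at \<open>a\<close>.\<close>
    define \<alpha> where "\<alpha> = (\<lambda>m \<tau>. \<Sum>i<n. s i * ((\<lambda>m. P m \<tau>) ^^ i) m)"
    have \<alpha>: "\<alpha> \<in> polys (fracs A)" unfolding \<alpha>_def
      by (rule polys_sum[OF FR], rule polys.mult[OF polys.const polys_power[OF FR Suc.prems(1)]])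
        (use s in blast)
    have Pa: "Q m' a = m' * Q 1 a" if "Q \<in> polys (fracs A)" "m' \<in> D" for Q m'
      using polys_ctr_left_linear[OF DR F_ctr that Dc(2) a] by simp
    have "((\<lambda>m. P m a) ^^ i) 1 = \<pi> ^ i" for i
    proof (induction i)
      case (Suc i)
      then show ?case using Pa[OF \<open>P \<in> polys (fracs A)\<close> Dc(8)[OF \<pi>, of i]]
        unfolding \<pi>_def by (simp add: power_commutes)
    qed simp
    then have \<alpha>a: "\<alpha> 1 a = inverse \<pi>" unfolding \<alpha>_def s(2) by simp
    define R where "R = (\<lambda>m \<tau>. \<alpha> (P m \<tau>) \<tau> + (- 1) * m)"
    have R: "R \<in> polys (fracs A)" unfolding R_def
      by (rule polys.add[OF polys.mult[OF \<alpha> Suc.prems(1)] polys.const])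
        (auto intro: is_subringD[OF FR])
    have "R 1 a = 0"
      unfolding R_def using Pa[OF \<alpha> \<pi>] \<alpha>a False unfolding \<pi>_def by simp
    then obtain \<beta> where \<beta>: "\<beta> \<in> polys (fracs A)" "\<And>m \<tau>. R m \<tau> = \<beta> (G m \<tau>) \<tau>"
      using polys_root_division[OF FR m R] unfolding G_def by blast
    obtain w1 where w1: "w1 \<in> A" "w1 \<noteq> 0" "\<And>t. t \<in> A \<Longrightarrow> \<alpha> 1 t \<in> localiz A w1"
      using polys_localiz[OF \<alpha>] by blast
    obtain w2 where w2: "w2 \<in> A" "w2 \<noteq> 0" "\<And>t. t \<in> A \<Longrightarrow> \<beta> 1 t \<in> localiz A w2"
      using polys_localiz[OF \<beta>(1)] by blast
    obtain w3 where w3: "w3 \<in> A" "w3 \<noteq> 0" "\<And>t. t \<in> A \<Longrightarrow> G 1 t \<in> localiz A w3"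
      using polys_localiz[OF G] by blast
    \<comment> \<open>A single localization that contains the given bounded values and all values of
      \<open>\<alpha>\<close>, \<open>\<beta>\<close> and \<open>G\<close> on
      \<open>A\<close>.\<close>
    define V where "V = v * (w1 * (w2 * w3))"
    have V: "V \<in> A" "V \<noteq> 0" unfolding V_def using v w1 w2 w3 is_subringD(4)[OF A] by auto
    have lV: "localiz A u \<subseteq> localiz A V" if "u \<in> {v, w1, w2, w3}" for u
    proof -
      have mem: "v \<in> ctr D" "w1 \<in> ctr D" "w2 \<in> ctr D" "w3 \<in> ctr D" using v w1 w2 w3 AD by auto
      have V': "V = w1 * (v * (w2 * w3))" "V = w2 * (v * (w1 * w3))" "V = w3 * (v * (w1 * w2))"
        unfolding V_def using comm[OF mem(3,4)]
        by (simp_all only: left_comm[OF mem(2,1)] left_comm[OF mem(3,1)] left_comm[OF mem(3,2)]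
            left_comm[OF mem(4,1)] left_comm[OF mem(4,2)])
      show ?thesis
        using that V_def V' loc_mono[OF A AD] v w1 w2 w3 is_subringD(4)[OF A]
        by (metis insertE singletonD)
    qed
    note LR = is_subring_loc[OF A AD V]
    obtain t where t: "t \<in> A" "G 1 t \<noteq> 0" "inverse (G 1 t) \<notin> localiz A V"
      using nonunit_values_monic[where f = f, OF A AD nv f V] unfolding G_def by blast
    obtain x where x: "x \<in> localiz A v" "G 1 t ^ Suc k * x = P 1 t"
      using Suc.prems(2)[of t] t unfolding G_def by blast
    have "\<alpha> 1 t * P 1 t - 1 = \<beta> 1 t * G 1 t"
      using \<beta>(2)[of 1 t] mc[OF \<alpha> Suc.prems(1) t(1)] mc[OF \<beta>(1) G t(1)] unfolding R_def by simp
    then have "\<alpha> 1 t * (G 1 t * (G 1 t ^ k * x)) - \<beta> 1 t * G 1 t = 1"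
      unfolding x(2)[symmetric] by (simp add: mult.assoc algebra_simps)
    moreover have "\<alpha> 1 t * (G 1 t * (G 1 t ^ k * x)) = G 1 t * (\<alpha> 1 t * (G 1 t ^ k * x))"
      by (rule left_comm) (use polys_value_F[OF \<alpha> t(1)] GF[OF t(1)] F_ctr in auto)
    moreover have "\<beta> 1 t * G 1 t = G 1 t * \<beta> 1 t"
      by (rule commF[OF polys_value_F[OF \<beta>(1) t(1)] GF[OF t(1)]])
    ultimately have "G 1 t * (\<alpha> 1 t * (G 1 t ^ k * x) - \<beta> 1 t) = 1"
      by (simp add: right_diff_distrib)
    then have "inverse (G 1 t) = \<alpha> 1 t * (G 1 t ^ k * x) - \<beta> 1 t" by (rule inverse_unique)
    also have "\<dots> \<in> localiz A V"
      using lV w1(3)[OF t(1)] w2(3)[OF t(1)] w3(3)[OF t(1)] x(1)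
      by (intro is_subringD(6)[OF LR] is_subringD(4)[OF LR] is_subringD(7)[OF LR]) auto
    finally show ?thesis using t(3) by blast
  qed
qed

text \<open>What the pole argument has to know about \<open>\<Lambda>\<close>. It is quantified over
  all \<open>a\<close> because the place is chosen after \<open>\<Lambda>\<close>; \<open>P\<close>
  has coefficients in \<open>D\<close>, while the place belongs to the minimal polynomial over
  \<open>fracs A\<close>.\<close>

definition no_poles :: "'a set \<Rightarrow> bool" where
  "no_poles \<Lambda> \<longleftrightarrow> (\<forall>a\<in>D. \<forall>N f P k. minpoly (fracs A) a N f \<longrightarrow> P \<in> polys D \<longrightarrow>
      (\<forall>t\<in>A. monic N f 1 t \<noteq> 0 \<longrightarrow> (\<exists>x\<in>\<Lambda>. monic N f 1 t ^ k * x = P 1 t)) \<longrightarrow>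
      (\<exists>E\<in>polys D. \<forall>t\<in>A. monic N f 1 t \<noteq> 0 \<longrightarrow> P 1 t = monic N f 1 t ^ k * E 1 t))"

text \<open>Fix a basis of \<open>D\<close> over \<open>fracs A\<close> and a common denominator
  \<open>v\<close> of the coordinates of \<open>X\<close> and of the products of basis elements. The
  elements with coordinates in \<open>A[1/v]\<close> are closed under sums and products. The
  coordinates of a polynomial over \<open>D\<close> are polynomials over \<open>fracs A\<close>, so
  poles are removed coordinate by coordinate.\<close>

lemma bounded_order_exists:
  assumes X: "finite X" "X \<subseteq> D"
  shows "\<exists>\<Lambda>. X \<subseteq> \<Lambda> \<and> 0 \<in> \<Lambda> \<and> (\<forall>x\<in>\<Lambda>. \<forall>y\<in>\<Lambda>. x + y \<in> \<Lambda> \<and> x * y \<in> \<Lambda>) \<and> no_poles \<Lambda>"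
proof -
  obtain B co where B: "finite B" "B \<subseteq> C" and co_F: "\<And>x b. co x b \<in> fracs A"
    and co_sum: "\<forall>x\<in>spn (fracs A) C. x = (\<Sum>b\<in>B. co x b * b)"
    and co_add': "\<forall>x\<in>spn (fracs A) C. \<forall>y\<in>spn (fracs A) C. \<forall>b\<in>B. co (x + y) b = co x b + co y b"
    and co_scale': "\<forall>x\<in>spn (fracs A) C. \<forall>k\<in>fracs A. \<forall>b\<in>B. co (k * x) b = k * co x b"
    using coordinates_exist[OF F C(1)] by auto
  have BD: "B \<subseteq> D" using B C by auto
  have co_repr: "x = (\<Sum>b\<in>B. co x b * b)" if "x \<in> D" for x using co_sum DC that by blast
  have co_add: "co (x + y) b = co x b + co y b" if "x \<in> D" "y \<in> D" "b \<in> B" for x y b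
    using co_add' DC that by blast
  have co_scale: "co (k * x) b = k * co x b" if "x \<in> D" "k \<in> fracs A" "b \<in> B" for x k b
    using co_scale' DC that by blast
  have co_zero: "co 0 b = 0" if "b \<in> B" for b using co_add[OF Dc(1) Dc(1) that] by simp
  have co_sums: "co (sum g I) b = (\<Sum>i\<in>I. co (g i) b)" if "\<And>i. i \<in> I \<Longrightarrow> g i \<in> D" "b \<in> B"
    for g :: "'c \<Rightarrow> 'a" and I b
    using that(1)
  proof (induction I rule: infinite_finite_induct)
    case (insert i I)
    then have "sum g I \<in> D" by (auto intro: div_subring_sum[OF D])
    then show ?case using insert co_add[OF _ _ that(2), of "g i" "sum g I"] by simp
  qed (use co_zero[OF that(2)] in auto)
  define Y where "Y = (\<lambda>(x, b). co x b) ` ((X \<union> (\<lambda>(b, b'). b * b') ` (B \<times> B)) \<times> B)"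
  have "finite Y" "Y \<subseteq> fracs A" unfolding Y_def using X(1) B(1) co_F by auto
  then obtain v where v: "v \<in> A" "v \<noteq> 0" "\<forall>y\<in>Y. y * v \<in> A"
    using common_denominator[OF A AD] by blast
  have Yv: "Y \<subseteq> localiz A v"
  proof
    fix y assume "y \<in> Y"
    then have "y * v ^ 1 \<in> A" using v by simp
    then show "y \<in> localiz A v" unfolding localiz_def by blast
  qed
  note LR = is_subring_loc[OF A AD v(1,2)]
  define \<Lambda> where "\<Lambda> = {x \<in> D. \<forall>b\<in>B. co x b \<in> localiz A v}"
  have XL: "X \<subseteq> \<Lambda>"
  proof
    fix x assume x: "x \<in> X"
    have "co x b \<in> Y" if "b \<in> B" for b unfolding Y_def using x that by force
    then show "x \<in> \<Lambda>" unfolding \<Lambda>_def using x X(2) Yv by blast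
  qed
  have add_mult: "x + y \<in> \<Lambda> \<and> x * y \<in> \<Lambda>" if xy: "x \<in> \<Lambda>" "y \<in> \<Lambda>" for x y
  proof
    have D2: "x \<in> D" "y \<in> D" using xy unfolding \<Lambda>_def by auto
    show "x + y \<in> \<Lambda>" using xy co_add[OF D2] is_subringD(3)[OF LR] Dc(3)[OF D2] unfolding \<Lambda>_def by auto
    have "co (x * y) d \<in> localiz A v" if d: "d \<in> B" for d
    proof -
      have Fc: "k * z = z * k" if "k \<in> fracs A" "z \<in> D" for k z using central F_ctr that by blast
      have "x * y = (\<Sum>b\<in>B. co x b * b) * (\<Sum>b'\<in>B. co y b' * b')"
        using co_repr[OF D2(1)] co_repr[OF D2(2)] by simp
      also have "\<dots> = (\<Sum>b\<in>B. \<Sum>b'\<in>B. (co x b * b) * (co y b' * b'))"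
        by (simp only: sum_product)
      also have "\<dots> = (\<Sum>b\<in>B. \<Sum>b'\<in>B. (co x b * co y b') * (b * b'))"
      proof (intro sum.cong refl)
        fix b b' assume b: "b \<in> B" "b' \<in> B"
        have "b * co y b' = co y b' * b" using Fc[OF co_F, of b] b BD by (simp add: subset_iff)
        then show "(co x b * b) * (co y b' * b') = (co x b * co y b') * (b * b')"
          by (metis mult.assoc)
      qed
      finally have eq: "x * y = (\<Sum>b\<in>B. \<Sum>b'\<in>B. (co x b * co y b') * (b * b'))" .
      have mem: "(co x b * co y b') * (b * b') \<in> D" "b * b' \<in> D" if "b \<in> B" "b' \<in> B" for b b'
        using that BD co_F F_D by (auto intro!: Dc)
      have "co (x * y) d = (\<Sum>b\<in>B. \<Sum>b'\<in>B. co ((co x b * co y b') * (b * b')) d)"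
        unfolding eq by (subst co_sums, use mem d in \<open>auto intro!: div_subring_sum[OF D]\<close>,
          rule sum.cong, use mem d in \<open>auto intro!: co_sums\<close>)
      also have "\<dots> = (\<Sum>b\<in>B. \<Sum>b'\<in>B. co x b * co y b' * co (b * b') d)"
        by (intro sum.cong refl co_scale) (use mem d co_F is_subringD(4)[OF FR] in auto)
      also have "\<dots> \<in> localiz A v"
      proof (intro is_subring_sum[OF LR] is_subringD(4)[OF LR])
        fix b b' assume b: "b \<in> B" "b' \<in> B"
        show "co x b \<in> localiz A v" "co y b' \<in> localiz A v" using xy b unfolding \<Lambda>_def by auto
        have "co (b * b') d \<in> Y" unfolding Y_def using b d by force
        then show "co (b * b') d \<in> localiz A v" using Yv by blast
      qed
      finally show ?thesis .
    qed
    then show "x * y \<in> \<Lambda>" unfolding \<Lambda>_def using Dc(4)[OF D2] by blast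
  qed
  have zero: "0 \<in> \<Lambda>" unfolding \<Lambda>_def using co_zero Dc(1) is_subringD(1)[OF LR] by simp
  have main: "\<exists>E\<in>polys D. \<forall>t\<in>A. monic N f 1 t \<noteq> 0 \<longrightarrow> P 1 t = monic N f 1 t ^ k * E 1 t"
    if a: "a \<in> D" and m: "minpoly (fracs A) a N f" and P: "P \<in> polys D"
      and loc: "\<forall>t\<in>A. monic N f 1 t \<noteq> 0 \<longrightarrow> (\<exists>x\<in>\<Lambda>. monic N f 1 t ^ k * x = P 1 t)" for a N f P k
  proof -
    define G where "G = monic N f 1"
    have f: "\<And>i. f i \<in> fracs A" using m unfolding minpoly_def by auto
    have GF: "G t ^ k \<in> fracs A" if "t \<in> A" for t
      unfolding G_def by (rule is_subringD(7)[OF FR polys_value_F[OF monic_polys[OF FR f] that]])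
    obtain n c where c: "\<And>i. c i \<in> D" "P = (\<lambda>m \<tau>. \<Sum>i<n. c i * m * \<tau> ^ i)"
      using polys_has_coeffs[OF DR P] unfolding has_coeffs_def by blast
    define PB where "PB b = (\<lambda>m \<tau>. \<Sum>i<n. co (c i) b * m * \<tau> ^ i)" for b
    have PB: "PB b \<in> polys (fracs A)" for b unfolding PB_def by (rule polys_explicit[OF FR co_F])
    have coP: "co (P 1 t) b = PB b 1 t" if t: "t \<in> A" and b: "b \<in> B" for t b
    proof -
      have ti: "t ^ i \<in> fracs A" "t ^ i \<in> ctr D" for i
        using is_subringD(7)[OF FR, of t i] t A_F F_ctr by auto
      have "P 1 t = (\<Sum>i<n. t ^ i * c i)"
        unfolding c(2) using central[OF ti(2) c(1)] by simp
      also have "co \<dots> b = (\<Sum>i<n. co (t ^ i * c i) b)"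
        by (rule co_sums[OF _ b], rule Dc(4)) (use ti c F_D in auto)
      also have "\<dots> = (\<Sum>i<n. t ^ i * co (c i) b)"
        by (intro sum.cong refl co_scale c ti b)
      also have "\<dots> = PB b 1 t"
        unfolding PB_def using central[OF ti(2) subsetD[OF F_D co_F]] by simp
      finally show ?thesis .
    qed
    have "\<exists>E\<in>polys (fracs A). \<forall>t\<in>A. G t \<noteq> 0 \<longrightarrow> PB b 1 t = G t ^ k * E 1 t" if b: "b \<in> B" for b
      unfolding G_def
    proof (rule polynomial_of_localized_scalar[OF a m v(1,2) PB])
      fix t assume t: "t \<in> A" "monic N f 1 t \<noteq> 0"
      then obtain x where x: "x \<in> \<Lambda>" "G t ^ k * x = P 1 t" using loc unfolding G_def by blast
      then have "co (P 1 t) b = G t ^ k * co x b"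
        using co_scale[OF _ GF[OF t(1)] b, of x] unfolding \<Lambda>_def by auto
      then show "\<exists>x\<in>localiz A v. monic N f 1 t ^ k * x = PB b 1 t"
        using x(1) b coP[OF t(1) b] unfolding \<Lambda>_def G_def by auto
    qed
    then obtain EB where EB: "\<And>b. b \<in> B \<Longrightarrow> EB b \<in> polys (fracs A)"
      "\<And>b t. b \<in> B \<Longrightarrow> t \<in> A \<Longrightarrow> G t \<noteq> 0 \<Longrightarrow> PB b 1 t = G t ^ k * EB b 1 t" by metis
    \<comment> \<open>The coordinates reassembled: feeding \<open>b\<close> into the operator
      multiplies the value by \<open>b\<close> on the right at a central point.\<close>
    define E where "E = (\<lambda>m \<tau>. \<Sum>b\<in>B. EB b (b * m) \<tau>)"
    have E: "E \<in> polys D" unfolding E_def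
      by (rule polys_sum[OF DR], rule polys.mult[OF polys_D[OF EB(1)] polys.const]) (use BD in auto)
    have "P 1 t = G t ^ k * E 1 t" if t: "t \<in> A" "G t \<noteq> 0" for t
    proof -
      have "P 1 t \<in> D" using polys_closed[OF DR P Dc(2)] t A_D by blast
      then have "P 1 t = (\<Sum>b\<in>B. co (P 1 t) b * b)" by (rule co_repr)
      also have "\<dots> = (\<Sum>b\<in>B. PB b 1 t * b)" using coP[OF t(1)] by simp
      also have "\<dots> = (\<Sum>b\<in>B. G t ^ k * EB b 1 t * b)" using EB(2) t by simp
      also have "\<dots> = (\<Sum>b\<in>B. G t ^ k * EB b b t)"
      proof (intro sum.cong refl)
        fix b assume b: "b \<in> B"
        have "EB b b t = EB b 1 t * b"
          by (rule polys_central_arg[OF DR polys_D[OF EB(1)[OF b]]]) (use t AD b BD in auto)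
        then show "G t ^ k * EB b 1 t * b = G t ^ k * EB b b t" by (simp add: mult.assoc)
      qed
      finally show ?thesis unfolding E_def by (simp add: sum_distrib_left)
    qed
    then show ?thesis using E unfolding G_def by blast
  qed
  have "no_poles \<Lambda>" unfolding no_poles_def using main by blast
  then show ?thesis using XL zero add_mult by blast
qed

end

section \<open>Commutator words and their poles\<close>

text \<open>With \<open>N\<close> cosets, two of the powers from \<open>x ^ 0\<close> to
  \<open>x ^ N\<close> share one, so \<open>x ^ d\<close> lies in \<open>H\<close> for some
  \<open>1 \<le> d \<le> N\<close>. The exponent \<open>N!\<close> is a multiple of every such
  \<open>d\<close>, hence uniform in \<open>x\<close>, also when \<open>H\<close> is not
  normal.\<close>

lemma (in group) uniform_power_in_subgroup:
  assumes H: "subgroup H G" and fin: "finite (rcosets H)"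
  shows "\<exists>m\<ge>1. \<forall>x\<in>carrier G. x [^] (m::nat) \<in> H"
proof (intro exI conjI ballI)
  let ?N = "card (rcosets H)"
  show "(1::nat) \<le> fact ?N" by (rule fact_ge_1)
  fix x assume x: "x \<in> carrier G"
  define c where "c j = H #> x [^] j" for j :: nat
  have "c ` {..?N} \<subseteq> rcosets H" unfolding c_def
    using rcosetsI[OF subgroup.subset[OF H]] x by auto
  then have "card (c ` {..?N}) < card {..?N}" using card_mono[OF fin] by (simp add: le_imp_less_Suc)
  then obtain i j where ij: "i \<le> ?N" "j \<le> ?N" "c i = c j" "i < j"
    using pigeonhole[of c "{..?N}"] unfolding inj_on_def by (metis atMost_iff linorder_neqE_nat)
  have "x [^] j \<in> c j" unfolding c_def using rcos_self[OF _ H] x by simp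
  then obtain h where h: "h \<in> H" "x [^] j = h \<otimes> x [^] i"
    unfolding ij(3)[symmetric] by (auto simp: c_def r_coset_def)
  have "x [^] j = x [^] (j - i) \<otimes> x [^] i" using x ij(4) by (simp add: nat_pow_mult)
  then have "h = x [^] (j - i)"
    using h subgroup.mem_carrier[OF H h(1)] x by (metis nat_pow_closed right_cancel)
  then have d: "x [^] (j - i) \<in> H" using h by simp
  have "j - i dvd fact ?N" by (rule dvd_fact) (use ij in auto)
  then obtain e where e: "fact ?N = (j - i) * e" by (rule dvdE)
  have "x [^] (fact ?N :: nat) = (x [^] (j - i)) [^] e"
    unfolding e using x by (simp add: nat_pow_pow)
  also have "\<dots> \<in> H"
    using d by (induction e) (auto intro: subgroup.m_closed[OF H] subgroup.one_closed[OF H])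
  finally show "x [^] (fact ?N :: nat) \<in> H" .
qed

definition commutator :: "('a, 'b) monoid_scheme \<Rightarrow> 'a \<Rightarrow> 'a \<Rightarrow> 'a" where
  "commutator K x g = x \<otimes>\<^bsub>K\<^esub> g \<otimes>\<^bsub>K\<^esub> inv\<^bsub>K\<^esub> x \<otimes>\<^bsub>K\<^esub> inv\<^bsub>K\<^esub> g"

text \<open>\<open>P\<close> abstracts the property of families to be preserved. As \<open>g\<close>
  lies in every term of the chain, the commutator falls into a normal next term, and a uniform power
  falls into a next term of finite index. The induction starts at the first commutator rather than
  at \<open>x\<close>, because the shape of leading coefficients that reproduces itself appears only
  there.\<close>

lemma almost_subnormal_commutator_word:
  assumes K: "group K" and as: "almost_subnormal H K" and g: "g \<in> H"
    and start: "P (\<lambda>t. commutator K (x t) g)" and x: "\<And>t. t \<in> T \<Longrightarrow> x t \<in> carrier K"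
    and comm: "\<And>\<Phi>. P \<Phi> \<Longrightarrow> (\<And>t. t \<in> T \<Longrightarrow> \<Phi> t \<in> carrier K) \<Longrightarrow> P (\<lambda>t. commutator K (\<Phi> t) g)"
    and pow: "\<And>\<Phi> m. P \<Phi> \<Longrightarrow> (\<And>t. t \<in> T \<Longrightarrow> \<Phi> t \<in> carrier K) \<Longrightarrow> m \<ge> 1 \<Longrightarrow> P (\<lambda>t. \<Phi> t [^]\<^bsub>K\<^esub> (m::nat))"
  shows "\<exists>\<Phi>. P \<Phi> \<and> (\<forall>t\<in>T. \<Phi> t \<in> H)"
proof -
  interpret K: group K by (rule K)
  obtain r :: nat and Hs where "r \<ge> 1 \<and> Hs 1 = carrier K \<and> Hs r = H \<and> (\<forall>i\<in>{1..r}. subgroup (Hs i) K) \<and>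
     (\<forall>i. 1 < i \<and> i \<le> r \<longrightarrow> Hs i \<subseteq> Hs (i - 1) \<and> (Hs i \<lhd> K\<lparr>carrier := Hs (i - 1)\<rparr> \<or>
             finite (rcosets\<^bsub>K\<lparr>carrier := Hs (i - 1)\<rparr>\<^esub> (Hs i))))"
    using as unfolding almost_subnormal_def by (elim exE) (rule that)
  then have r: "r \<ge> 1" "Hs 1 = carrier K" "Hs r = H" "\<And>i. i \<in> {1..r} \<Longrightarrow> subgroup (Hs i) K"
    and chain: "\<And>i. 1 < i \<Longrightarrow> i \<le> r \<Longrightarrow> Hs i \<subseteq> Hs (i - 1) \<and> (Hs i \<lhd> K\<lparr>carrier := Hs (i - 1)\<rparr> \<or>
             finite (rcosets\<^bsub>K\<lparr>carrier := Hs (i - 1)\<rparr>\<^esub> (Hs i)))"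
    by simp_all
  have dec: "Hs r \<subseteq> Hs i" if "1 \<le> i" "i \<le> r" for i
    using that(2,1)
  proof (induction rule: inc_induct)
    case (step j)
    then show ?case using chain[of "Suc j"] by auto
  qed simp
  have "1 \<le> i \<Longrightarrow> i \<le> r \<Longrightarrow> \<exists>\<Phi>. P \<Phi> \<and> (\<forall>t\<in>T. \<Phi> t \<in> Hs i)" for i
  proof (induction i rule: nat_induct_at_least)
    case base
    have "g \<in> carrier K" using g subgroup.subset[OF r(4)[of r]] r by auto
    then show ?case using start x r(2) by (intro exI[of _ "\<lambda>t. commutator K (x t) g"]) (auto simp: commutator_def)
  next
    case (Suc i)
    then obtain \<Phi> where \<Phi>: "P \<Phi>" "\<And>t. t \<in> T \<Longrightarrow> \<Phi> t \<in> Hs i" by auto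
    have sub: "subgroup (Hs i) K" "subgroup (Hs (Suc i)) K" using r(4) Suc by auto
    let ?K = "K\<lparr>carrier := Hs i\<rparr>"
    interpret L: group ?K by (rule K.subgroup_imp_group[OF sub(1)])
    have incl: "Hs (Suc i) \<subseteq> Hs i" and alt: "Hs (Suc i) \<lhd> ?K \<or> finite (rcosets\<^bsub>?K\<^esub> (Hs (Suc i)))"
      using chain[of "Suc i"] Suc by auto
    have subL: "subgroup (Hs (Suc i)) ?K" by (rule K.subgroup_incl[OF sub(2,1) incl])
    have gS: "g \<in> Hs (Suc i)" "g \<in> Hs i" using dec[of "Suc i"] g r(3) incl Suc by auto
    have \<Phi>K: "\<Phi> t \<in> carrier K" if "t \<in> T" for t using \<Phi>(2)[OF that] subgroup.subset[OF sub(1)] by blast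
    define \<Psi> where "\<Psi> t = commutator K (\<Phi> t) g" for t
    have P\<Psi>: "P \<Psi>" unfolding \<Psi>_def using comm[OF \<Phi>(1) \<Phi>K] .
    have \<Psi>i: "\<Psi> t \<in> Hs i" if "t \<in> T" for t unfolding \<Psi>_def commutator_def
      using \<Phi>(2)[OF that] gS by (auto intro!: subgroup.m_closed[OF sub(1)] subgroup.m_inv_closed[OF sub(1)])
    from alt show ?case
    proof
      assume "Hs (Suc i) \<lhd> ?K"
      then interpret N: normal "Hs (Suc i)" ?K .
      have "\<Psi> t \<in> Hs (Suc i)" if t: "t \<in> T" for t
      proof -
        have "\<Phi> t \<otimes>\<^bsub>K\<^esub> g \<otimes>\<^bsub>K\<^esub> inv\<^bsub>?K\<^esub> (\<Phi> t) \<in> Hs (Suc i)"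
          using N.inv_op_closed2[of "\<Phi> t" g] \<Phi>(2)[OF t] gS by simp
        then have "\<Phi> t \<otimes>\<^bsub>K\<^esub> g \<otimes>\<^bsub>K\<^esub> inv\<^bsub>K\<^esub> (\<Phi> t) \<in> Hs (Suc i)"
          using K.m_inv_consistent[OF sub(1) \<Phi>(2)[OF t]] by simp
        then show ?thesis unfolding \<Psi>_def commutator_def
          by (rule subgroup.m_closed[OF sub(2) _ subgroup.m_inv_closed[OF sub(2) gS(1)]])
      qed
      then show ?thesis using P\<Psi> by blast
    next
      assume "finite (rcosets\<^bsub>?K\<^esub> (Hs (Suc i)))"
      then obtain m where m: "m \<ge> 1" "\<And>y. y \<in> Hs i \<Longrightarrow> y [^]\<^bsub>?K\<^esub> (m::nat) \<in> Hs (Suc i)"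
        using L.uniform_power_in_subgroup[OF subL] by auto
      have "y [^]\<^bsub>?K\<^esub> m = y [^]\<^bsub>K\<^esub> m" for y by (simp add: nat_pow_def)
      then have "\<forall>t\<in>T. \<Psi> t [^]\<^bsub>K\<^esub> m \<in> Hs (Suc i)" using m(2)[OF \<Psi>i] by simp
      moreover have "P (\<lambda>t. \<Psi> t [^]\<^bsub>K\<^esub> m)"
        by (rule pow[OF P\<Psi> _ m(1)]) (use \<Psi>i subgroup.subset[OF sub(1)] in blast)
      ultimately show ?thesis by blast
    qed
  qed
  from this[OF r(1) order_refl] show ?thesis using r(3) by simp
qed

section \<open>The general linear group and leading coefficients at a pole\<close>

lemma GL_simps:
  "x \<otimes>\<^bsub>GL n\<^esub> y = x * y" "\<one>\<^bsub>GL n\<^esub> = 1\<^sub>m n"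
  by (simp_all add: GL_def units_of_mult units_of_one ring_mat_simps)

lemma GL_carrier:
  "x \<in> carrier (GL n) \<longleftrightarrow> x \<in> carrier_mat n n \<and> (\<exists>y\<in>carrier_mat n n. y * x = 1\<^sub>m n \<and> x * y = 1\<^sub>m n)"
  by (auto simp: GL_def units_of_carrier Units_def ring_mat_simps)

lemma GL_group: "group (GL n :: 'a::division_ring mat monoid)"
proof -
  interpret semiring "ring_mat TYPE('a) n ()" by (rule semiring_mat)
  show ?thesis unfolding GL_def by (rule units_group)
qed

lemma GL_inv:
  assumes "x \<in> carrier_mat n n" "y \<in> carrier_mat n n" "y * x = 1\<^sub>m n" "x * y = 1\<^sub>m n"
  shows "inv\<^bsub>GL n\<^esub> (x :: 'a::division_ring mat) = y"
proof -
  interpret group "GL n :: 'a mat monoid" by (rule GL_group)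
  show ?thesis by (rule inv_equality) (use assms in \<open>auto simp: GL_carrier GL_simps\<close>)
qed

context arithmetic_order
begin

text \<open>Columns are functions that vanish from \<open>n\<close> on, so that equal columns are
  equal functions.\<close>

definition nvecs :: "nat \<Rightarrow> (nat \<Rightarrow> 'a) set" where
  "nvecs n = {v. (\<forall>i. v i \<in> D) \<and> (\<forall>i\<ge>n. v i = 0)}"

definition mats :: "nat \<Rightarrow> 'a mat set" where
  "mats n = {M \<in> carrier_mat n n. \<forall>i<n. \<forall>j<n. M $$ (i, j) \<in> D}"

definition mulv :: "nat \<Rightarrow> 'a mat \<Rightarrow> (nat \<Rightarrow> 'a) \<Rightarrow> nat \<Rightarrow> 'a" where
  "mulv n M v = (\<lambda>p. if p < n then \<Sum>q<n. M $$ (p, q) * v q else 0)"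

lemma mulv_nvecs: "M \<in> mats n \<Longrightarrow> v \<in> nvecs n \<Longrightarrow> mulv n M v \<in> nvecs n"
  unfolding mulv_def nvecs_def mats_def
  by (auto intro!: div_subring_sum[OF D] Dc(4) Dc(1))

lemma mats_mult: "M \<in> mats n \<Longrightarrow> M' \<in> mats n \<Longrightarrow> M * M' \<in> mats n"
  unfolding mats_def
  by (auto simp: scalar_prod_def intro!: div_subring_sum[OF D] Dc(4))

lemma mat_mult_index:
  "M \<in> carrier_mat n n \<Longrightarrow> M' \<in> carrier_mat n n \<Longrightarrow> p < n \<Longrightarrow> q < n \<Longrightarrow>
    (M * M') $$ (p, q) = (\<Sum>r<n. M $$ (p, r) * M' $$ (r, q))"
  by (auto simp: scalar_prod_def atLeast0LessThan intro!: sum.cong)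

lemma mulv_mult:
  assumes "M \<in> carrier_mat n n" "M' \<in> carrier_mat n n"
  shows "mulv n (M * M') v = mulv n M (mulv n M' v)"
proof
  fix p
  have "(\<Sum>q<n. (\<Sum>r<n. M $$ (p, r) * M' $$ (r, q)) * v q) = (\<Sum>r<n. M $$ (p, r) * (\<Sum>q<n. M' $$ (r, q) * v q))"
    unfolding sum_distrib_left sum_distrib_right mult.assoc by (rule sum.swap)
  then show "mulv n (M * M') v p = mulv n M (mulv n M' v) p"
    using mat_mult_index[OF assms] by (simp add: mulv_def)
qed

lemma mulv_one: "v \<in> nvecs n \<Longrightarrow> mulv n (1\<^sub>m n) v = v"
  unfolding mulv_def nvecs_def
  by (auto simp: fun_eq_iff if_distrib[of "\<lambda>x. x * _"] cong: if_cong)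

end

text \<open>\<open>f\<close> describes the minimal polynomial over the center, which measures pole
  orders; \<open>f0\<close> describes the one over \<open>fracs A\<close>, to which
  \<open>no_poles\<close> applies. They are linked by \<open>G_dvd\<close>.\<close>

locale pole = arithmetic_order +
  fixes n :: nat and a M f N0 f0
  assumes a: "a \<in> D" and mp: "minpoly (ctr D) a M f" and mp0: "minpoly (fracs A) a N0 f0"
begin

abbreviation "G \<equiv> monic M f"
abbreviation "G0 \<equiv> monic N0 f0"

definition T where "T = {t \<in> A. G0 1 t \<noteq> 0}"

lemma coeffs: "f i \<in> ctr D" "f0 i \<in> fracs A"
  using mp mp0 unfolding minpoly_def by auto

lemma G_polys: "G \<in> polys D"
  using monic_polys[OF DR] coeffs ctr_D by blast

lemma G0_polys: "G0 \<in> polys (fracs A)"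
  by (rule monic_polys[OF FR coeffs(2)])

lemma G_root: "G 1 a = 0"
  using mp unfolding minpoly_def monic_def by simp

lemma T_A: "t \<in> T \<Longrightarrow> t \<in> A" "t \<in> T \<Longrightarrow> t \<in> ctr D" "t \<in> T \<Longrightarrow> t \<in> D"
  unfolding T_def using AD A_D by auto

lemma infinite_T: "infinite T"
proof -
  have "finite {t \<in> A. G0 1 t = 0}"
  proof (rule ccontr)
    assume inf: "infinite {t \<in> A. G0 1 t = 0}"
    define c where "c i = (if i = N0 then 1 else f0 i)" for i
    have "\<forall>i<Suc N0. c i = 0"
    proof (rule finitely_many_central_roots[OF inf])
      fix t assume t: "t \<in> {t \<in> A. G0 1 t = 0}"
      then show "(\<Sum>i<Suc N0. c i * t ^ i) = 0" by (simp add: c_def monic_def add.commute)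
      have "t \<in> ctr D" "\<And>i. c i \<in> D" using t AD coeffs(2) F_D Dc(2) unfolding c_def by auto
      then show "t * c i = c i * t" for i by (rule central)
    qed (use comm AD in blast)
    then show False unfolding c_def by auto
  qed
  moreover have "A = T \<union> {t \<in> A. G0 1 t = 0}" unfolding T_def by auto
  ultimately show ?thesis using infinite_A by (metis finite_Un)
qed

lemma G_dvd: "\<exists>r\<in>polys (ctr D). \<forall>m \<tau>. G0 m \<tau> = r (G m \<tau>) \<tau>"
proof -
  have "G0 \<in> polys (ctr D)" using G0_polys polys_mono[OF F_ctr] by blast
  moreover have "G0 1 a = 0" using mp0 unfolding minpoly_def monic_def by simp
  ultimately show ?thesis
    using polys_root_division[OF div_subring_imp_subring[OF Z] mp] by blast
qed

text \<open>\<open>X\<close> is the operator obtained from \<open>G^k \<Phi>\<close> by letting \<open>t\<close> act as right multiplication by \<open>a\<close>;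
  it is the leading coefficient of \<open>\<Phi>\<close> at the pole \<open>t = a\<close>.\<close>

definition residue :: "nat \<Rightarrow> ('a \<Rightarrow> 'a mat) \<Rightarrow> ((nat \<Rightarrow> 'a) \<Rightarrow> nat \<Rightarrow> 'a) \<Rightarrow> bool" where
  "residue k \<Phi> X \<longleftrightarrow> (\<forall>t\<in>T. \<Phi> t \<in> mats n) \<and> (\<exists>P. (\<forall>p q. P p q \<in> polys D) \<and>
     (\<forall>t\<in>T. \<forall>p<n. \<forall>q<n. G 1 t ^ k * \<Phi> t $$ (p, q) = P p q 1 t) \<and>
     (\<forall>v\<in>nvecs n. X v = (\<lambda>p. if p < n then \<Sum>q<n. P p q (v q) a else 0)))"

lemma residue_cong:
  "residue k \<Phi> X \<Longrightarrow> (\<And>t. t \<in> T \<Longrightarrow> \<Phi> t = \<Phi>' t) \<Longrightarrow> (\<And>v. v \<in> nvecs n \<Longrightarrow> X v = X' v) \<Longrightarrow> residue k \<Phi>' X'"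
  unfolding residue_def by simp

lemma residue_nvecs: assumes "residue k \<Phi> X" "v \<in> nvecs n" shows "X v \<in> nvecs n"
proof -
  obtain P where P: "\<And>p q. P p q \<in> polys D" "X v = (\<lambda>p. if p < n then \<Sum>q<n. P p q (v q) a else 0)"
    using assms unfolding residue_def by blast
  have "P p q (v q) a \<in> D" for p q
    by (rule polys_closed[OF DR P(1) _ a]) (use assms(2) in \<open>auto simp: nvecs_def\<close>)
  then show ?thesis unfolding P(2) nvecs_def using Dc(1) by (auto intro!: div_subring_sum[OF D])
qed

lemma residue_const: assumes "g \<in> mats n" shows "residue 0 (\<lambda>_. g) (mulv n g)"
proof -
  define P where "P p q = (\<lambda>m \<tau>::'a. (if p < n \<and> q < n then g $$ (p, q) else 0) * m)" for p q
  have "P p q \<in> polys D" for p q unfolding P_def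
    by (rule polys.const) (use assms Dc(1) in \<open>auto simp: mats_def\<close>)
  then show ?thesis unfolding residue_def using assms
    by (intro conjI ballI exI[of _ P]) (auto simp: P_def mulv_def fun_eq_iff)
qed

lemma G_polys_ctr: "G \<in> polys (ctr D)"
  by (rule monic_polys[OF div_subring_imp_subring[OF Z] coeffs(1)])

lemma G_pow_ctr: "t \<in> T \<Longrightarrow> G 1 t ^ k \<in> ctr D"
  by (intro Z_closed(8) polys_closed[OF div_subring_imp_subring[OF Z] G_polys_ctr Z_closed(2)] T_A(2))

text \<open>Composition of polynomial entries is the matrix product at central \<open>t\<close> and
  the composition of operators at \<open>a\<close>, so one matrix of polynomials witnesses both. The
  powers of \<open>G 1 t\<close> are central and move past the entries.\<close>

lemma residue_mult:
  assumes "residue k \<Phi> X" "residue l \<Psi> Y"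
  shows "residue (k + l) (\<lambda>t. \<Phi> t * \<Psi> t) (\<lambda>v. X (Y v))"
proof -
  obtain P where P: "\<And>p q. P p q \<in> polys D"
    "\<And>t p q. t \<in> T \<Longrightarrow> p < n \<Longrightarrow> q < n \<Longrightarrow> G 1 t ^ k * \<Phi> t $$ (p, q) = P p q 1 t"
    "\<And>v. v \<in> nvecs n \<Longrightarrow> X v = (\<lambda>p. if p < n then \<Sum>q<n. P p q (v q) a else 0)" and \<Phi>: "\<And>t. t \<in> T \<Longrightarrow> \<Phi> t \<in> mats n"
    using assms(1) unfolding residue_def by blast
  obtain Q where Q: "\<And>p q. Q p q \<in> polys D"
    "\<And>t p q. t \<in> T \<Longrightarrow> p < n \<Longrightarrow> q < n \<Longrightarrow> G 1 t ^ l * \<Psi> t $$ (p, q) = Q p q 1 t"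
    "\<And>v. v \<in> nvecs n \<Longrightarrow> Y v = (\<lambda>p. if p < n then \<Sum>q<n. Q p q (v q) a else 0)" and \<Psi>: "\<And>t. t \<in> T \<Longrightarrow> \<Psi> t \<in> mats n"
    using assms(2) unfolding residue_def by blast
  define R where "R p q = (\<lambda>m \<tau>. \<Sum>r<n. P p r (Q r q m \<tau>) \<tau>)" for p q
  have R: "R p q \<in> polys D" for p q unfolding R_def by (rule polys_sum[OF DR], rule polys.mult[OF P(1) Q(1)])
  have "G 1 t ^ (k + l) * (\<Phi> t * \<Psi> t) $$ (p, q) = R p q 1 t" if t: "t \<in> T" and pq: "p < n" "q < n" for t p q
  proof -
    have car: "\<Phi> t \<in> carrier_mat n n" "\<Psi> t \<in> carrier_mat n n" using \<Phi>[OF t] \<Psi>[OF t] by (auto simp: mats_def)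
    have "G 1 t ^ (k + l) * (\<Phi> t * \<Psi> t) $$ (p, q) = (\<Sum>r<n. (G 1 t ^ k * \<Phi> t $$ (p, r)) * (G 1 t ^ l * \<Psi> t $$ (r, q)))"
      unfolding mat_mult_index[OF car pq] sum_distrib_left
    proof (rule sum.cong[OF refl])
      fix r assume r: "r \<in> {..<n}"
      have "\<Phi> t $$ (p, r) \<in> D" using \<Phi>[OF t] pq r unfolding mats_def by auto
      then have "G 1 t ^ l * \<Phi> t $$ (p, r) = \<Phi> t $$ (p, r) * G 1 t ^ l"
        using central[OF G_pow_ctr[OF t]] by blast
      then show "G 1 t ^ (k + l) * (\<Phi> t $$ (p, r) * \<Psi> t $$ (r, q)) =
        (G 1 t ^ k * \<Phi> t $$ (p, r)) * (G 1 t ^ l * \<Psi> t $$ (r, q))"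
        by (metis mult.assoc power_add)
    qed
    also have "\<dots> = (\<Sum>r<n. P p r 1 t * Q r q 1 t)" using P(2) Q(2) t pq by simp
    also have "\<dots> = R p q 1 t" unfolding R_def
      using polys_mult_central[OF DR P(1) Q(1) T_A(2)[OF t]] by simp
    finally show ?thesis .
  qed
  moreover have "X (Y v) = (\<lambda>p. if p < n then \<Sum>q<n. R p q (v q) a else 0)" if v: "v \<in> nvecs n" for v
  proof -
    have Yv: "Y v \<in> nvecs n" by (rule residue_nvecs[OF assms(2) v])
    have eqs: "(\<Sum>r<n. P p r (Y v r) a) = (\<Sum>q<n. R p q (v q) a)" for p
    proof -
      have "(\<Sum>r<n. P p r (Y v r) a) = (\<Sum>r<n. \<Sum>q<n. P p r (Q r q (v q) a) a)"
        unfolding Q(3)[OF v] by (simp add: polys_sum_arg[OF P(1)])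
      also have "\<dots> = (\<Sum>q<n. R p q (v q) a)" unfolding R_def by (rule sum.swap)
      finally show ?thesis .
    qed
    show ?thesis unfolding P(3)[OF Yv] eqs ..
  qed
  moreover have "\<Phi> t * \<Psi> t \<in> mats n" if "t \<in> T" for t using mats_mult \<Phi> \<Psi> that by blast
  ultimately show ?thesis unfolding residue_def using R by (intro conjI ballI exI[of _ R]) auto
qed

text \<open>Multiplying by \<open>r ^ k\<close> turns the denominator \<open>G ^ k\<close> into
  \<open>G0 ^ k\<close>, where \<open>no_poles\<close> removes it. Cancelling \<open>r ^ k\<close>
  leaves \<open>P = G ^ k E\<close> at infinitely many central points, hence as polynomials. At
  \<open>a\<close> the factor \<open>G\<close> contributes 0, because
  \<open>k \<ge> 1\<close>.\<close>

lemma residue_zero_of_bounded: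
  assumes extend: "no_poles \<Lambda>"
    and res: "residue k \<Phi> X" and k: "k \<ge> 1"
    and bd: "\<And>t p q. t \<in> T \<Longrightarrow> p < n \<Longrightarrow> q < n \<Longrightarrow> \<Phi> t $$ (p, q) \<in> \<Lambda>" and v: "v \<in> nvecs n"
  shows "X v = (\<lambda>_. 0)"
proof -
  obtain P where P: "\<And>p q. P p q \<in> polys D"
    "\<And>t p q. t \<in> T \<Longrightarrow> p < n \<Longrightarrow> q < n \<Longrightarrow> G 1 t ^ k * \<Phi> t $$ (p, q) = P p q 1 t"
    "\<And>v. v \<in> nvecs n \<Longrightarrow> X v = (\<lambda>p. if p < n then \<Sum>q<n. P p q (v q) a else 0)"
    using res unfolding residue_def by blast
  obtain r where r: "r \<in> polys (ctr D)" "\<And>m \<tau>. G0 m \<tau> = r (G m \<tau>) \<tau>" using G_dvd by blast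
  have rD: "r \<in> polys D" using r(1) polys_mono[OF ctr_D] by blast
  define rk where "rk = (\<lambda>m \<tau>. ((\<lambda>m. r m \<tau>) ^^ k) m)"
  define Gk where "Gk = (\<lambda>m \<tau>. ((\<lambda>m. G m \<tau>) ^^ k) m)"
  have rk: "rk \<in> polys D" unfolding rk_def by (rule polys_power[OF DR rD])
  have Gk: "Gk \<in> polys D" unfolding Gk_def by (rule polys_power[OF DR G_polys])
  have "P p q m a = 0" if pq: "p < n" "q < n" and m: "m \<in> D" for p q m
  proof -
    have ev: "rk 1 t = r 1 t ^ k" "Gk 1 t = G 1 t ^ k" "G0 1 t = r 1 t * G 1 t"
      "G0 1 t ^ k = r 1 t ^ k * G 1 t ^ k" if t: "t \<in> T" for t
    proof -
      show "rk 1 t = r 1 t ^ k" unfolding rk_def by (rule polys_power_central[OF DR rD T_A(2)[OF t]])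
      show "Gk 1 t = G 1 t ^ k" unfolding Gk_def by (rule polys_power_central[OF DR G_polys T_A(2)[OF t]])
      show *: "G0 1 t = r 1 t * G 1 t"
        using polys_mult_central[OF DR rD G_polys T_A(2)[OF t]] r(2)[of 1 t] by simp
      have "r 1 t * G 1 t = G 1 t * r 1 t"
        using central[OF G_pow_ctr[OF t, of 1], of "r 1 t"] polys_closed[OF DR rD Dc(2) T_A(3)[OF t]] by simp
      then show "G0 1 t ^ k = r 1 t ^ k * G 1 t ^ k" unfolding * by (rule power_mult_commuting)
    qed
    define P' where "P' = (\<lambda>m \<tau>. rk (P p q m \<tau>) \<tau>)"
    have P': "P' \<in> polys D" unfolding P'_def by (rule polys.mult[OF rk P(1)])
    have P't: "P' 1 t = r 1 t ^ k * P p q 1 t" if t: "t \<in> T" for t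
      unfolding P'_def using polys_mult_central[OF DR rk P(1) T_A(2)[OF t]] ev(1)[OF t] by simp
    have "\<exists>x\<in>\<Lambda>. G0 1 t ^ k * x = P' 1 t" if "t \<in> A" "G0 1 t \<noteq> 0" for t
    proof -
      have t: "t \<in> T" using that unfolding T_def by blast
      show ?thesis
        using P't[OF t] ev(4)[OF t] P(2)[OF t pq] bd[OF t pq] by (metis mult.assoc)
    qed
    then obtain E where E: "E \<in> polys D" "\<And>t. t \<in> A \<Longrightarrow> G0 1 t \<noteq> 0 \<Longrightarrow> P' 1 t = G0 1 t ^ k * E 1 t"
      using extend a mp0 P' unfolding no_poles_def by blast
    have ev_eq: "P p q 1 t = Gk (E 1 t) t" if t: "t \<in> T" for t
    proof -
      have "r 1 t ^ k * P p q 1 t = r 1 t ^ k * (G 1 t ^ k * E 1 t)"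
        using P't[OF t] E(2)[of t] ev(4)[OF t] t unfolding T_def by (simp add: mult.assoc)
      moreover have "r 1 t ^ k \<noteq> 0" using ev(3)[OF t] t unfolding T_def by auto
      ultimately have "P p q 1 t = G 1 t ^ k * E 1 t" by (metis mult_left_cancel)
      also have "\<dots> = Gk (E 1 t) t" using polys_mult_central[OF DR Gk E(1) T_A(2)[OF t]] ev(2)[OF t] by simp
      finally show ?thesis .
    qed
    have "P p q m a = Gk (E m a) a"
      by (rule polys_eqI[OF DR P(1) polys.mult[OF Gk E(1)] infinite_T])
        (use T_A(2) in blast, erule ev_eq)
    moreover have "Gk m' a = 0" if m': "m' \<in> D" for m'
    proof -
      obtain j where j: "k = Suc j" using k by (cases k) auto
      have "((\<lambda>m. G m a) ^^ j) m' \<in> D"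
        using polys_closed[OF DR polys_power[OF DR G_polys] m' a] .
      then have "G (((\<lambda>m. G m a) ^^ j) m' * 1) a = ((\<lambda>m. G m a) ^^ j) m' * G 1 a"
        by (intro polys_ctr_left_linear[OF DR order_refl G_polys_ctr _ Dc(2) a])
      then show ?thesis unfolding Gk_def j using G_root by simp
    qed
    ultimately show ?thesis using polys_closed[OF DR E(1) m a] by simp
  qed
  then show ?thesis unfolding P(3)[OF v] using v by (auto simp: fun_eq_iff nvecs_def)
qed

end

text \<open>Scalars act on the right, so that matrices act linearly from the left.\<close>

definition scale_vec :: "(nat \<Rightarrow> 'a::times) \<Rightarrow> 'a \<Rightarrow> nat \<Rightarrow> 'a" where
  "scale_vec w c = (\<lambda>i. w i * c)"

context arithmetic_order
begin

lemma mulv_scale: "mulv n M (scale_vec w c) = scale_vec (mulv n M w) c"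
  unfolding mulv_def scale_vec_def by (auto simp: fun_eq_iff sum_distrib_right mult.assoc)

lemma scale_nvecs: "w \<in> nvecs n \<Longrightarrow> c \<in> D \<Longrightarrow> scale_vec w c \<in> nvecs n"
  unfolding nvecs_def scale_vec_def using Dc(4) by auto

end

context pole
begin

definition cent where "cent = {z \<in> D. z * a = a * z}"

lemma cent: "div_subring cent"
  unfolding cent_def by (rule div_subring_centralizer[OF D])

definition polar :: "('a \<Rightarrow> 'a mat) \<Rightarrow> ((nat \<Rightarrow> 'a) \<Rightarrow> nat \<Rightarrow> 'a) \<Rightarrow> bool" where
  "polar \<Phi> X \<longleftrightarrow> (\<exists>k\<ge>1. residue k \<Phi> X)"

lemma polar_cong:
  "polar \<Phi> X \<Longrightarrow> (\<And>t. t \<in> T \<Longrightarrow> \<Phi> t = \<Phi>' t) \<Longrightarrow> (\<And>v. v \<in> nvecs n \<Longrightarrow> X v = X' v) \<Longrightarrow> polar \<Phi>' X'"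
  unfolding polar_def using residue_cong by meson

lemma polar_mult:
  "polar \<Phi> X \<Longrightarrow> polar \<Psi> Y \<Longrightarrow> polar (\<lambda>t. \<Phi> t * \<Psi> t) (\<lambda>v. X (Y v))"
  unfolding polar_def using residue_mult trans_le_add1 by meson

lemma polar_const:
  assumes g: "g \<in> mats n" and "polar \<Phi> X"
  shows "polar (\<lambda>t. g * \<Phi> t) (\<lambda>v. mulv n g (X v))" "polar (\<lambda>t. \<Phi> t * g) (\<lambda>v. X (mulv n g v))"
proof -
  obtain k where "k \<ge> 1" "residue k \<Phi> X" using assms(2) unfolding polar_def by blast
  then show "polar (\<lambda>t. g * \<Phi> t) (\<lambda>v. mulv n g (X v))" "polar (\<lambda>t. \<Phi> t * g) (\<lambda>v. X (mulv n g v))"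
    unfolding polar_def using residue_mult[OF residue_const[OF g], of k] residue_mult[OF _ residue_const[OF g], of k]
    by force+
qed

text \<open>An element with a rank one pole of this kind keeps a nonzero leading coefficient under all
  commutators with \<open>g\<close> and under powers, whereas a word with values in \<open>H\<close> has no pole.\<close>

lemma no_rank_one_pole:
  assumes as: "almost_subnormal H (GL n)" and g: "g \<in> H" "g \<in> mats n"
    and gi: "inv\<^bsub>GL n\<^esub> g \<in> mats n" and gGL: "g \<in> carrier (GL n)"
    and HL: "\<And>h p q. h \<in> H \<Longrightarrow> p < n \<Longrightarrow> q < n \<Longrightarrow> h $$ (p, q) \<in> \<Lambda>" and L: "no_poles \<Lambda>"
    and xGL: "\<And>t. t \<in> T \<Longrightarrow> x t \<in> carrier (GL n)"
    and polx: "polar x (\<lambda>v. scale_vec \<delta> (y v))"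
    and poli: "polar (\<lambda>t. inv\<^bsub>GL n\<^esub> (x t)) (\<lambda>v. scale_vec \<delta>' (y v))"
    and \<delta>: "\<delta> \<in> nvecs n" "\<delta>' \<in> nvecs n"
    and y: "\<And>v. v \<in> nvecs n \<Longrightarrow> y v \<in> cent"
      "\<And>w c. w \<in> nvecs n \<Longrightarrow> c \<in> cent \<Longrightarrow> y (scale_vec w c) = y w * c"
    and nz: "y (mulv n g \<delta>) \<noteq> 0" "y (mulv n (inv\<^bsub>GL n\<^esub> g) \<delta>) \<noteq> 0"
      "y (mulv n g \<delta>') \<noteq> 0" "y (mulv n (inv\<^bsub>GL n\<^esub> g) \<delta>') \<noteq> 0"
  shows False
proof -
  interpret K: group "GL n :: 'a mat monoid" by (rule GL_group)
  note Cc = div_subringD[OF cent]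
  define gi where "gi = inv\<^bsub>GL n\<^esub> g"
  have giM: "gi \<in> mats n" using gi unfolding gi_def .
  define U where "U = mulv n g"
  define V where "V = mulv n gi"
  have car: "g \<in> carrier_mat n n" "gi \<in> carrier_mat n n" using g(2) giM unfolding mats_def by auto
  have VU: "V (U v) = v" if "v \<in> nvecs n" for v
    unfolding U_def V_def using mulv_mult[OF car(2,1), of v] mulv_one[OF that] K.l_inv[OF gGL]
    by (simp add: GL_simps gi_def)
  have UVn: "U v \<in> nvecs n" "V v \<in> nvecs n" if "v \<in> nvecs n" for v
    unfolding U_def V_def using mulv_nvecs g(2) giM that by auto
  have Us: "U (scale_vec w c) = scale_vec (U w) c" "V (scale_vec w c) = scale_vec (V w) c" for w c
    unfolding U_def V_def by (rule mulv_scale)+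
  \<comment> \<open>Products of such scalars stay nonzero because \<open>cent\<close> is a division
    ring; this is what excludes cancellation.\<close>
  define S where "S = cent - {0}"
  have S_mult: "c * d \<in> S" if "c \<in> S" "d \<in> S" for c d using that Cc(4) unfolding S_def by auto
  have yS: "y (U \<delta>) \<in> S" "y (V \<delta>) \<in> S" "y (U \<delta>') \<in> S" "y (V \<delta>') \<in> S"
    using y(1) UVn \<delta> nz unfolding S_def U_def V_def gi_def by auto
  \<comment> \<open>The shape of the first commutator: \<open>x g x^-1 g^-1\<close> has the leading
    coefficient \<open>\<delta> * y (U \<delta>') * y (V v)\<close>, and its inverse
    \<open>g x g^-1 x^-1\<close> has \<open>U \<delta> * y (V \<delta>') * y v\<close>. As
    \<open>V\<close> undoes \<open>U\<close>, further commutators and products keep the shape and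
    change only \<open>c\<close> and \<open>c'\<close>, by factors \<open>y (U \<delta>)\<close> and
    \<open>y (V \<delta>)\<close>.\<close>
  define R where "R \<Phi> \<longleftrightarrow> (\<exists>c\<in>S. \<exists>c'\<in>S. polar \<Phi> (\<lambda>v. scale_vec \<delta> (c * y (V v))) \<and>
    polar (\<lambda>t. inv\<^bsub>GL n\<^esub> (\<Phi> t)) (\<lambda>v. scale_vec (U \<delta>) (c' * y v)))" for \<Phi>
  have cm: "commutator (GL n) x g = x * g * inv\<^bsub>GL n\<^esub> x * gi" for x
    by (simp add: commutator_def GL_simps gi_def)
  have icm: "inv\<^bsub>GL n\<^esub> (commutator (GL n) x g) = g * x * gi * inv\<^bsub>GL n\<^esub> x" if "x \<in> carrier (GL n)" for x
  proof -
    have "inv\<^bsub>GL n\<^esub> (commutator (GL n) x g) = g \<otimes>\<^bsub>GL n\<^esub> x \<otimes>\<^bsub>GL n\<^esub> inv\<^bsub>GL n\<^esub> g \<otimes>\<^bsub>GL n\<^esub> inv\<^bsub>GL n\<^esub> x"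
      unfolding commutator_def using that gGL by (simp add: K.inv_mult_group K.m_assoc)
    then show ?thesis by (simp add: GL_simps gi_def)
  qed
  have R_commutator: "R (\<lambda>t. commutator (GL n) (\<Phi> t) g)"
    if \<Phi>: "\<And>t. t \<in> T \<Longrightarrow> \<Phi> t \<in> carrier (GL n)" and XY: "polar \<Phi> X" "polar (\<lambda>t. inv\<^bsub>GL n\<^esub> (\<Phi> t)) Y"
      and c: "c \<in> S" "c' \<in> S"
      and X: "\<And>v. v \<in> nvecs n \<Longrightarrow> X (U (Y (V v))) = scale_vec \<delta> (c * y (V v))"
      and Y: "\<And>v. v \<in> nvecs n \<Longrightarrow> U (X (V (Y v))) = scale_vec (U \<delta>) (c' * y v)" for \<Phi> X Y c c'
  proof -
    have "polar (\<lambda>t. commutator (GL n) (\<Phi> t) g) (\<lambda>v. scale_vec \<delta> (c * y (V v)))"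
      by (rule polar_cong[OF polar_const(2)[OF giM polar_mult[OF polar_const(2)[OF g(2) XY(1)] XY(2)]]])
        (simp_all add: cm X flip: U_def V_def)
    moreover have "polar (\<lambda>t. inv\<^bsub>GL n\<^esub> (commutator (GL n) (\<Phi> t) g)) (\<lambda>v. scale_vec (U \<delta>) (c' * y v))"
      by (rule polar_cong[OF polar_mult[OF polar_const(2)[OF giM polar_const(1)[OF g(2) XY(1)]] XY(2)]])
        (simp_all add: icm \<Phi> Y flip: U_def V_def)
    ultimately show ?thesis unfolding R_def using c by blast
  qed
  have start: "R (\<lambda>t. commutator (GL n) (x t) g)"
    by (rule R_commutator[OF xGL polx poli yS(3,4)]) (use y \<delta> UVn Us in auto)
  have step: "R (\<lambda>t. commutator (GL n) (\<Phi> t) g)"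
    if R: "R \<Phi>" and \<Phi>: "\<And>t. t \<in> T \<Longrightarrow> \<Phi> t \<in> carrier (GL n)" for \<Phi>
  proof -
    obtain c c' where *: "c \<in> S" "c' \<in> S" "polar \<Phi> (\<lambda>v. scale_vec \<delta> (c * y (V v)))"
      "polar (\<lambda>t. inv\<^bsub>GL n\<^esub> (\<Phi> t)) (\<lambda>v. scale_vec (U \<delta>) (c' * y v))"
      using R unfolding R_def by blast
    have mem: "c' * y v \<in> cent" if "v \<in> nvecs n" for v using *(2) y(1)[OF that] Cc(4) unfolding S_def by blast
    show ?thesis
    proof (rule R_commutator[OF \<Phi> *(3,4) S_mult[OF S_mult[OF *(1) yS(1)] *(2)] S_mult[OF S_mult[OF *(1) yS(2)] *(2)]])
      fix v assume v: "v \<in> nvecs n"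
      show "scale_vec \<delta> (c * y (V (U (scale_vec (U \<delta>) (c' * y (V v)))))) = scale_vec \<delta> (c * y (U \<delta>) * c' * y (V v))"
        unfolding Us VU[OF UVn(1)[OF \<delta>(1)]] y(2)[OF UVn(1)[OF \<delta>(1)] mem[OF UVn(2)[OF v]]] by (simp add: mult.assoc)
      show "U (scale_vec \<delta> (c * y (V (V (scale_vec (U \<delta>) (c' * y v)))))) = scale_vec (U \<delta>) (c * y (V \<delta>) * c' * y v)"
        unfolding Us VU[OF \<delta>(1)] y(2)[OF UVn(2)[OF \<delta>(1)] mem[OF v]] by (simp add: mult.assoc)
    qed
  qed
  have mult: "R (\<lambda>t. \<Phi> t * \<Psi> t)" if R: "R \<Phi>" "R \<Psi>"
    and GLs: "\<And>t. t \<in> T \<Longrightarrow> \<Phi> t \<in> carrier (GL n)" "\<And>t. t \<in> T \<Longrightarrow> \<Psi> t \<in> carrier (GL n)" for \<Phi> \<Psi>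
  proof -
    obtain c c' where *: "c \<in> S" "c' \<in> S" "polar \<Phi> (\<lambda>v. scale_vec \<delta> (c * y (V v)))"
      "polar (\<lambda>t. inv\<^bsub>GL n\<^esub> (\<Phi> t)) (\<lambda>v. scale_vec (U \<delta>) (c' * y v))"
      using R(1) unfolding R_def by blast
    obtain d d' where **: "d \<in> S" "d' \<in> S" "polar \<Psi> (\<lambda>v. scale_vec \<delta> (d * y (V v)))"
      "polar (\<lambda>t. inv\<^bsub>GL n\<^esub> (\<Psi> t)) (\<lambda>v. scale_vec (U \<delta>) (d' * y v))"
      using R(2) unfolding R_def by blast
    have mem: "e * y v \<in> cent" if "e \<in> S" "v \<in> nvecs n" for e v
      using that y(1)[OF that(2)] Cc(4) unfolding S_def by blast
    have "polar (\<lambda>t. \<Phi> t * \<Psi> t) (\<lambda>v. scale_vec \<delta> ((c * y (V \<delta>) * d) * y (V v)))"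
      by (rule polar_cong[OF polar_mult[OF *(3) **(3)] refl])
        (simp add: Us y(2)[OF UVn(2)[OF \<delta>(1)] mem[OF **(1) UVn(2)]] mult.assoc)
    moreover have "polar (\<lambda>t. inv\<^bsub>GL n\<^esub> (\<Phi> t * \<Psi> t)) (\<lambda>v. scale_vec (U \<delta>) ((d' * y (U \<delta>) * c') * y v))"
      by (rule polar_cong[OF polar_mult[OF **(4) *(4)]])
        (use GLs K.inv_mult_group in \<open>simp_all add: GL_simps y(2)[OF UVn(1)[OF \<delta>(1)] mem[OF *(2)]] mult.assoc\<close>)
    ultimately show ?thesis unfolding R_def using S_mult * ** yS by blast
  qed
  have pow: "R (\<lambda>t. \<Phi> t [^]\<^bsub>GL n\<^esub> m)"
    if R: "R \<Phi>" and \<Phi>: "\<And>t. t \<in> T \<Longrightarrow> \<Phi> t \<in> carrier (GL n)" and m: "m \<ge> 1" for \<Phi> and m :: nat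
    using m
  proof (induction m rule: nat_induct_at_least)
    case base
    obtain c c' where *: "c \<in> S" "c' \<in> S" "polar \<Phi> (\<lambda>v. scale_vec \<delta> (c * y (V v)))"
      "polar (\<lambda>t. inv\<^bsub>GL n\<^esub> (\<Phi> t)) (\<lambda>v. scale_vec (U \<delta>) (c' * y v))"
      using R unfolding R_def by blast
    have "polar (\<lambda>t. \<Phi> t [^]\<^bsub>GL n\<^esub> (1::nat)) (\<lambda>v. scale_vec \<delta> (c * y (V v)))"
      "polar (\<lambda>t. inv\<^bsub>GL n\<^esub> (\<Phi> t [^]\<^bsub>GL n\<^esub> (1::nat))) (\<lambda>v. scale_vec (U \<delta>) (c' * y v))"
      by (rule polar_cong[OF *(3)], simp_all add: \<Phi>) (rule polar_cong[OF *(4)], simp_all add: \<Phi>)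
    then show ?case using *(1,2) unfolding R_def by blast
  next
    case (Suc m)
    from mult[OF Suc.IH R] \<Phi> show ?case by (simp add: GL_simps)
  qed
  obtain \<Phi> where \<Phi>: "R \<Phi>" "\<And>t. t \<in> T \<Longrightarrow> \<Phi> t \<in> H"
    using almost_subnormal_commutator_word[where P = R and T = T and x = x, OF GL_group as g(1) start xGL step pow]
    by blast
  obtain k c where kc: "k \<ge> 1" "c \<in> S" "residue k \<Phi> (\<lambda>v. scale_vec \<delta> (c * y (V v)))"
    using \<Phi>(1) unfolding R_def polar_def by blast
  \<comment> \<open>Testing the vanishing operator on \<open>\<delta>\<close> itself forces
    \<open>\<delta> = 0\<close>, contrary to \<open>y (V \<delta>) \<noteq> 0\<close>.\<close>
  have "scale_vec \<delta> (c * y (V \<delta>)) = (\<lambda>_. 0)"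
    by (rule residue_zero_of_bounded[OF L kc(3,1) _ \<delta>(1)]) (use HL \<Phi>(2) in auto)
  moreover have "c * y (V \<delta>) \<noteq> 0" using S_mult[OF kc(2) yS(2)] unfolding S_def by blast
  ultimately have "\<delta> i = 0" for i
    by (auto simp: scale_vec_def fun_eq_iff)
  then have "V \<delta> = scale_vec (V \<delta>) 0" unfolding V_def mulv_def scale_vec_def by (auto simp: fun_eq_iff)
  then have "y (V \<delta>) = y (V \<delta>) * 0" using y(2)[OF UVn(2)[OF \<delta>(1)] Cc(1)] by simp
  then show False using yS(2) unfolding S_def by simp
qed

end

section \<open>Families with rank one poles in general position\<close>

context arithmetic_order
begin

text \<open>If \<open>\<phi>\<close> killed \<open>g u\<close> whenever it kills \<open>u\<close>,
  every vector would be an eigenvector and \<open>g\<close> a central scalar. A second functional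
  \<open>\<phi>'\<close> separates \<open>gi u\<close> from the line of \<open>u\<close>, and one of
  \<open>\<phi>\<close>, \<open>\<phi>'\<close>, \<open>\<phi> + \<phi>'\<close> meets both
  conditions.\<close>

lemma noncentral_transvection_pair:
  assumes g: "g \<in> mats n" "gi \<in> mats n" and gg: "g * gi = 1\<^sub>m n" "gi * g = 1\<^sub>m n"
    and x0: "x0 \<in> mats n" "g * x0 \<noteq> x0 * g" and n: "n \<ge> 2"
  shows "\<exists>u \<phi>. u \<in> nvecs n \<and> (\<forall>i. \<phi> i \<in> D) \<and> (\<Sum>i<n. \<phi> i * u i) = 0 \<and>
    (\<Sum>i<n. \<phi> i * mulv n g u i) \<noteq> 0 \<and> (\<Sum>i<n. \<phi> i * mulv n gi u i) \<noteq> 0"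
proof -
  have car: "g \<in> carrier_mat n n" "gi \<in> carrier_mat n n" "x0 \<in> carrier_mat n n" using g x0 unfolding mats_def by auto
  define pr where "pr \<phi> w = (\<Sum>i<n. \<phi> i * w i)" for \<phi> w :: "nat \<Rightarrow> 'a"
  define e where "e k d = (\<lambda>i. if i = k then d else 0)" for k :: nat and d :: 'a
  have pre: "pr (\<lambda>i. \<psi> i + \<psi>' i) w = pr \<psi> w + pr \<psi>' w" for \<psi> \<psi>' w
    unfolding pr_def by (simp add: distrib_right sum.distrib)
  have pre1: "pr (e k d) w = d * w k" if "k < n" for k d w
    unfolding pr_def e_def using that by (simp add: if_distrib[of "\<lambda>x. x * _"] cong: if_cong)
  have eD: "e k d i \<in> D" if "d \<in> D" for k d i unfolding e_def using that Dc(1) by simp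
  have en: "e k d \<in> nvecs n" if "d \<in> D" "k < n" for k d unfolding nvecs_def using that eD by (auto simp: e_def)
  have mve: "mulv n M (e k d) i = M $$ (i, k) * d" if "k < n" "i < n" for M k d i
    unfolding mulv_def e_def using that by (simp add: if_distrib[of "\<lambda>x. _ * x"] cong: if_cong)
  have mva: "mulv n M (\<lambda>i. v i + w i) i = mulv n M v i + mulv n M w i" for M v w i
    unfolding mulv_def by (simp add: distrib_left sum.distrib)
  have "\<exists>u \<phi>. u \<in> nvecs n \<and> (\<forall>i. \<phi> i \<in> D) \<and> pr \<phi> u = 0 \<and> pr \<phi> (mulv n g u) \<noteq> 0"
  proof (rule ccontr)
    assume neg: "\<not> ?thesis"
    have van: "pr \<phi> (mulv n g u) = 0" if "u \<in> nvecs n" "\<And>i. \<phi> i \<in> D" "pr \<phi> u = 0" for u \<phi>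
      using neg that by blast
    have off: "g $$ (i, j) = 0" if "i < n" "j < n" "i \<noteq> j" for i j
    proof -
      have "pr (e i 1) (e j 1) = 0" unfolding pre1[OF that(1)] using that by (simp add: e_def)
      then have "pr (e i 1) (mulv n g (e j 1)) = 0" using van[of "e j 1" "e i 1"] en eD Dc(2) that by blast
      then show ?thesis unfolding pre1[OF that(1)] mve[OF that(2,1)] by simp
    qed
    \<comment> \<open>The pair \<open>u = e_i + e_j d\<close>, \<open>\<phi> = e_j - d e_i\<close>
      compares two diagonal entries through \<open>d\<close>: for \<open>d = 1\<close> they agree,
      and general \<open>d\<close> shows that their common value commutes with
      \<open>D\<close>.\<close>
    have diag: "d * g $$ (i, i) = g $$ (j, j) * d" if "i < n" "j < n" "i \<noteq> j" "d \<in> D" for i j d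
    proof -
      define u where "u = (\<lambda>k. e i 1 k + e j d k)"
      define \<phi> where "\<phi> = (\<lambda>k. e j 1 k + e i (- d) k)"
      have u: "u \<in> nvecs n" unfolding u_def nvecs_def using eD Dc that by (auto simp: e_def)
      have \<phi>: "\<phi> k \<in> D" for k unfolding \<phi>_def using eD Dc that by auto
      have "pr \<phi> u = 0" unfolding \<phi>_def pre pre1[OF that(1)] pre1[OF that(2)] u_def using that(3) by (simp add: e_def)
      then have "pr \<phi> (mulv n g u) = 0" using van[OF u] \<phi> by blast
      then have "g $$ (j, i) + g $$ (j, j) * d + - d * (g $$ (i, i) + g $$ (i, j) * d) = 0"
        unfolding \<phi>_def pre pre1[OF that(1)] pre1[OF that(2)] u_def mva
        using mve that by simp
      then show ?thesis using off that by simp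
    qed
    obtain i0 i1 where i01: "i0 < n" "i1 < n" "i0 \<noteq> i1" using n by (metis One_nat_def less_2_cases_iff less_le_trans n_not_Suc_n)
    define lam where "lam = g $$ (i0, i0)"
    have lam: "g $$ (i, i) = lam" if "i < n" for i
      using diag[OF i01(1) that _ Dc(2)] unfolding lam_def by (cases "i = i0") auto
    have cen: "d * lam = lam * d" if "d \<in> D" for d
      using diag[OF i01 that] lam i01 by simp
    have entry: "g $$ (i, j) = (if i = j then lam else 0)" if "i < n" "j < n" for i j
      using lam off that by auto
    have "g * x0 = x0 * g"
    proof (rule eq_matI)
      fix i j assume ij: "i < dim_row (x0 * g)" "j < dim_col (x0 * g)"
      then have ij: "i < n" "j < n" using car by auto
      have "(g * x0) $$ (i, j) = (\<Sum>r<n. (if i = r then lam else 0) * x0 $$ (r, j))"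
        unfolding mat_mult_index[OF car(1,3) ij] using entry ij by simp
      also have "\<dots> = lam * x0 $$ (i, j)"
        using ij by (simp add: if_distrib[of "\<lambda>x. x * _"] cong: if_cong)
      also have "\<dots> = x0 $$ (i, j) * lam" using cen x0 ij unfolding mats_def by simp
      also have "\<dots> = (\<Sum>r<n. x0 $$ (i, r) * (if r = j then lam else 0))"
        using ij by (simp add: if_distrib[of "\<lambda>x. _ * x"] cong: if_cong)
      also have "\<dots> = (x0 * g) $$ (i, j)"
        unfolding mat_mult_index[OF car(3,1) ij] using entry ij by simp
      finally show "(g * x0) $$ (i, j) = (x0 * g) $$ (i, j)" .
    qed (use car in auto)
    then show False using x0 by blast
  qed
  then obtain u \<phi> where u: "u \<in> nvecs n" "\<And>i. \<phi> i \<in> D" "pr \<phi> u = 0" "pr \<phi> (mulv n g u) \<noteq> 0" by blast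
  define w where "w = mulv n gi u"
  have wn: "w \<in> nvecs n" unfolding w_def by (rule mulv_nvecs[OF g(2) u(1)])
  have gw: "mulv n g w = u" unfolding w_def using mulv_mult[OF car(1,2), of u] gg mulv_one[OF u(1)] by simp
  have "\<exists>k<n. u k \<noteq> 0"
  proof (rule ccontr)
    assume "\<not> ?thesis"
    then have "pr \<phi> (mulv n g u) = 0" unfolding pr_def mulv_def by simp
    then show False using u by blast
  qed
  then obtain k where k: "k < n" "u k \<noteq> 0" by blast
  have "\<exists>\<phi>'. (\<forall>i. \<phi>' i \<in> D) \<and> pr \<phi>' u = 0 \<and> pr \<phi>' w \<noteq> 0"
  proof (rule ccontr)
    assume neg: "\<not> ?thesis"
    \<comment> \<open>If no functional separates \<open>w\<close> from \<open>u\<close>, then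
      \<open>w = u c\<close>. Applying \<open>g\<close> gives \<open>u = g u c\<close>, and pairing
      with \<open>\<phi>\<close> gives \<open>c = 0\<close>, hence \<open>u = 0\<close>.\<close>
    define c where "c = inverse (u k) * w k"
    have "w i = u i * c" if i: "i < n" for i
    proof -
      define \<phi>' where "\<phi>' = (\<lambda>j. e i 1 j + e k (- (u i * inverse (u k))) j)"
      have "\<phi>' j \<in> D" for j unfolding \<phi>'_def using eD Dc u(1) by (auto simp: nvecs_def)
      moreover have "pr \<phi>' u = 0" unfolding \<phi>'_def pre pre1[OF i] pre1[OF k(1)] using k by (simp add: mult.assoc)
      ultimately have "pr \<phi>' w = 0" using neg by blast
      then show ?thesis unfolding \<phi>'_def pre pre1[OF i] pre1[OF k(1)] c_def by (simp add: mult.assoc)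
    qed
    then have wc: "w = scale_vec u c" using wn u(1) unfolding scale_vec_def nvecs_def
      by (metis (mono_tags, lifting) ext linorder_not_less mem_Collect_eq mult_zero_left)
    have "u = scale_vec (mulv n g u) c" using gw unfolding wc mulv_scale by simp
    then have "pr \<phi> u = pr \<phi> (scale_vec (mulv n g u) c)" by simp
    also have "\<dots> = pr \<phi> (mulv n g u) * c" unfolding pr_def scale_vec_def by (simp add: sum_distrib_right mult.assoc)
    finally have "c = 0" using u by simp
    then have "u k = 0" using \<open>u = scale_vec (mulv n g u) c\<close> unfolding scale_vec_def by (metis mult_zero_right)
    then show False using k by simp
  qed
  then obtain \<phi>' where \<phi>': "\<And>i. \<phi>' i \<in> D" "pr \<phi>' u = 0" "pr \<phi>' w \<noteq> 0" by blast
  have "\<exists>\<psi>. (\<forall>i. \<psi> i \<in> D) \<and> pr \<psi> u = 0 \<and> pr \<psi> (mulv n g u) \<noteq> 0 \<and> pr \<psi> w \<noteq> 0"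
  proof (cases "pr \<phi> w = 0")
    case False
    then show ?thesis using u by blast
  next
    case True
    show ?thesis
    proof (cases "pr \<phi>' (mulv n g u) = 0")
      case False
      then show ?thesis using \<phi>' by blast
    next
      case True': True
      show ?thesis
        by (intro exI[of _ "\<lambda>i. \<phi> i + \<phi>' i"]) (use u \<phi>' True True' pre Dc(3) in auto)
    qed
  qed
  then show ?thesis using u(1) unfolding pr_def w_def by blast
qed

lemma minpoly_zero: "is_subring S \<Longrightarrow> minpoly S 0 1 (\<lambda>_. 0)"
  unfolding minpoly_def using is_subringD(1)[of S] by auto

text \<open>As for the independence of characters: once the leading coefficient is 1, the commutator
  of the relation with any \<open>d\<close> is shorter. If all these commutators vanish, the
  coefficients are central and \<open>m = 1\<close> gives the relation. So powers of
  \<open>a\<close> that are independent over the center stay independent as right multiplications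
  with left coefficients.\<close>

lemma left_right_relation:
  assumes a: "a \<in> D" and "\<And>j. p j \<in> D" and "\<And>m. m \<in> D \<Longrightarrow> (\<Sum>j<k. p j * m * a ^ j) = 0"
    and "\<exists>j<k. p j \<noteq> 0"
  shows "\<exists>c. (\<forall>i. c i \<in> ctr D) \<and> (\<exists>i<k. c i \<noteq> 0) \<and> (\<Sum>i<k. c i * a ^ i) = 0"
  using assms(2-)
proof (induction k arbitrary: p)
  case (Suc k)
  have lift: ?case if rel: "\<exists>c. (\<forall>i. c i \<in> ctr D) \<and> (\<exists>i<k. c i \<noteq> 0) \<and> (\<Sum>i<k. c i * a ^ i) = 0"
  proof -
    obtain c where c: "\<forall>i. c i \<in> ctr D" "\<exists>i<k. c i \<noteq> 0" "(\<Sum>i<k. c i * a ^ i) = 0" using rel by blast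
    then show ?thesis using Z_closed(1)
      by (intro exI[of _ "\<lambda>i. if i < k then c i else 0"]) (auto intro: less_SucI)
  qed
  show ?case
  proof (cases "p k = 0")
    case True
    have "\<exists>j<k. p j \<noteq> 0" using Suc.prems(3) True less_Suc_eq by blast
    moreover have "(\<Sum>j<k. p j * m * a ^ j) = 0" if "m \<in> D" for m using Suc.prems(2)[OF that] True by simp
    ultimately show ?thesis using lift Suc.IH[of p] Suc.prems(1) by blast
  next
    case False
    define q where "q j = inverse (p k) * p j" for j
    have q: "q j \<in> D" for j unfolding q_def using Suc.prems(1) Dc(4,6) by blast
    have qk: "q k = 1" unfolding q_def using False by simp
    have rel: "(\<Sum>j<Suc k. q j * m * a ^ j) = 0" if "m \<in> D" for m
      using Suc.prems(2)[OF that] unfolding q_def mult.assoc sum_distrib_left[symmetric] by simp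
    show ?thesis
    proof (cases "\<exists>d\<in>D. \<exists>j<k. d * q j - q j * d \<noteq> 0")
      \<comment> \<open>The commutator with \<open>d\<close> is a shorter relation.\<close>
      case True
      then obtain d where d: "d \<in> D" "\<exists>j<k. d * q j - q j * d \<noteq> 0" by blast
      have "(\<Sum>j<k. (d * q j - q j * d) * m * a ^ j) = 0" if m: "m \<in> D" for m
      proof -
        have "(\<Sum>j<Suc k. (d * q j - q j * d) * m * a ^ j) =
          d * (\<Sum>j<Suc k. q j * m * a ^ j) - (\<Sum>j<Suc k. q j * (d * m) * a ^ j)"
          by (simp only: left_diff_distrib sum_subtractf sum_distrib_left mult.assoc)
        also have "\<dots> = 0" using rel[OF m] rel[OF Dc(4)[OF d(1) m]] by simp
        finally show ?thesis using qk by simp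
      qed
      moreover have "d * q j - q j * d \<in> D" for j using Dc(4)[OF d(1) q] Dc(4)[OF q d(1)] Dc(7) by blast
      ultimately show ?thesis using lift Suc.IH[of "\<lambda>j. d * q j - q j * d"] d(2) by blast
    next
      case False
      define c where "c j = (if j \<le> k then q j else 0)" for j
      have "c j \<in> ctr D" for j
      proof (cases "j < k")
        case True
        then show ?thesis unfolding c_def ctr_def using False q by auto
      next
        case False
        then show ?thesis unfolding c_def using qk Z_closed(1,2) by auto
      qed
      moreover have "(\<Sum>i<Suc k. c i * a ^ i) = 0" using rel[OF Dc(2)] by (simp add: c_def)
      moreover have "c k \<noteq> 0" unfolding c_def using qk by simp
      ultimately show ?thesis by blast
    qed
  qed
qed simp

text \<open>The coefficients of \<open>(G \<beta> - G X) / (\<beta> - X)\<close> for a monic polynomial \<open>G\<close>.\<close>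

definition rcoeff :: "nat \<Rightarrow> (nat \<Rightarrow> 'a) \<Rightarrow> 'a \<Rightarrow> nat \<Rightarrow> 'a" where
  "rcoeff N e \<beta> j = (\<Sum>i\<in>{j<..N}. (if i = N then 1 else e i) * \<beta> ^ (i - 1 - j))"

text \<open>For a root \<open>\<beta>\<close> of \<open>G\<close> and a central
  \<open>\<tau>\<close>, the value at \<open>m = 1\<close> divided by \<open>- G 1 \<tau>\<close> is
  the inverse of \<open>\<beta> - \<tau>\<close>, by \<open>resolvent_eq\<close>. At
  \<open>\<tau> = \<beta>\<close> the operator is therefore, up to sign, the leading coefficient of
  that inverse, and its values commute with \<open>\<beta>\<close>.\<close>

definition resolvent :: "nat \<Rightarrow> (nat \<Rightarrow> 'a) \<Rightarrow> 'a \<Rightarrow> 'a \<Rightarrow> 'a \<Rightarrow> 'a" where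
  "resolvent N e \<beta> m \<tau> = (\<Sum>j<N. rcoeff N e \<beta> j * m * \<tau> ^ j)"

lemma rcoeff_D: "(\<And>i. e i \<in> ctr D) \<Longrightarrow> \<beta> \<in> D \<Longrightarrow> rcoeff N e \<beta> j \<in> D"
  unfolding rcoeff_def using ctr_D Dc(2) by (intro div_subring_sum[OF D] Dc(4) Dc(8)) auto

lemma resolvent_polys: "(\<And>i. e i \<in> ctr D) \<Longrightarrow> \<beta> \<in> D \<Longrightarrow> resolvent N e \<beta> \<in> polys D"
  unfolding resolvent_def[abs_def] by (rule polys_explicit[OF DR rcoeff_D])

lemma rcoeff_commute:
  assumes e: "\<And>i. e i \<in> ctr D" and c: "c \<in> D" "c * \<beta> = \<beta> * c"
  shows "c * rcoeff N e \<beta> j = rcoeff N e \<beta> j * c"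
  unfolding rcoeff_def sum_distrib_left sum_distrib_right
proof (rule sum.cong[OF refl])
  fix i
  have "(if i = N then 1 else e i) * c = c * (if i = N then 1 else e i)" using central[OF e c(1)] by simp
  moreover have "\<beta> ^ k * c = c * \<beta> ^ k" for k using power_commute[of \<beta> c k] c(2) by simp
  ultimately show "c * ((if i = N then 1 else e i) * \<beta> ^ (i - 1 - j)) = (if i = N then 1 else e i) * \<beta> ^ (i - 1 - j) * c"
    by (metis mult.assoc)
qed

lemma rcoeff_top: "N \<ge> 1 \<Longrightarrow> rcoeff N e \<beta> (N - 1) = 1"
proof -
  assume "N \<ge> 1"
  then have "{N - 1<..N} = {N}" by auto
  then show ?thesis unfolding rcoeff_def by simp
qed

text \<open>The top coefficient is 1, so this is the highest one in which \<open>\<beta>\<close> is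
  visible. For central \<open>e\<close> it differs from \<open>\<beta>\<close> by a central element
  and has the same commutators.\<close>

lemma rcoeff_second: "N \<ge> 2 \<Longrightarrow> rcoeff N e \<beta> (N - 2) = \<beta> + e (N - 1)"
proof -
  assume N: "N \<ge> 2"
  then have "{N - 2<..N} = {N - 1, N}" by auto
  moreover have "N - 1 \<noteq> N" "N - 1 - 1 - (N - 2) = 0" "N - 1 - (N - 2) = 1" using N by auto
  ultimately show ?thesis unfolding rcoeff_def by (simp add: add.commute)
qed

lemma resolvent_eq:
  assumes e: "\<And>i. e i \<in> ctr D" and \<beta>: "\<beta> \<in> D" and m: "m \<in> D"
  shows "\<beta> * resolvent N e \<beta> m \<tau> - resolvent N e \<beta> m \<tau> * \<tau> = monic N e 1 \<beta> * m - monic N e m \<tau>"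
proof -
  define g where "g i = (if i = N then 1 else e i)" for i
  \<comment> \<open>Geometric sums of left multiplication by \<open>\<beta>\<close> and right
    multiplication by \<open>\<tau>\<close>, which commute as operators and so telescope. The
    resolvent combines these sums with the coefficients of \<open>G\<close>.\<close>
  define S where "S k = (\<Sum>j<k. \<beta> ^ (k - 1 - j) * m * \<tau> ^ j)" for k
  have SS: "S (Suc k) = \<beta> * S k + m * \<tau> ^ k" for k
  proof -
    have "\<beta> ^ (k - j) = \<beta> * \<beta> ^ (k - 1 - j)" if "j < k" for j
    proof -
      have "k - j = Suc (k - 1 - j)" using that by simp
      then show ?thesis by simp
    qed
    then show ?thesis unfolding S_def by (simp add: sum_distrib_left mult.assoc)
  qed
  have S: "\<beta> * S k - S k * \<tau> = \<beta> ^ k * m - m * \<tau> ^ k" for k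
  proof (induction k)
    case (Suc k)
    have "\<beta> * S (Suc k) - S (Suc k) * \<tau> = \<beta> * (\<beta> * S k - S k * \<tau>) + \<beta> * (m * \<tau> ^ k) - m * \<tau> ^ k * \<tau>"
      unfolding SS by (simp add: algebra_simps)
    also have "\<dots> = \<beta> ^ Suc k * m - m * \<tau> ^ Suc k"
      unfolding Suc by (simp add: algebra_simps power_commutes)
    finally show ?case .
  qed (simp add: S_def)
  have gc: "\<beta> * g i = g i * \<beta>" for i unfolding g_def using central[OF e \<beta>, of i] by simp
  have W: "resolvent N e \<beta> m \<tau> = (\<Sum>i\<le>N. g i * S i)"
  proof -
    have "(\<Sum>i\<le>N. g i * S i) = (\<Sum>i\<le>N. \<Sum>j<i. g i * \<beta> ^ (i - 1 - j) * m * \<tau> ^ j)"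
      unfolding S_def by (simp add: sum_distrib_left mult.assoc)
    also have "\<dots> = resolvent N e \<beta> m \<tau>"
      unfolding sum.nested_swap' atLeastSucAtMost_greaterThanAtMost resolvent_def rcoeff_def g_def
      by (simp only: sum_distrib_right)
    finally show ?thesis by simp
  qed
  have "\<beta> * resolvent N e \<beta> m \<tau> - resolvent N e \<beta> m \<tau> * \<tau> = (\<Sum>i\<le>N. g i * (\<beta> * S i - S i * \<tau>))"
    unfolding W sum_distrib_left sum_distrib_right sum_subtractf[symmetric]
    by (rule sum.cong) (use gc in \<open>auto simp: right_diff_distrib mult.assoc[symmetric]\<close>)
  also have "\<dots> = (\<Sum>i\<le>N. g i * \<beta> ^ i) * m - (\<Sum>i\<le>N. g i * m * \<tau> ^ i)"
    unfolding S by (simp add: right_diff_distrib sum_subtractf sum_distrib_right mult.assoc)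
  also have "(\<Sum>i\<le>N. g i * \<beta> ^ i) = monic N e 1 \<beta>"
    by (simp add: monic_def g_def lessThan_Suc_atMost[symmetric] add.commute)
  also have "(\<Sum>i\<le>N. g i * m * \<tau> ^ i) = monic N e m \<tau>"
    by (simp add: monic_def g_def lessThan_Suc_atMost[symmetric] add.commute)
  finally show ?thesis .
qed

lemma ctr_algebraic: "x \<in> D \<Longrightarrow> algebraic_over (ctr D) x"
  using algebraic_over_mono[OF F_ctr algebraic] .

text \<open>These are the inequalities that \<open>no_rank_one_pole\<close> requires of the
  conjugates of \<open>h\<close> and \<open>inverse h\<close>. Each inequality for \<open>h\<close>
  fails only on a proper additive subgroup, so \<open>h1\<close>, \<open>h2\<close> or
  \<open>h1 + h2\<close> meets both. The inverse is treated by adding a central \<open>t\<close>,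
  which leaves the commutator with \<open>a\<close> unchanged.\<close>

lemma scalar_pole_data:
  assumes a: "a \<in> D" and \<gamma>: "\<gamma> \<in> D" "\<gamma>i \<in> D" "\<gamma> * \<gamma>i = 1" "\<gamma>i * \<gamma> = 1" and nc: "a * \<gamma> \<noteq> \<gamma> * a"
    and m: "minpoly (ctr D) a M f"
  shows "\<exists>h\<in>D. h \<noteq> 0 \<and> (\<forall>b\<in>{\<gamma>, \<gamma>i}. resolvent M f a (b * (a * h - h * a)) a \<noteq> 0 \<and>
    resolvent M f a (b * (a * inverse h - inverse h * a)) a \<noteq> 0)"
proof -
  define y where "y m = resolvent M f a m a" for m
  have f: "\<And>i. f i \<in> ctr D" "M \<ge> 1" and root: "monic M f 1 a = 0"
    using m unfolding minpoly_def monic_def by auto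
  have Gp: "monic M f \<in> polys (ctr D)" by (rule monic_polys[OF div_subring_imp_subring[OF Z] f(1)])
  have Wp: "resolvent M f a \<in> polys D" by (rule resolvent_polys[OF f(1) a])
  have yD: "y m \<in> D" if "m \<in> D" for m unfolding y_def by (rule polys_closed[OF DR Wp that a])
  have ya: "a * y m = y m * a" if "m \<in> D" for m
  proof -
    have "monic M f m a = m * monic M f 1 a"
      using polys_ctr_left_linear[OF DR order_refl Gp that Dc(2) a] by simp
    then show ?thesis using resolvent_eq[where e = f and N = M and \<tau> = a, OF f(1) a that] root unfolding y_def by simp
  qed
  have y_right: "y (x * c) = y x * c" if "c * a = a * c" for x c
    unfolding y_def by (rule polys_right_linear[OF Wp that])
  have y_left: "y (a * x) = a * y x" for x
    unfolding y_def resolvent_def sum_distrib_left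
  proof (rule sum.cong[OF refl])
    fix j
    have "a * rcoeff M f a j = rcoeff M f a j * a" by (rule rcoeff_commute[OF f(1) a refl])
    then show "rcoeff M f a j * (a * x) * a ^ j = a * (rcoeff M f a j * x * a ^ j)"
      by (metis mult.assoc)
  qed
  have y_add: "y (x + z) = y x + y z" for x z unfolding y_def by (rule polys_additive[OF Wp])
  have y_zero: "y 0 = 0" unfolding y_def by (rule polys_zero_arg[OF Wp])
  have y_diff: "y (x - z) = y x - y z" for x z using y_add[of "x - z" z] by simp
  have y_neg: "y (- x) = - y x" for x using y_diff[of 0 x] y_zero by simp
  have y_nz: "\<exists>m\<in>D. y m \<noteq> 0"
  proof (rule ccontr)
    assume "\<not> ?thesis"
    then have "\<And>m. m \<in> D \<Longrightarrow> (\<Sum>j<M. rcoeff M f a j * m * a ^ j) = 0"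
      unfolding y_def resolvent_def by blast
    moreover have "\<exists>j<M. rcoeff M f a j \<noteq> 0"
      using rcoeff_top[OF f(2), of f a] f(2) by (intro exI[of _ "M - 1"]) auto
    moreover have "rcoeff M f a j \<in> D" for j by (rule rcoeff_D[OF f(1) a])
    ultimately obtain c where "\<forall>i. c i \<in> ctr D" "\<exists>i<M. c i \<noteq> 0" "(\<Sum>i<M. c i * a ^ i) = 0"
      using left_right_relation[OF a, of "rcoeff M f a" M] by blast
    then show False using m unfolding minpoly_def by blast
  qed
  have single: "\<exists>h\<in>D. y (b * (a * h - h * a)) \<noteq> 0"
    if b: "b \<in> D" "b' \<in> D" "b * b' = 1" "b' * b = 1" "a * b \<noteq> b * a" for b b'
  proof (rule ccontr)
    assume "\<not> ?thesis"
    then have van: "y (b * (a * h - h * a)) = 0" if "h \<in> D" for h using that by blast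
    \<comment> \<open>Put \<open>b' * h\<close> in place of \<open>h\<close>. Since
      \<open>y (h * a) = y h * a = a * y h = y (a * h)\<close>, the assumption says that
      \<open>y\<close> vanishes on the multiples of \<open>b * a * b' - a\<close>, which is
      invertible; so \<open>y\<close> would vanish on \<open>D\<close>.\<close>
    have zero: "y ((b * a * b' - a) * h) = 0" if h: "h \<in> D" for h
    proof -
      have "b * (a * (b' * h) - b' * h * a) = b * a * b' * h - h * a"
        using b(3) by (simp add: right_diff_distrib mult.assoc[symmetric])
      then have "y (b * a * b' * h) = y h * a"
        using van[OF Dc(4)[OF b(2) h]] y_diff[of "b * a * b' * h" "h * a"] y_right[of a h] by simp
      also have "\<dots> = y (a * h)" using ya[OF h] y_left by simp
      finally show ?thesis unfolding left_diff_distrib y_diff by (simp only: diff_self)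
    qed
    define e where "e = b * a * b' - a"
    have eD: "e \<in> D" unfolding e_def by (intro Dc(7) Dc(4) b(1,2) a)
    have "e \<noteq> 0"
    proof
      assume "e = 0"
      then have "b * a * b' * b = a * b" unfolding e_def by simp
      then have "b * a = a * b" using b(4) by (simp add: mult.assoc)
      then show False using b(5) by simp
    qed
    have "y m = 0" if "m \<in> D" for m
      using zero[OF Dc(4)[OF Dc(6)[OF eD] that]] \<open>e \<noteq> 0\<close> unfolding e_def[symmetric]
      by (simp add: mult.assoc[symmetric])
    then show False using y_nz by blast
  qed
  have nci: "a * \<gamma>i \<noteq> \<gamma>i * a"
  proof
    assume "a * \<gamma>i = \<gamma>i * a"
    then have "\<gamma> * (a * \<gamma>i) * \<gamma> = \<gamma> * (\<gamma>i * a) * \<gamma>" by simp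
    then show False using nc \<gamma>(3,4) by (metis mult.assoc mult_1_left mult_1_right)
  qed
  have lin: "y (b * (a * (h + h') - (h + h') * a)) = y (b * (a * h - h * a)) + y (b * (a * h' - h' * a))" for b h h'
    unfolding y_add[symmetric] by (simp add: algebra_simps)
  obtain h1 where h1: "h1 \<in> D" "y (\<gamma> * (a * h1 - h1 * a)) \<noteq> 0" using single[OF \<gamma> nc] by blast
  obtain h2 where h2: "h2 \<in> D" "y (\<gamma>i * (a * h2 - h2 * a)) \<noteq> 0"
    using single[OF \<gamma>(2,1,4,3) nci] by blast
  have "\<exists>h\<in>D. \<forall>b\<in>{\<gamma>, \<gamma>i}. y (b * (a * h - h * a)) \<noteq> 0"
  proof (cases "y (\<gamma>i * (a * h1 - h1 * a)) = 0")
    case False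
    then show ?thesis using h1 by blast
  next
    case True
    show ?thesis
    proof (cases "y (\<gamma> * (a * h2 - h2 * a)) = 0")
      case False
      then show ?thesis using h2 by blast
    next
      case True': True
      show ?thesis
        by (rule bexI[of _ "h1 + h2"]) (use h1 h2 True True' lin Dc(3) in auto)
    qed
  qed
  then obtain h0 where h0: "h0 \<in> D" "\<And>b. b \<in> {\<gamma>, \<gamma>i} \<Longrightarrow> y (b * (a * h0 - h0 * a)) \<noteq> 0" by blast
  \<comment> \<open>Replace \<open>h0\<close> by \<open>h0 + t\<close>: the inverse is a polynomial in \<open>t\<close> up to a central factor, with a known
    second coefficient.\<close>
  define \<beta> where "\<beta> = - h0"
  have \<beta>: "\<beta> \<in> D" unfolding \<beta>_def by (rule Dc(5)[OF h0(1)])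
  have nc0: "a * \<beta> \<noteq> \<beta> * a" using h0(2)[of \<gamma>] y_zero unfolding \<beta>_def by auto
  obtain N e where mb: "minpoly (ctr D) \<beta> N e" using minpoly_exists[OF Z ctr_algebraic[OF \<beta>]] by blast
  have e: "\<And>i. e i \<in> ctr D" "N \<ge> 1" "monic N e 1 \<beta> = 0" using mb unfolding minpoly_def monic_def by auto
  have N2: "N \<ge> 2"
  proof (rule ccontr)
    assume "\<not> N \<ge> 2"
    then have "N = 1" using e(2) by simp
    then have "\<beta> + e 0 = 0" using e(3) unfolding monic_def by simp
    then have "\<beta> = - e 0" by (simp add: eq_neg_iff_add_eq_0)
    then have "\<beta> \<in> ctr D" using Z_closed(5)[OF e(1)] by simp
    then show False using nc0 central[OF _ a] by simp
  qed
  define V where "V t = resolvent N e \<beta> 1 t" for t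
  have Vp: "resolvent N e \<beta> \<in> polys D" by (rule resolvent_polys[OF e(1) \<beta>])
  \<comment> \<open>The tested value is a polynomial in \<open>t\<close> with coefficients
    \<open>c j\<close>, and \<open>c (N - 2)\<close> equals
    \<open>- y (b * (a * h0 - h0 * a))\<close>, which is nonzero. So only finitely many
    \<open>t\<close> are bad.\<close>
  define bad where "bad b = {t \<in> A. y (b * (a * V t - V t * a)) = 0}" for b
  have fin: "finite (bad b)" if b: "b \<in> {\<gamma>, \<gamma>i}" for b
  proof (rule ccontr)
    assume inf: "infinite (bad b)"
    define c where "c j = y (b * (a * rcoeff N e \<beta> j - rcoeff N e \<beta> j * a))" for j
    have bD: "b \<in> D" using b \<gamma> by blast
    have rD: "rcoeff N e \<beta> j \<in> D" for j by (rule rcoeff_D[OF e(1) \<beta>])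
    have cD: "c j \<in> D" for j unfolding c_def
      by (intro yD Dc(4)[OF bD] Dc(7) Dc(4)[OF a rD] Dc(4)[OF rD a])
    have "\<forall>j<N. c j = 0"
    proof (rule finitely_many_central_roots[OF inf])
      show "t * s = s * t" if "t \<in> bad b" "s \<in> bad b" for t s
        using that comm AD unfolding bad_def by blast
      show "t * c i = c i * t" if "t \<in> bad b" for t i
        using that central[OF _ cD] AD unfolding bad_def by blast
      fix t assume t: "t \<in> bad b"
      then have tc: "t \<in> ctr D" "t \<in> A" unfolding bad_def using AD by auto
      have pc: "t ^ j * x = x * t ^ j" if "x \<in> D" for j x using central[OF Z_closed(8)[OF tc(1)] that] .
      have ta: "t ^ j * a = a * t ^ j" for j by (rule pc[OF a])
      have "b * (a * V t - V t * a) = (\<Sum>j<N. b * (a * rcoeff N e \<beta> j - rcoeff N e \<beta> j * a) * t ^ j)"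
      proof -
        have "b * (a * V t - V t * a) = (\<Sum>j<N. b * (a * (rcoeff N e \<beta> j * t ^ j) - rcoeff N e \<beta> j * t ^ j * a))"
          unfolding V_def resolvent_def by (simp add: sum_distrib_left sum_distrib_right sum_subtractf right_diff_distrib)
        also have "\<dots> = (\<Sum>j<N. b * (a * rcoeff N e \<beta> j - rcoeff N e \<beta> j * a) * t ^ j)"
        proof (rule sum.cong[OF refl])
          fix j
          have "rcoeff N e \<beta> j * t ^ j * a = rcoeff N e \<beta> j * a * t ^ j"
            using ta by (simp add: mult.assoc)
          then show "b * (a * (rcoeff N e \<beta> j * t ^ j) - rcoeff N e \<beta> j * t ^ j * a) =
            b * (a * rcoeff N e \<beta> j - rcoeff N e \<beta> j * a) * t ^ j"
            by (simp add: right_diff_distrib left_diff_distrib mult.assoc)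
        qed
        finally show ?thesis .
      qed
      then have "y (b * (a * V t - V t * a)) = (\<Sum>j<N. y (b * (a * rcoeff N e \<beta> j - rcoeff N e \<beta> j * a) * t ^ j))"
        unfolding y_def using polys_sum_arg[OF Wp] by simp
      also have "\<dots> = (\<Sum>j<N. c j * t ^ j)" unfolding c_def using y_right[OF ta] by simp
      finally show "(\<Sum>j<N. c j * t ^ j) = 0" using t unfolding bad_def by simp
    qed
    then have "c (N - 2) = 0" using N2 by simp
    moreover have "a * rcoeff N e \<beta> (N - 2) - rcoeff N e \<beta> (N - 2) * a = - (a * h0 - h0 * a)"
      unfolding rcoeff_second[OF N2] \<beta>_def
      using central[OF e(1) a, of "N - 1"] by (simp add: algebra_simps)
    ultimately have "y (b * - (a * h0 - h0 * a)) = 0" unfolding c_def by simp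
    then have "y (b * (a * h0 - h0 * a)) = 0" unfolding mult_minus_right y_neg by simp
    then show False using h0(2)[OF b] by blast
  qed
  then have "finite (bad \<gamma> \<union> bad \<gamma>i)" by simp
  then obtain t where t: "t \<in> A" "t \<notin> bad \<gamma> \<union> bad \<gamma>i"
    using infinite_A by (metis finite_subset subsetI)
  have tc: "t \<in> ctr D" using t AD by blast
  have tD: "t \<in> D" using tc ctr_D by blast
  define h where "h = h0 + t"
  have hD: "h \<in> D" unfolding h_def by (rule Dc(3)[OF h0(1) tD])
  have com_h: "a * h - h * a = a * h0 - h0 * a"
    unfolding h_def using central[OF tc a] by (simp add: algebra_simps)
  have h_nz: "h \<noteq> 0" using com_h h0(2)[of \<gamma>] y_zero by auto
  define G where "G = monic N e 1 t"
  have Gc: "G \<in> ctr D" unfolding G_def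
    by (rule polys_closed[OF div_subring_imp_subring[OF Z] monic_polys[OF div_subring_imp_subring[OF Z] e(1)] Z_closed(2) tc])
  have VD: "V t \<in> D" unfolding V_def by (rule polys_closed[OF DR Vp Dc(2) tD])
  have "\<beta> * V t - V t * t = - G"
    using resolvent_eq[where e = e and N = N and \<tau> = t, OF e(1) \<beta> Dc(2)] e(3) unfolding V_def G_def by simp
  moreover have "V t * t = t * V t" using central[OF tc VD] by simp
  \<comment> \<open>Here \<open>h = t - \<beta>\<close>, so the resolvent inverts \<open>h\<close>
    up to the central factor \<open>G\<close>.\<close>
  ultimately have hV: "h * V t = G" unfolding h_def \<beta>_def
    by (simp add: distrib_right) (metis add.inverse_inverse minus_diff_eq diff_minus_eq_add add.commute)
  have V_nz: "V t \<noteq> 0" using t y_zero unfolding bad_def by auto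
  have G_nz: "G \<noteq> 0" using hV h_nz V_nz by auto
  define s where "s = inverse G"
  have sc: "s \<in> ctr D" unfolding s_def by (rule Z_closed(6)[OF Gc])
  have "h * (V t * s) = 1" using hV G_nz unfolding s_def by (simp add: mult.assoc[symmetric])
  then have hi: "inverse h = V t * s" by (rule inverse_unique)
  have "y (b * (a * inverse h - inverse h * a)) \<noteq> 0" if b: "b \<in> {\<gamma>, \<gamma>i}" for b
  proof -
    have sa: "s * a = a * s" by (rule central[OF sc a])
    have "b * (a * inverse h - inverse h * a) = b * (a * V t - V t * a) * s"
      unfolding hi using sa by (simp add: right_diff_distrib left_diff_distrib mult.assoc)
    then have "y (b * (a * inverse h - inverse h * a)) = y (b * (a * V t - V t * a)) * s"
      using y_right[OF sa] by simp
    moreover have "s \<noteq> 0" unfolding s_def using G_nz by simp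
    moreover have "y (b * (a * V t - V t * a)) \<noteq> 0" using t b unfolding bad_def by auto
    ultimately show ?thesis by simp
  qed
  then show ?thesis using hD h_nz h0(2) com_h unfolding y_def by (intro bexI[of _ h]) auto
qed

text \<open>The place is \<open>t = 0\<close>, with minimal polynomial \<open>X\<close> over either
  field and centralizer \<open>D\<close>. The matrix \<open>t * E (c / t)\<close> is polynomial in
  \<open>t\<close> and becomes \<open>c u \<phi>\<close> at 0. One computation with
  \<open>c = 1\<close> and \<open>c = - 1\<close> covers the family and its inverse.\<close>

lemma no_noncentral_bounded_matrix:
  assumes as: "almost_subnormal H (GL n)" and n: "n \<ge> 2" and g: "g \<in> H" "g \<in> carrier (GL n)" "g \<in> mats n"
    and gi: "inv\<^bsub>GL n\<^esub> g \<in> mats n" and x0: "x0 \<in> mats n" "g * x0 \<noteq> x0 * g"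
    and HL: "\<And>h p q. h \<in> H \<Longrightarrow> p < n \<Longrightarrow> q < n \<Longrightarrow> h $$ (p, q) \<in> \<Lambda>" and L: "no_poles \<Lambda>"
  shows False
proof -
  interpret K: group "GL n :: 'a mat monoid" by (rule GL_group)
  interpret pole D A C n 0 1 "\<lambda>_. 0" 1 "\<lambda>_. 0"
    by unfold_locales (auto intro: Dc(1) minpoly_zero FR div_subring_imp_subring[OF Z] simp del: One_nat_def)
  define gi where "gi = inv\<^bsub>GL n\<^esub> g"
  have gg: "g * gi = 1\<^sub>m n" "gi * g = 1\<^sub>m n"
    using K.r_inv[OF g(2)] K.l_inv[OF g(2)] unfolding GL_simps gi_def by auto
  obtain u \<phi> where u: "u \<in> nvecs n" "\<And>i. \<phi> i \<in> D" "(\<Sum>i<n. \<phi> i * u i) = 0"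
    "(\<Sum>i<n. \<phi> i * mulv n g u i) \<noteq> 0" "(\<Sum>i<n. \<phi> i * mulv n gi u i) \<noteq> 0"
    using noncentral_transvection_pair[OF g(3) gi[folded gi_def] gg x0 n] by blast
  have uD: "u i \<in> D" for i using u(1) unfolding nvecs_def by blast
  define y where "y v = (\<Sum>i<n. \<phi> i * v i)" for v
  define E where "E s = mat n n (\<lambda>(i, j). (if i = j then 1 else 0) + s * (u i * \<phi> j))" for s
  have E_car: "E s \<in> carrier_mat n n" for s unfolding E_def by simp
  have E_mats: "E s \<in> mats n" if "s \<in> D" for s
    unfolding mats_def E_def using that uD u(2) Dc(1-4) by auto
  have E_inv: "E s * E (- s) = 1\<^sub>m n" if s: "s \<in> ctr D" for s
  proof (rule eq_matI)
    fix i j assume "i < dim_row (1\<^sub>m n)" "j < dim_col (1\<^sub>m n)"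
    then have ij: "i < n" "j < n" by auto
    have sphi: "\<phi> r * s = s * \<phi> r" for r using central[OF s u(2)] by simp
    have "(E s * E (- s)) $$ (i, j) = (\<Sum>r<n. ((if i = r then 1 else 0) + s * (u i * \<phi> r)) * ((if r = j then 1 else 0) - s * (u r * \<phi> j)))"
      unfolding mat_mult_index[OF E_car E_car ij] using ij by (auto simp: E_def intro!: sum.cong)
    also have "\<dots> = (\<Sum>r<n. (if i = r then (if r = j then 1 else 0) - s * (u r * \<phi> j) else 0)
      + (if r = j then s * (u i * \<phi> r) else 0) - s * (u i * (s * (\<phi> r * u r * \<phi> j))))"
    proof (rule sum.cong[OF refl])
      fix r
      have "\<phi> r * (s * (u r * \<phi> j)) = s * (\<phi> r * u r * \<phi> j)" using sphi by (metis mult.assoc)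
      then have "s * (u i * \<phi> r) * (s * (u r * \<phi> j)) = s * (u i * (s * (\<phi> r * u r * \<phi> j)))"
        by (simp add: mult.assoc)
      then show "((if i = r then 1 else 0) + s * (u i * \<phi> r)) * ((if r = j then 1 else 0) - s * (u r * \<phi> j)) =
        (if i = r then (if r = j then 1 else 0) - s * (u r * \<phi> j) else 0)
        + (if r = j then s * (u i * \<phi> r) else 0) - s * (u i * (s * (\<phi> r * u r * \<phi> j)))"
        by (simp add: distrib_right right_diff_distrib)
    qed
    also have "\<dots> = (if i = j then 1 else 0) - s * (u i * (s * ((\<Sum>r<n. \<phi> r * u r) * \<phi> j)))"
      using ij by (simp add: sum.distrib sum_subtractf sum_distrib_left sum_distrib_right)
    finally show "(E s * E (- s)) $$ (i, j) = 1\<^sub>m n $$ (i, j)" using ij u(3) by simp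
  qed (simp_all add: E_def)
  have G: "G 1 t = t" for t :: 'a by (simp add: monic_def)
  have t_nz: "t \<noteq> 0" if "t \<in> T" for t using that unfolding T_def by (simp add: monic_def)
  have tc: "inverse t \<in> ctr D" "- inverse t \<in> ctr D" if "t \<in> T" for t
    using Z_closed(5,6) T_A(2)[OF that] by auto
  have E_inv': "E (- inverse t) * E (inverse t) = 1\<^sub>m n" if "t \<in> T" for t
    using E_inv[OF tc(2)[OF that]] by simp
  have EGL: "E (inverse t) \<in> carrier (GL n)" if "t \<in> T" for t
    unfolding GL_carrier using E_car E_inv[OF tc(1)[OF that]] E_inv'[OF that] by blast
  have invE: "inv\<^bsub>GL n\<^esub> (E (inverse t)) = E (- inverse t)" if "t \<in> T" for t
    by (rule GL_inv[OF E_car E_car E_inv'[OF that] E_inv[OF tc(1)[OF that]]])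
  have res: "polar (\<lambda>t. E (c * inverse t)) (\<lambda>v. scale_vec (scale_vec u c) (y v))" if c: "c \<in> ctr D" for c
  proof -
    have cD: "c \<in> D" using c ctr_D by blast
    define P where "P p q = (\<lambda>m \<tau>. (if p = q then m * \<tau> else 0) + c * (u p * \<phi> q) * m)" for p q :: nat
    have "(\<lambda>m \<tau>. if p = q then m * \<tau> else 0) \<in> polys D" for p q :: nat
      by (cases "p = q") (auto intro: polys.var polys_zero[OF DR])
    then have P: "P p q \<in> polys D" for p q unfolding P_def
      by (rule polys.add[OF _ polys.const]) (intro Dc(4) cD uD u(2))
    have "G 1 t ^ 1 * E (c * inverse t) $$ (p, q) = P p q 1 t" if t: "t \<in> T" and pq: "p < n" "q < n" for t p q
    proof -
      have "t * c = c * t" using central[OF c] T_A(3)[OF t] by simp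
      then have "t * (c * inverse t * (u p * \<phi> q)) = c * (t * inverse t) * (u p * \<phi> q)"
        by (metis mult.assoc)
      then show ?thesis unfolding G P_def E_def using pq t_nz[OF t] by (simp add: distrib_left)
    qed
    moreover have "scale_vec (scale_vec u c) (y v) = (\<lambda>p. if p < n then \<Sum>q<n. P p q (v q) 0 else 0)"
      if "v \<in> nvecs n" for v
    proof
      fix p
      have "u p * c = c * u p" using central[OF c uD] by simp
      then have "scale_vec (scale_vec u c) (y v) p = c * u p * y v" by (simp add: scale_vec_def)
      also have "\<dots> = (\<Sum>q<n. P p q (v q) 0)"
        unfolding P_def y_def by (simp add: sum_distrib_left mult.assoc cong: if_cong)
      finally have eq: "scale_vec (scale_vec u c) (y v) p = (\<Sum>q<n. P p q (v q) 0)" .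
      show "scale_vec (scale_vec u c) (y v) p = (if p < n then \<Sum>q<n. P p q (v q) 0 else 0)"
      proof (cases "p < n")
        case False
        then have "u p = 0" using u(1) unfolding nvecs_def by simp
        then show ?thesis using False by (simp add: scale_vec_def)
      qed (simp add: eq)
    qed
    moreover have "E (c * inverse t) \<in> mats n" if "t \<in> T" for t
      using E_mats Dc(4)[OF cD] Dc(6)[OF T_A(3)[OF that]] by blast
    ultimately have "residue 1 (\<lambda>t. E (c * inverse t)) (\<lambda>v. scale_vec (scale_vec u c) (y v))"
      unfolding residue_def using P by blast
    then show ?thesis unfolding polar_def by blast
  qed
  have one: "1 \<in> ctr D" "- 1 \<in> ctr D" using Z_closed(2,5) by auto
  have y_scale: "y (scale_vec w c) = y w * c" for w c
    unfolding y_def scale_vec_def by (simp add: sum_distrib_right mult.assoc)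
  have centD: "cent = D" unfolding cent_def by auto
  have s1: "scale_vec u 1 = u" unfolding scale_vec_def by simp
  show False
  proof (rule no_rank_one_pole[OF as g(1,3) gi g(2) HL L EGL])
    show "polar (\<lambda>t. E (inverse t)) (\<lambda>v. scale_vec u (y v))" using res[OF one(1)] unfolding s1 by simp
    show "polar (\<lambda>t. inv\<^bsub>GL n\<^esub> E (inverse t)) (\<lambda>v. scale_vec (scale_vec u (- 1)) (y v))"
      by (rule polar_cong[OF res[OF one(2)]]) (simp_all add: invE)
    show "u \<in> nvecs n" by (rule u(1))
    show "scale_vec u (- 1) \<in> nvecs n" by (rule scale_nvecs[OF u(1)]) (use one ctr_D in blast)
    show "y v \<in> cent" if "v \<in> nvecs n" for v
      unfolding centD y_def using that u(2) by (auto simp: nvecs_def intro!: div_subring_sum[OF D] Dc(4))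
    show "y (scale_vec w c) = y w * c" for w c by (rule y_scale)
    show "y (mulv n g u) \<noteq> 0" "y (mulv n (inv\<^bsub>GL n\<^esub> g) u) \<noteq> 0"
      using u(4,5) unfolding y_def gi_def by auto
    then show "y (mulv n g (scale_vec u (- 1))) \<noteq> 0" "y (mulv n (inv\<^bsub>GL n\<^esub> g) (scale_vec u (- 1))) \<noteq> 0"
      unfolding mulv_scale y_scale by auto
  qed auto
qed

text \<open>Multiplying \<open>(a - t) k (a - t)^-1\<close> by \<open>G\<close> gives
  \<open>- (a - t) k W\<close>, where \<open>W\<close> is the resolvent. At \<open>t = a\<close>
  this becomes \<open>(k a - a k) W\<close>, because \<open>W\<close> then takes values in the
  centralizer of \<open>a\<close>. The inverse of a conjugate is the conjugate of the inverse, so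
  the formula serves for \<open>k = h\<close> and \<open>k = inverse h\<close>.\<close>

lemma no_noncentral_bounded_scalar:
  assumes as: "almost_subnormal H (GL 1)" and g: "g \<in> H" "g \<in> carrier (GL 1)" "g \<in> mats 1"
    and gi: "inv\<^bsub>GL 1\<^esub> g \<in> mats 1" and x0: "x0 \<in> mats 1" "g * x0 \<noteq> x0 * g"
    and HL: "\<And>h p q. h \<in> H \<Longrightarrow> p < 1 \<Longrightarrow> q < 1 \<Longrightarrow> h $$ (p, q) \<in> \<Lambda>" and L: "no_poles \<Lambda>"
  shows False
proof -
  interpret K: group "GL 1 :: 'a mat monoid" by (rule GL_group)
  have idx: "(M * M') $$ (0, 0) = M $$ (0, 0) * M' $$ (0, 0)"
    if "M \<in> carrier_mat 1 1" "M' \<in> carrier_mat 1 1" for M M' :: "'a mat"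
    using mat_mult_index[OF that] by simp
  have mat1_eqI: "M = M'" if "M \<in> carrier_mat 1 1" "M' \<in> carrier_mat 1 1" "M $$ (0, 0) = M' $$ (0, 0)"
    for M M' :: "'a mat"
    by (rule eq_matI) (use that in auto)
  have car: "g \<in> carrier_mat 1 1" "inv\<^bsub>GL 1\<^esub> g \<in> carrier_mat 1 1" "x0 \<in> carrier_mat 1 1"
    using g(3) gi x0(1) unfolding mats_def by auto
  define \<gamma> where "\<gamma> = g $$ (0, 0)"
  define \<gamma>i where "\<gamma>i = (inv\<^bsub>GL 1\<^esub> g) $$ (0, 0)"
  define a where "a = x0 $$ (0, 0)"
  have mem: "\<gamma> \<in> D" "\<gamma>i \<in> D" "a \<in> D" using g(3) gi x0(1) unfolding mats_def \<gamma>_def \<gamma>i_def a_def by auto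
  have \<gamma>\<gamma>: "\<gamma> * \<gamma>i = 1" "\<gamma>i * \<gamma> = 1"
    using idx[OF car(1,2)] idx[OF car(2,1)] K.r_inv[OF g(2)] K.l_inv[OF g(2)]
    unfolding GL_simps \<gamma>_def \<gamma>i_def by auto
  have nc: "a * \<gamma> \<noteq> \<gamma> * a"
  proof
    assume "a * \<gamma> = \<gamma> * a"
    then have "g * x0 = x0 * g"
      using mat1_eqI[of "g * x0" "x0 * g"] idx[OF car(1,3)] idx[OF car(3,1)] car
      unfolding \<gamma>_def a_def by auto
    then show False using x0(2) by blast
  qed
  obtain M f where mp: "minpoly (ctr D) a M f" using minpoly_exists[OF Z ctr_algebraic[OF mem(3)]] by blast
  obtain N0 f0 where mp0: "minpoly (fracs A) a N0 f0" using minpoly_exists[OF F algebraic[OF mem(3)]] by blast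
  interpret pole D A C 1 a M f N0 f0 by unfold_locales (use mem(3) mp mp0 in auto)
  define W where "W = resolvent M f a"
  have W: "W \<in> polys D" unfolding W_def by (rule resolvent_polys[OF coeffs(1) mem(3)])
  have Weq: "a * W m \<tau> - W m \<tau> * \<tau> = - G m \<tau>" if "m \<in> D" for m \<tau>
    unfolding W_def using resolvent_eq[where e = f and N = M and \<tau> = \<tau>, OF coeffs(1) mem(3) that] G_root by simp
  have WD: "W m a \<in> D" if "m \<in> D" for m by (rule polys_closed[OF DR W that mem(3)])
  have Wa: "W m a * a = a * W m a" if "m \<in> D" for m
  proof -
    have "G m a = m * G 1 a"
      using polys_ctr_left_linear[OF DR order_refl G_polys_ctr that Dc(2) mem(3)] by simp
    then show ?thesis using Weq[OF that, of a] G_root by simp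
  qed
  obtain h where h: "h \<in> D" "h \<noteq> 0" "\<And>b. b \<in> {\<gamma>, \<gamma>i} \<Longrightarrow> W (b * (a * h - h * a)) a \<noteq> 0"
    "\<And>b. b \<in> {\<gamma>, \<gamma>i} \<Longrightarrow> W (b * (a * inverse h - inverse h * a)) a \<noteq> 0"
    using scalar_pole_data[OF mem(3,1,2) \<gamma>\<gamma> nc mp] unfolding W_def by blast
  have t_nz: "a - t \<noteq> 0" if "t \<in> T" for t
    using central[OF T_A(2)[OF that] mem(1)] nc by auto
  define x where "x k t = mat 1 1 (\<lambda>_::nat \<times> nat. (a - t) * k * inverse (a - t))" for k t
  have x_car: "x k t \<in> carrier_mat 1 1" "x k t $$ (0, 0) = (a - t) * k * inverse (a - t)" for k t
    unfolding x_def by auto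
  have x_mats: "x k t \<in> mats 1" if "k \<in> D" "t \<in> T" for k t
    unfolding mats_def using x_car that mem(3) T_A(3) by (auto intro!: Dc(4) Dc(6) Dc(7))
  have x_mult: "x k t * x k' t = 1\<^sub>m 1" if "k * k' = 1" "t \<in> T" for k k' t
  proof (rule mat1_eqI)
    have "(a - t) * k * inverse (a - t) * ((a - t) * k' * inverse (a - t))
      = (a - t) * (k * (inverse (a - t) * (a - t)) * k') * inverse (a - t)" by (simp only: mult.assoc)
    also have "\<dots> = 1" using t_nz[OF that(2)] that(1) by simp
    finally show "(x k t * x k' t) $$ (0, 0) = 1\<^sub>m 1 $$ (0, 0)"
      using idx[OF x_car(1) x_car(1)] x_car(2) by simp
  qed (rule mult_carrier_mat[OF x_car(1) x_car(1)], rule one_carrier_mat)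
  have hh: "h * inverse h = 1" "inverse h * h = 1" using h(2) by auto
  have xGL: "x h t \<in> carrier (GL 1)" if "t \<in> T" for t
    unfolding GL_carrier using x_car x_mult[OF hh(1) that] x_mult[OF hh(2) that] by blast
  have invx: "inv\<^bsub>GL 1\<^esub> (x h t) = x (inverse h) t" if "t \<in> T" for t
    by (rule GL_inv[OF x_car(1) x_car(1) x_mult[OF hh(2) that] x_mult[OF hh(1) that]])
  define \<delta> where "\<delta> k = (\<lambda>i::nat. if i = 0 then k * a - a * k else 0)" for k
  define y where "y v = W (v 0) a" for v :: "nat \<Rightarrow> 'a"
  have res: "polar (x k) (\<lambda>v. scale_vec (\<delta> k) (y v))" if k: "k \<in> D" for k
  proof -
    define P where "P = (\<lambda>m \<tau>. - a * (k * W m \<tau>) + (k * W m \<tau>) * \<tau>)"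
    have Q: "(\<lambda>m \<tau>. k * W m \<tau>) \<in> polys D" by (rule polys.mult[OF polys.const[OF k] W])
    have P: "P \<in> polys D" unfolding P_def
      by (rule polys.add[OF polys.mult[OF polys.const[OF Dc(5)[OF mem(3)]] Q] polys.mult[OF polys.var Q]])
    have "G 1 t * x k t $$ (0, 0) = P 1 t" if t: "t \<in> T" for t
    proof -
      have tD: "t \<in> D" by (rule T_A(3)[OF t])
      have w: "W 1 t \<in> D" by (rule polys_closed[OF DR W Dc(2) tD])
      have "(a - t) * W 1 t = - G 1 t"
        using Weq[OF Dc(2), of t] central[OF T_A(2)[OF t] w] by (simp add: left_diff_distrib)
      then have "inverse (a - t) * G 1 t = inverse (a - t) * (a - t) * - W 1 t"
        by (simp add: mult.assoc)
      then have r: "inverse (a - t) * G 1 t = - W 1 t" using t_nz[OF t] by simp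
      have "G 1 t * ((a - t) * k * inverse (a - t)) = (a - t) * k * (inverse (a - t) * G 1 t)"
        using central[OF G_pow_ctr[OF t, of 1], of "(a - t) * k * inverse (a - t)"] mem(3) tD k
        by (simp add: Dc mult.assoc)
      also have "\<dots> = - ((a - t) * (k * W 1 t))" unfolding r by (simp add: mult.assoc)
      also have "\<dots> = P 1 t"
        unfolding P_def using central[OF T_A(2)[OF t] Dc(4)[OF k w]] by (simp add: left_diff_distrib)
      finally show ?thesis using x_car(2) by simp
    qed
    moreover have "scale_vec (\<delta> k) (y v) = (\<lambda>p. if p < 1 then \<Sum>q<1. P (v q) a else 0)"
      if v: "v \<in> nvecs 1" for v
    proof
      fix p :: nat
      have "v 0 \<in> D" using v unfolding nvecs_def by blast
      then have "P (v 0) a = (k * a - a * k) * W (v 0) a"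
        unfolding P_def using Wa by (simp add: left_diff_distrib mult.assoc)
      then show "scale_vec (\<delta> k) (y v) p = (if p < 1 then \<Sum>q<1. P (v q) a else 0)"
        by (simp add: scale_vec_def \<delta>_def y_def)
    qed
    ultimately show ?thesis unfolding polar_def residue_def using P x_mats[OF k]
      by (intro exI[of _ 1] conjI ballI exI[of _ "\<lambda>p q. P"]) auto
  qed
  have hi: "inverse h \<in> D" by (rule Dc(6)[OF h(1)])
  have \<delta>n: "\<delta> k \<in> nvecs 1" if "k \<in> D" for k
    unfolding nvecs_def \<delta>_def using Dc(1) Dc(7)[OF Dc(4)[OF that mem(3)] Dc(4)[OF mem(3) that]] by auto
  have neg: "W (b * (k * a - a * k)) a = - W (b * (a * k - k * a)) a" for b k
    using polys_right_linear[OF W, of "- 1" a "b * (a * k - k * a)"] by (simp add: algebra_simps)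
  have ymul: "y (mulv 1 B (\<delta> k)) = W (B $$ (0, 0) * (k * a - a * k)) a" for B k
    unfolding y_def mulv_def \<delta>_def by simp
  show False
  proof (rule no_rank_one_pole[OF as g(1,3) gi g(2) HL L xGL])
    show "polar (x h) (\<lambda>v. scale_vec (\<delta> h) (y v))" by (rule res[OF h(1)])
    show "polar (\<lambda>t. inv\<^bsub>GL 1\<^esub> x h t) (\<lambda>v. scale_vec (\<delta> (inverse h)) (y v))"
      by (rule polar_cong[OF res[OF hi]]) (simp_all only: invx)
    show "\<delta> h \<in> nvecs 1" "\<delta> (inverse h) \<in> nvecs 1" using \<delta>n h(1) hi by blast+
    show "y v \<in> cent" if "v \<in> nvecs 1" for v
      unfolding cent_def y_def using that Wa WD by (auto simp: nvecs_def)
    show "y (scale_vec w c) = y w * c" if "c \<in> cent" for w c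
      unfolding y_def scale_vec_def by (rule polys_right_linear[OF W]) (use that in \<open>auto simp: cent_def\<close>)
    show "y (mulv 1 g (\<delta> h)) \<noteq> 0" "y (mulv 1 (inv\<^bsub>GL 1\<^esub> g) (\<delta> h)) \<noteq> 0"
      "y (mulv 1 g (\<delta> (inverse h))) \<noteq> 0" "y (mulv 1 (inv\<^bsub>GL 1\<^esub> g) (\<delta> (inverse h))) \<noteq> 0"
      unfolding ymul neg \<gamma>_def[symmetric] \<gamma>i_def[symmetric] using h(3,4) by auto
  qed auto
qed

end

section \<open>Entries of a finitely generated matrix group, and conclusion\<close>

lemma finite_mats:
  assumes "finite X" shows "finite {M \<in> carrier_mat n n. \<forall>i<n. \<forall>j<n. M $$ (i, j) \<in> X}"
proof (rule finite_subset)
  show "{M \<in> carrier_mat n n. \<forall>i<n. \<forall>j<n. M $$ (i, j) \<in> X} \<subseteq>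
    mat n n ` (PiE ({..<n} \<times> {..<n}) (\<lambda>_. X))"
  proof
    fix M assume M: "M \<in> {M \<in> carrier_mat n n. \<forall>i<n. \<forall>j<n. M $$ (i, j) \<in> X}"
    define f where "f = restrict (\<lambda>ij. M $$ ij) ({..<n} \<times> {..<n})"
    have "f \<in> PiE ({..<n} \<times> {..<n}) (\<lambda>_. X)" using M unfolding f_def by auto
    moreover have "M = mat n n f" by (rule eq_matI) (use M in \<open>auto simp: f_def\<close>)
    ultimately show "M \<in> mat n n ` (PiE ({..<n} \<times> {..<n}) (\<lambda>_. X))" by blast
  qed
  show "finite (mat n n ` (PiE ({..<n} \<times> {..<n}) (\<lambda>_. X)))"
    by (intro finite_imageI finite_PiE) (auto simp: assms)
qed

lemma generate_GL_entries:
  fixes X :: "'a::division_ring set"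
  assumes X: "0 \<in> X" "1 \<in> X" "\<And>x y. x \<in> X \<Longrightarrow> y \<in> X \<Longrightarrow> x + y \<in> X" "\<And>x y. x \<in> X \<Longrightarrow> y \<in> X \<Longrightarrow> x * y \<in> X"
    and S: "S \<subseteq> carrier (GL n)"
    and ent: "\<And>s p q. s \<in> S \<Longrightarrow> p < n \<Longrightarrow> q < n \<Longrightarrow> s $$ (p, q) \<in> X \<and> (inv\<^bsub>GL n\<^esub> s) $$ (p, q) \<in> X"
    and h: "h \<in> generate (GL n) S"
  shows "h \<in> {M \<in> carrier_mat n n. \<forall>i<n. \<forall>j<n. M $$ (i, j) \<in> X}"
proof -
  interpret K: group "GL n :: 'a mat monoid" by (rule GL_group)
  have car: "s \<in> carrier_mat n n" "inv\<^bsub>GL n\<^esub> s \<in> carrier_mat n n" if "s \<in> S" for s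
    using S that K.inv_closed[of s] GL_carrier[of _ n] by blast+
  have sumX: "sum f I \<in> X" if "\<And>i. i \<in> I \<Longrightarrow> f i \<in> X" for f :: "nat \<Rightarrow> 'a" and I
    using that by (induction I rule: infinite_finite_induct) (auto intro: X)
  show ?thesis using h
  proof induction
    case (eng h1 h2)
    then show ?case by (auto simp: GL_simps scalar_prod_def intro!: sumX X(4))
  qed (use car ent X in \<open>auto simp: GL_simps\<close>)
qed

theorem theorem5p4:
  fixes G :: "'a::division_ring mat set" and n :: nat
  assumes "weakly_locally_finite TYPE('a)"
    and "n \<ge> 1"
    and "subgroup G (GL n)"
    and "infinite G"
    and "almost_subnormal G (GL n)"
    and "\<exists>S. finite S \<and> S \<subseteq> carrier (GL n) \<and> G = generate (GL n) S"
  shows "G \<subseteq> group_center (GL n)"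
proof (rule ccontr)
  interpret K: group "GL n :: 'a mat monoid" by (rule GL_group)
  obtain S where S: "finite S" "S \<subseteq> carrier (GL n)" "G = generate (GL n) S" using assms(6) by blast
  assume "\<not> ?thesis"
  then obtain g where g: "g \<in> G" "g \<notin> group_center (GL n)" by blast
  have gGL: "g \<in> carrier (GL n)" using g(1) subgroup.subset[OF assms(3)] by blast
  obtain x0 where x0: "x0 \<in> carrier (GL n)" "g * x0 \<noteq> x0 * g"
    using g(2) gGL unfolding group_center_def GL_simps by blast
  \<comment> \<open>The entries of \<open>g\<close> and of the witness \<open>x0\<close> are
    collected as well, so that \<open>g\<close> remains noncentral among the matrices over
    \<open>D\<close>.\<close>
  define S' where "S' = insert g (insert x0 S)"
  have S': "S' \<subseteq> carrier (GL n)" "finite S'" unfolding S'_def using S gGL x0 by auto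
  define Ms where "Ms = S' \<union> (\<lambda>s. inv\<^bsub>GL n\<^esub> s) ` S'"
  \<comment> \<open>The entry 1 is included for the identity matrix, since the order obtained from
    \<open>X\<close> is only known to contain \<open>X\<close> and 0.\<close>
  define X where "X = insert 1 ((\<lambda>(M, p, q). M $$ (p, q)) ` (Ms \<times> {..<n} \<times> {..<n}))"
  have finX: "finite X" unfolding X_def Ms_def using S'(2) by auto
  have entX: "M $$ (p, q) \<in> X" if "M \<in> Ms" "p < n" "q < n" for M p q unfolding X_def using that by force
  have oneX: "1 \<in> X" unfolding X_def by simp
  have MsC: "M \<in> carrier_mat n n" if "M \<in> Ms" for M
    using that S'(1) K.inv_closed GL_carrier[of _ n] unfolding Ms_def by blast
  obtain D where DS: "div_subring D" and XD: "X \<subseteq> D" and cases: "finite D \<or>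
    (\<exists>A C. is_subring A \<and> nonunit_values A \<and> A \<subseteq> ctr D \<and> finite C \<and> C \<subseteq> D \<and> D \<subseteq> spn (fracs A) C)"
    using arithmetic_order_exists[OF assms(1) finX] by blast
  have entries: "h \<in> {M \<in> carrier_mat n n. \<forall>i<n. \<forall>j<n. M $$ (i, j) \<in> Y}"
    if "h \<in> G" "X \<subseteq> Y" "0 \<in> Y" "\<And>x y. x \<in> Y \<Longrightarrow> y \<in> Y \<Longrightarrow> x + y \<in> Y" "\<And>x y. x \<in> Y \<Longrightarrow> y \<in> Y \<Longrightarrow> x * y \<in> Y" for h Y
  proof (rule generate_GL_entries[OF that(3) _ that(4,5) S(2)])
    show "s $$ (p, q) \<in> Y \<and> (inv\<^bsub>GL n\<^esub> s) $$ (p, q) \<in> Y" if "s \<in> S" "p < n" "q < n" for s p q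
    proof -
      have "s \<in> Ms" "inv\<^bsub>GL n\<^esub> s \<in> Ms" using that(1) unfolding Ms_def S'_def by auto
      then show ?thesis using entX that(2,3) \<open>X \<subseteq> Y\<close> by blast
    qed
  qed (use that oneX S(3) in auto)
  from cases show False
  proof
    assume fin: "finite D"
    have "G \<subseteq> {M \<in> carrier_mat n n. \<forall>i<n. \<forall>j<n. M $$ (i, j) \<in> D}"
      using entries[OF _ XD] div_subringD(1,3,4)[OF DS] by blast
    then show False using finite_mats[OF fin] finite_subset assms(4) by blast
  next
    assume "\<exists>A C. is_subring A \<and> nonunit_values A \<and> A \<subseteq> ctr D \<and> finite C \<and> C \<subseteq> D \<and> D \<subseteq> spn (fracs A) C"
    then obtain A C where AC: "is_subring A" "nonunit_values A" "A \<subseteq> ctr D" "finite C" "C \<subseteq> D"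
      "D \<subseteq> spn (fracs A) C" by blast
    interpret arithmetic_order D A C by unfold_locales (use DS AC in auto)
    obtain \<Lambda> where L: "X \<subseteq> \<Lambda>" "0 \<in> \<Lambda>" "\<And>x y. x \<in> \<Lambda> \<Longrightarrow> y \<in> \<Lambda> \<Longrightarrow> x + y \<in> \<Lambda>"
      "\<And>x y. x \<in> \<Lambda> \<Longrightarrow> y \<in> \<Lambda> \<Longrightarrow> x * y \<in> \<Lambda>" "no_poles \<Lambda>"
      using bounded_order_exists[OF finX XD] by blast
    have GL: "h $$ (p, q) \<in> \<Lambda>" if "h \<in> G" "p < n" "q < n" for h p q
      using entries[OF that(1) L(1-4)] that(2,3) by blast
    have mats: "M \<in> mats n" if "M \<in> Ms" for M
      unfolding mats_def using MsC[OF that] entX[OF that] XD by blast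
    have m: "g \<in> mats n" "inv\<^bsub>GL n\<^esub> g \<in> mats n" "x0 \<in> mats n"
      by (rule mats, simp add: Ms_def S'_def)+
    show False
    proof (cases "n = 1")
      case True
      show False
        by (rule no_noncentral_bounded_scalar[of G g x0 \<Lambda>]) (use assms(5) g(1) gGL m x0(2) GL L(5) True in auto)
    next
      case False
      then have "n \<ge> 2" using assms(2) by simp
      then show False
        using no_noncentral_bounded_matrix[OF assms(5) _ g(1) gGL m(1,2,3) x0(2) GL L(5)] by blast
    qed
  qed
qed

end
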